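(* Let $\mathfrak g=C_n^{(1)}$ with $n\ge2$ and $1\le r\le n$. Then the virtual crystal $V^{r,1}$ is an aligned $U_q'(C_n^{(1)})$-crystal and $V^{r,1}\cong V(\overline\Lambda_r)$ as a $U_q(C_n)$-crystal.
   Context: TYPE A CRYSTALS. $\varnothing$ means "undefined"; $\epsilon_i(b)=\max\{m:e_i^m(b)\ne\varnothing\}$, $\varphi_i(b)=\max\{m:f_i^m(b)\ne\varnothing\}$. Tensor convention: $f_i(b_2\otimes b_1)=f_i(b_2)\otimes b_1$ if $\epsilon_i(b_2)\ge\varphi_i(b_1)$ and $b_2\otimes f_i(b_1)$ otherwise; $e_i(b_2\otimes b_1)=e_i(b_2)\otimes b_1$ if $\epsilon_i(b_2)>\varphi_i(b_1)$ and $b_2\otimes e_i(b_1)$ otherwise. Letters are $[2n]$ with $f_i^A(i)=i+1$ ($1\le i\le 2n-1$), all other values $\varnothing$; words are tensor products of letters; a semistandard tableau is identified with its column-reading word $c_1c_2\cdots$, $c_j$ being the strictly decreasing word of the $j$-th column. $\mathbb P(w)$ is the Schensted tableau of $w$ (the unique semistandard tableau Knuth equivalent to $w$). $B_A^{r,s}$ is the set of semistandard tableaux in $[2n]$ of rectangular shape with $r$ rows and $s$ columns. The bijection $\psi$ of $B_A^{r,s}$ is such that $\psi^{-1}(t)$ is obtained by deleting the letters $1$ from $t$, applying $\mathbb P$, subtracting $1$ from all entries, and filling the remaining cells of the rectangle with $2n$; $e_0^A=\psi^{-1}e_1^A\psi$, $f_0^A=\psi^{-1}f_1^A\psi$ on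 $B_A^{r,s}$, extended to tensor products by the tensor rule. VIRTUAL CRYSTALS of type $C_n^{(1)}$. Virtual operators: $e_0=(e_0^A)^2$, $e_i=e_{2n-i}^Ae_i^A$ ($1\le i\le n-1$), $e_n=(e_n^A)^2$, and similarly $f_i$. Virtual weight: $\Psi(\mathrm{wt}(b))=\mathrm{wt}_A(b)$, where $\Psi(\overline\Lambda_i)=\overline\Lambda_i^A+\overline\Lambda_{2n-i}^A$ for $i<n$ and $\Psi(\overline\Lambda_n)=2\overline\Lambda_n^A$ ($\overline\Lambda_i$, $\overline\Lambda_i^A$ the fundamental weights of $C_n$, $A_{2n-1}$). Ambient crystal: $\widehat V^{r,1}=B_A^{2n-r,1}\otimes B_A^{r,1}$ if $r<n$, $\widehat V^{n,1}=B_A^{n,2}$. $V^{r,1}\subset\widehat V^{r,1}$ is the subset generated by the virtual operators $e_i,f_i$, $0\le i\le n$, from the tensor product of the tableaux whose $i$-th row consists of letters $i$. $V(\overline\Lambda_r)$ is the subset of the crystal of semistandard tableaux in $[2n]$ with two columns of heights $2n-r$ and $r$ generated by the virtual operators $e_i,f_i$ with $1\le i\le n$ only, from the tableau whose $i$-th row consists of letters $i$; it is a $U_q(C_n)$-crystal isomorphic to the crystal $B(\overline\Lambda_r)$ of the irreducible $U_q(C_n)$-module of highest weight $\overline\Lambda_r$ (Baker). $V^{r,1}$ is aligned if for all $b\in V^{r,1}$: $\varphi_i^A(b)=\varphi_{2n-i}^A(b)$ and $\epsilon_i^A(b)=\epsilon_{2n-i}^A(b)$ for $1\le i\le n-1$,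 and $\varphi_0^A(b),\epsilon_0^A(b),\varphi_n^A(b),\epsilon_n^A(b)$ are all even. *)

theory Defs
  imports Main
begin

section \<open>Crystals\<close>

text \<open>
  Crystal operators are partial maps, with \<^term>\<open>None\<close> for the undefined value. Weights are
  given by their coordinates in the basis of fundamental weights, so that
  \<^term>\<open>weight C b i\<close> is the pairing of the weight of \<^term>\<open>b\<close> with the simple coroot \<open>h\<^sub>i\<close>.
\<close>

record 'a crystal =
  elems :: "'a set"
  e_op :: "nat \<Rightarrow> 'a \<Rightarrow> 'a option"
  f_op :: "nat \<Rightarrow> 'a \<Rightarrow> 'a option"
  weight :: "'a \<Rightarrow> nat \<Rightarrow> int"

definition op_power :: "('a \<Rightarrow> 'a option) \<Rightarrow> nat \<Rightarrow> 'a \<Rightarrow> 'a option" where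
  "op_power g m b = ((\<lambda>x. Option.bind x g) ^^ m) (Some b)"

definition string_length :: "('a \<Rightarrow> 'a option) \<Rightarrow> 'a \<Rightarrow> nat" where
  "string_length g b = Max {m. op_power g m b \<noteq> None}"

definition eps :: "'a crystal \<Rightarrow> nat \<Rightarrow> 'a \<Rightarrow> nat" where
  "eps C i b = string_length (e_op C i) b"

definition phi :: "'a crystal \<Rightarrow> nat \<Rightarrow> 'a \<Rightarrow> nat" where
  "phi C i b = string_length (f_op C i) b"

text \<open>
  The crystal axioms for index set \<^term>\<open>I\<close> and Cartan matrix \<^term>\<open>a\<close>, where
  \<^term>\<open>a i j\<close> is the pairing of the coroot \<open>h\<^sub>i\<close> with the root \<open>\<alpha>\<^sub>j\<close>.
\<close>

definition is_crystal :: "nat set \<Rightarrow> (nat \<Rightarrow> nat \<Rightarrow> int) \<Rightarrow> 'a crystal \<Rightarrow> bool" where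
  "is_crystal I a C \<longleftrightarrow>
     elems C \<noteq> {} \<and>
     (\<forall>i\<in>I. \<forall>b\<in>elems C. \<forall>b'. e_op C i b = Some b' \<or> f_op C i b = Some b' \<longrightarrow> b' \<in> elems C) \<and>
     (\<forall>i\<in>I. \<forall>b\<in>elems C. finite {m. op_power (e_op C i) m b \<noteq> None} \<and>
                        finite {m. op_power (f_op C i) m b \<noteq> None}) \<and>
     (\<forall>i\<in>I. \<forall>b\<in>elems C. \<forall>b'\<in>elems C. f_op C i b = Some b' \<longleftrightarrow> e_op C i b' = Some b) \<and>
     (\<forall>i\<in>I. \<forall>b\<in>elems C. \<forall>b'. f_op C i b = Some b' \<longrightarrow>
        (\<forall>j\<in>I. weight C b' j = weight C b j - a j i)) \<and>
     (\<forall>i\<in>I. \<forall>b\<in>elems C. weight C b i = int (phi C i b) - int (eps C i b))"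

definition crystal_isomorphic :: "nat set \<Rightarrow> 'a crystal \<Rightarrow> 'b crystal \<Rightarrow> bool" where
  "crystal_isomorphic I C D \<longleftrightarrow>
     (\<exists>\<theta>. bij_betw \<theta> (elems C) (elems D) \<and>
        (\<forall>b\<in>elems C.
           (\<forall>i\<in>I. weight D (\<theta> b) i = weight C b i) \<and>
           (\<forall>i\<in>I. e_op D i (\<theta> b) = map_option \<theta> (e_op C i b)) \<and>
           (\<forall>i\<in>I. f_op D i (\<theta> b) = map_option \<theta> (f_op C i b))))"

text \<open>The element \<open>b\<^sub>2 \<otimes> b\<^sub>1 \<otimes> \<dots>\<close> of a tensor product is the list \<open>[b\<^sub>2, b\<^sub>1, \<dots>]\<close>.\<close>

definition trivial_crystal :: "'a list crystal" where
  "trivial_crystal = \<lparr>elems = {[]}, e_op = (\<lambda>_ _. None), f_op = (\<lambda>_ _. None),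
     weight = (\<lambda>_ _. 0)\<rparr>"

definition tensor_cons :: "'a crystal \<Rightarrow> 'a list crystal \<Rightarrow> 'a list crystal" where
  "tensor_cons B C = \<lparr>
     elems = {b # bs | b bs. b \<in> elems B \<and> bs \<in> elems C},
     e_op = (\<lambda>i x. case x of [] \<Rightarrow> None | b # bs \<Rightarrow>
       if eps B i b > phi C i bs then map_option (\<lambda>b'. b' # bs) (e_op B i b)
       else map_option (\<lambda>bs'. b # bs') (e_op C i bs)),
     f_op = (\<lambda>i x. case x of [] \<Rightarrow> None | b # bs \<Rightarrow>
       if eps B i b \<ge> phi C i bs then map_option (\<lambda>b'. b' # bs) (f_op B i b)
       else map_option (\<lambda>bs'. b # bs') (f_op C i bs)),
     weight = (\<lambda>x j. case x of [] \<Rightarrow> 0 | b # bs \<Rightarrow> weight B b j + weight C bs j)\<rparr>"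

definition tensor_list :: "'a crystal list \<Rightarrow> 'a list crystal" where
  "tensor_list Bs = foldr tensor_cons Bs trivial_crystal"


section \<open>Crystals of type A\<close>

text \<open>
  The letter \<^term>\<open>x\<close> has weight \<open>\<Lambda>\<^sub>x - \<Lambda>\<^sub>x\<^sub>-\<^sub>1\<close>, with \<open>\<Lambda>\<^sub>0\<close> and \<open>\<Lambda>\<^sub>2\<^sub>n\<close> read as zero (type A with
  Dynkin diagram nodes \<open>1, \<dots>, 2n - 1\<close>).
\<close>

definition letters :: "nat \<Rightarrow> nat crystal" where
  "letters n = \<lparr>
     elems = {1..2*n},
     e_op = (\<lambda>i x. if 1 \<le> i \<and> i \<le> 2*n - 1 \<and> x = i + 1 then Some i else None),
     f_op = (\<lambda>i x. if 1 \<le> i \<and> i \<le> 2*n - 1 \<and> x = i then Some (i + 1) else None),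
     weight = (\<lambda>x i. if 1 \<le> i \<and> i \<le> 2*n - 1 then of_bool (x = i) - of_bool (x = i + 1) else 0)\<rparr>"

definition words :: "nat \<Rightarrow> nat \<Rightarrow> nat list crystal" where
  "words n k = tensor_list (replicate k (letters n))"

text \<open>
  A tableau is the list of its columns, each column being written as its reading word, that is,
  from bottom to top (English notation). The column-reading word of \<^term>\<open>t\<close> is \<^term>\<open>concat t\<close>.
\<close>

type_synonym tableau = "nat list list"

definition semistandard :: "tableau \<Rightarrow> bool" where
  "semistandard t \<longleftrightarrow>
     (\<forall>c\<in>set t. c \<noteq> [] \<and> sorted_wrt (>) c) \<and>
     (\<forall>j. Suc j < length t \<longrightarrow>
        length (t ! Suc j) \<le> length (t ! j) \<and>
        (\<forall>k<length (t ! Suc j). rev (t ! j) ! k \<le> rev (t ! Suc j) ! k))"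

fun split_word :: "nat list \<Rightarrow> nat list \<Rightarrow> tableau" where
  "split_word [] w = []"
| "split_word (h # hs) w = take h w # split_word hs (drop h w)"

text \<open>The crystal of semistandard tableaux in \<open>[2n]\<close> with column heights \<^term>\<open>hs\<close>.\<close>

definition tableaux :: "nat \<Rightarrow> nat list \<Rightarrow> tableau crystal" where
  "tableaux n hs = \<lparr>
     elems = {t. semistandard t \<and> map length t = hs \<and> set (concat t) \<subseteq> {1..2*n}},
     e_op = (\<lambda>i t. map_option (split_word hs) (e_op (words n (sum_list hs)) i (concat t))),
     f_op = (\<lambda>i t. map_option (split_word hs) (f_op (words n (sum_list hs)) i (concat t))),
     weight = (\<lambda>t. weight (words n (sum_list hs)) (concat t))\<rparr>"

text \<open>The tableau with column heights \<^term>\<open>hs\<close> whose \<open>i\<close>-th row consists of letters \<open>i\<close>.\<close>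

definition yamanouchi :: "nat list \<Rightarrow> tableau" where
  "yamanouchi hs = map (\<lambda>h. rev [1..<Suc h]) hs"

inductive knuth_step :: "nat list \<Rightarrow> nat list \<Rightarrow> bool" where
  "x \<le> y \<Longrightarrow> y < z \<Longrightarrow> knuth_step (u @ [x, z, y] @ v) (u @ [z, x, y] @ v)"
| "x < y \<Longrightarrow> y \<le> z \<Longrightarrow> knuth_step (u @ [y, x, z] @ v) (u @ [y, z, x] @ v)"

definition schensted :: "nat list \<Rightarrow> tableau" where
  "schensted w = (THE t. semistandard t \<and> equivclp knuth_step (concat t) w)"

text \<open>
  The map \<open>\<psi>\<^sup>-\<^sup>1\<close> on rectangular tableaux with \<^term>\<open>r\<close> rows and \<^term>\<open>s\<close> columns. The cells to be
  filled with \<open>2n\<close> lie at the bottom of each column, hence at the beginning of its reading word.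
\<close>

definition psi_inv :: "nat \<Rightarrow> nat \<Rightarrow> nat \<Rightarrow> tableau \<Rightarrow> tableau" where
  "psi_inv n r s t =
     (let p = schensted (filter (\<lambda>x. x \<noteq> 1) (concat t)) in
      map (\<lambda>j. let c = (if j < length p then p ! j else []) in
             replicate (r - length c) (2*n) @ map (\<lambda>x. x - 1) c) [0..<s])"

definition psi :: "nat \<Rightarrow> nat \<Rightarrow> nat \<Rightarrow> tableau \<Rightarrow> tableau" where
  "psi n r s = inv_into (elems (tableaux n (replicate s r))) (psi_inv n r s)"

text \<open>The crystal of rectangular tableaux, with the affine operators of index \<open>0\<close>.\<close>

definition rect_crystal :: "nat \<Rightarrow> nat \<Rightarrow> nat \<Rightarrow> tableau crystal" where
  "rect_crystal n r s =
     (let T = tableaux n (replicate s r) in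
      T\<lparr>e_op := (e_op T)(0 := (\<lambda>t. map_option (psi_inv n r s) (e_op T 1 (psi n r s t)))),
        f_op := (f_op T)(0 := (\<lambda>t. map_option (psi_inv n r s) (f_op T 1 (psi n r s t))))\<rparr>)"


section \<open>Virtual crystals\<close>

text \<open>
  The Cartan matrix of type \<open>C\<^sub>n\<^sup>(\<^sup>1\<^sup>)\<close> for \<open>n \<ge> 2\<close>: the roots \<open>\<alpha>\<^sub>0\<close> and \<open>\<alpha>\<^sub>n\<close> are long. Restricted to
  the indices \<open>1, \<dots>, n\<close> it is the Cartan matrix of type \<open>C\<^sub>n\<close>.
\<close>

definition cartan :: "nat \<Rightarrow> nat \<Rightarrow> nat \<Rightarrow> int" where
  "cartan n i j =
     (if i = j then 2
      else if (i = 1 \<and> j = 0) \<or> (i = n - 1 \<and> j = n) then -2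
      else if i = j + 1 \<or> j = i + 1 then -1
      else 0)"

definition weights_C :: "nat \<Rightarrow> (nat \<Rightarrow> int) set" where
  "weights_C n = {l. \<forall>i. i \<notin> {1..n} \<longrightarrow> l i = 0}"

text \<open>The image under \<open>\<Psi>\<close> of the \<^term>\<open>i\<close>-th fundamental weight of \<open>C\<^sub>n\<close>, and \<open>\<Psi>\<close> itself.\<close>

definition Psi_fund :: "nat \<Rightarrow> nat \<Rightarrow> nat \<Rightarrow> int" where
  "Psi_fund n i j = (if i < n then of_bool (j = i) + of_bool (j = 2*n - i) else 2 * of_bool (j = n))"

definition Psi :: "nat \<Rightarrow> (nat \<Rightarrow> int) \<Rightarrow> nat \<Rightarrow> int" where
  "Psi n l = (\<lambda>j. \<Sum>i=1..n. l i * Psi_fund n i j)"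

definition virtual_op :: "nat \<Rightarrow> (nat \<Rightarrow> 'a \<Rightarrow> 'a option) \<Rightarrow> nat \<Rightarrow> 'a \<Rightarrow> 'a option" where
  "virtual_op n g i b =
     (if i = 0 \<or> i = n then Option.bind (g i b) (g i)
      else Option.bind (g i b) (g (2*n - i)))"

text \<open>
  The part of the ambient crystal \<^term>\<open>A\<close> generated from \<^term>\<open>u\<close> by the virtual operators with
  index in \<^term>\<open>I\<close>.
\<close>

inductive_set generated :: "nat \<Rightarrow> 'a crystal \<Rightarrow> nat set \<Rightarrow> 'a \<Rightarrow> 'a set"
  for n :: nat and A :: "'a crystal" and I :: "nat set" and u :: 'a where
  "u \<in> elems A \<Longrightarrow> u \<in> generated n A I u"
| "b \<in> generated n A I u \<Longrightarrow> i \<in> I \<Longrightarrow> virtual_op n (e_op A) i b = Some b' \<Longrightarrow> b' \<in> elems A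
   \<Longrightarrow> b' \<in> generated n A I u"
| "b \<in> generated n A I u \<Longrightarrow> i \<in> I \<Longrightarrow> virtual_op n (f_op A) i b = Some b' \<Longrightarrow> b' \<in> elems A
   \<Longrightarrow> b' \<in> generated n A I u"

text \<open>
  The virtual weight is only meaningful where the ambient weight lies in the image of \<open>\<Psi>\<close>; this is
  stated separately by \<open>virtual_weights_exist\<close>.
\<close>

definition virtual_crystal :: "nat \<Rightarrow> 'a crystal \<Rightarrow> 'a set \<Rightarrow> 'a crystal" where
  "virtual_crystal n A V = \<lparr>
     elems = V,
     e_op = virtual_op n (e_op A),
     f_op = virtual_op n (f_op A),
     weight = (\<lambda>b. inv_into (weights_C n) (Psi n) (weight A b))\<rparr>"

definition virtual_weights_exist :: "nat \<Rightarrow> 'a crystal \<Rightarrow> 'a set \<Rightarrow> bool" where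
  "virtual_weights_exist n A V \<longleftrightarrow> (\<forall>b\<in>V. weight A b \<in> Psi n ` weights_C n)"

text \<open>
  Weights of \<open>U\<^sub>q'(C\<^sub>n\<^sup>(\<^sup>1\<^sup>))\<close>-crystals are the level zero lifts of weights of \<open>C\<^sub>n\<close>. As the canonical
  central element is \<open>h\<^sub>0 + \<dots> + h\<^sub>n\<close>, the coordinate at \<open>0\<close> is minus the sum of the others.
\<close>

definition level_zero :: "nat \<Rightarrow> 'a crystal \<Rightarrow> 'a crystal" where
  "level_zero n C = C\<lparr>weight := (\<lambda>b. (weight C b)(0 := - (\<Sum>i=1..n. weight C b i)))\<rparr>"

definition is_affine_C_crystal :: "nat \<Rightarrow> 'a crystal \<Rightarrow> bool" where
  "is_affine_C_crystal n C \<longleftrightarrow> is_crystal {0..n} (cartan n) (level_zero n C)"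

definition is_C_crystal :: "nat \<Rightarrow> 'a crystal \<Rightarrow> bool" where
  "is_C_crystal n C \<longleftrightarrow> is_crystal {1..n} (cartan n) C"

definition aligned :: "nat \<Rightarrow> 'a crystal \<Rightarrow> 'a set \<Rightarrow> bool" where
  "aligned n A V \<longleftrightarrow> (\<forall>b\<in>V.
     (\<forall>i\<in>{1..n-1}. phi A i b = phi A (2*n - i) b \<and> eps A i b = eps A (2*n - i) b) \<and>
     even (phi A 0 b) \<and> even (eps A 0 b) \<and> even (phi A n b) \<and> even (eps A n b))"

definition ambient :: "nat \<Rightarrow> nat \<Rightarrow> tableau list crystal" where
  "ambient n r = tensor_list
     (if r < n then [rect_crystal n (2*n - r) 1, rect_crystal n r 1] else [rect_crystal n n 2])"

definition V_set :: "nat \<Rightarrow> nat \<Rightarrow> tableau list set" where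
  "V_set n r = generated n (ambient n r) {0..n}
     (if r < n then [yamanouchi [2*n - r], yamanouchi [r]] else [yamanouchi [n, n]])"

definition V_crystal :: "nat \<Rightarrow> nat \<Rightarrow> tableau list crystal" where
  "V_crystal n r = virtual_crystal n (ambient n r) (V_set n r)"

text \<open>The virtual crystal \<open>V(\<Lambda>\<^sub>r)\<close> inside the crystal of tableaux with two columns.\<close>

definition V_Lambda_set :: "nat \<Rightarrow> nat \<Rightarrow> tableau set" where
  "V_Lambda_set n r =
     generated n (tableaux n [2*n - r, r]) {1..n} (yamanouchi [2*n - r, r])"

definition V_Lambda :: "nat \<Rightarrow> nat \<Rightarrow> tableau crystal" where
  "V_Lambda n r = virtual_crystal n (tableaux n [2*n - r, r]) (V_Lambda_set n r)"

end

theory Submission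
  imports Defs "HOL-Library.Sublist" "HOL-Library.Multiset"
begin

text \<open>
  Both virtual crystals are copies of one small crystal of words. Pair the letters \<open>k\<close> and
  \<open>2n + 1 - k\<close> for \<open>1 \<le> k \<le> n\<close>. In the pairs of columns that can be reached from the highest weight
  pair, each of these letter pairs occurs in one of five ways, which are recorded as the states
  \<open>Off\<close>, \<open>Pos\<close>, \<open>Neg\<close>, \<open>Open\<close>, \<open>Close\<close>. After complementing and reversing the left column, a word
  of states is the split form of a Kashiwara--Nakashima column: \<open>Pos\<close> and \<open>Neg\<close> are letters \<open>k\<close> and
  \<open>2n + 1 - k\<close> common to the two halves, while \<open>Open\<close> and \<open>Close\<close> are the places where the halves
  differ. Admissibility of the column says that \<open>Open\<close> and \<open>Close\<close> are balanced brackets with no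
  \<open>Off\<close> inside a bracket; this is the set \<open>model\<close>.

  On such words the virtual operators are local. For \<open>0 < i < n\<close> they change the states at \<open>i\<close> and
  \<open>i + 1\<close>, the operator \<open>n\<close> changes the last state and the operator \<open>0\<close> the first one. The bracket
  condition excludes precisely the neighbours for which the type A signatures at \<open>i\<close> and \<open>2n - i\<close>
  disagree, or for which the signatures at \<open>n\<close> and \<open>0\<close> have odd length. Alignment and the crystal
  axioms thus become finite case distinctions (\<open>virtual_middle\<close>, \<open>virtual_n\<close>, \<open>virtual_0\<close>). The
  model is closed under all operators including \<open>0\<close> (\<open>op_model\<close>), and only one word is annihilated
  by all \<open>e\<^sub>i\<close> with \<open>1 \<le> i \<le> n\<close> (\<open>highest_weight_unique\<close>). Hence the operators with \<open>i \<ge> 1\<close> already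
  generate the whole model, and both crystals are its image: adding the arrows \<open>0\<close> changes nothing
  (\<open>generated_eq_model\<close>), and the isomorphism reads the same word on both sides.

  It remains to see how the ambient operators act on a pair of columns. For \<open>i \<ge> 1\<close> the signature
  rule on reading words reduces to membership of \<open>i\<close> and \<open>i + 1\<close> in the two columns
  (\<open>words_col\<close>, \<open>tableaux_pair\<close>). For a single column \<open>\<psi>\<close> is the rotation of the alphabet
  \<open>{1, \<dots>, 2n}\<close>, so that \<open>f\<^sub>0\<close> replaces \<open>2n\<close> by \<open>1\<close>; this settles \<open>r < n\<close>.

  For \<open>r = n\<close> the map \<open>\<psi>\<close> is promotion on rectangles with two columns, and the definition of \<open>P\<close>
  by Knuth equivalence has to be put to use. A semistandard tableau with at most two columns is
  determined by its Knuth class, because the longest decreasing subsequences among the letters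
  below \<open>k\<close> give the first column, and the absence of weakly increasing subsequences of length
  three excludes a third column (\<open>schensted_eq\<close>). Such a tableau exists by column insertion
  (\<open>column_insertion\<close>). The longest decreasing subsequences among the letters from \<open>k\<close> on determine
  the skew tableau left after the letters \<open>1\<close> are deleted; so \<open>\<psi>\<^sup>-\<^sup>1\<close> is injective, and being a
  self-map of a finite set it is bijective (\<open>psi_inv_pair_elems\<close>). If the first state is \<open>Pos\<close> or
  \<open>Neg\<close>, then \<open>\<psi>\<close> only shifts the letters and \<open>f\<^sub>0\<close>, \<open>e\<^sub>0\<close> act columnwise. If it is \<open>Open\<close>, a counting
  argument shows that \<open>\<psi>\<close> of the tableau has both letters 1 and 2 in its first column and neither
  of them in the second, so that \<open>f\<^sub>0\<close> and \<open>e\<^sub>0\<close> vanish (\<open>psi_inv_preimage_mixed\<close>).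
\<close>

section \<open>Strings of partial operators\<close>

lemma op_power_0 [simp]: "op_power g 0 b = Some b"
  by (simp add: op_power_def)

lemma op_power_Suc [simp]: "op_power g (Suc m) b = Option.bind (g b) (op_power g m)"
proof -
  have none: "((\<lambda>x. Option.bind x g) ^^ m) None = None" for m
    by (induction m) auto
  show ?thesis
    unfolding op_power_def by (cases "g b") (simp_all add: funpow_Suc_right none del: funpow.simps)
qed

text \<open>
  A function with these properties is the length of the \<open>g\<close>-string through each point of \<open>S\<close>.
  Exhibiting it yields finiteness and the value of the maximum at once.
\<close>

definition string_fun :: "'a set \<Rightarrow> ('a \<Rightarrow> 'a option) \<Rightarrow> ('a \<Rightarrow> nat) \<Rightarrow> bool" where
  "string_fun S g N \<longleftrightarrow>
     (\<forall>b\<in>S. case g b of None \<Rightarrow> N b = 0 | Some b' \<Rightarrow> b' \<in> S \<and> N b = Suc (N b'))"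

lemma string_funI:
  assumes "\<And>b. b \<in> S \<Longrightarrow> g b = None \<Longrightarrow> N b = 0"
    and "\<And>b b'. b \<in> S \<Longrightarrow> g b = Some b' \<Longrightarrow> b' \<in> S \<and> N b = Suc (N b')"
  shows "string_fun S g N"
  using assms by (auto simp: string_fun_def split: option.split)

lemma string_funD:
  assumes "string_fun S g N" "b \<in> S"
  shows "g b = None \<longleftrightarrow> N b = 0" "g b = Some b' \<Longrightarrow> b' \<in> S" "g b = Some b' \<Longrightarrow> N b = Suc (N b')"
  using assms by (fastforce simp: string_fun_def split: option.splits)+

lemma op_power_defined_iff:
  assumes "string_fun S g N" "b \<in> S"
  shows "op_power g m b \<noteq> None \<longleftrightarrow> m \<le> N b"
  using assms(2)
proof (induction m arbitrary: b)
  case (Suc m)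
  show ?case
  proof (cases "g b")
    case None
    then show ?thesis using string_funD(1)[OF assms(1) Suc.prems] by simp
  next
    case (Some b')
    then show ?thesis
      using string_funD(2,3)[OF assms(1) Suc.prems Some] Suc.IH[of b'] by simp
  qed
qed simp

lemma string_finite:
  assumes "string_fun S g N" "b \<in> S"
  shows "finite {m. op_power g m b \<noteq> None}"
  using op_power_defined_iff[OF assms] by (simp del: not_None_eq)

lemma string_length_eq:
  assumes "string_fun S g N" "b \<in> S"
  shows "string_length g b = N b"
proof -
  have "{m. op_power g m b \<noteq> None} = {..N b}"
    using op_power_defined_iff[OF assms] by auto
  then have "string_length g b = Max {..N b}"
    unfolding string_length_def by presburger
  also have "\<dots> = N b" by (rule Max_eqI) auto
  finally show ?thesis .
qed

lemma string_fun_cong: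
  assumes "string_fun S g N" "\<And>b. b \<in> S \<Longrightarrow> N b = N' b"
  shows "string_fun S g N'"
  using assms by (fastforce simp: string_fun_def split: option.splits)

lemma string_fun_image:
  assumes "string_fun S g N" "\<And>b. b \<in> S \<Longrightarrow> g' (\<theta> b) = map_option \<theta> (g b)"
    "\<And>b. b \<in> S \<Longrightarrow> N' (\<theta> b) = N b"
  shows "string_fun (\<theta> ` S) g' N'"
proof (rule string_funI)
  fix b assume "b \<in> \<theta> ` S" "g' b = None"
  then show "N' b = 0" using string_funD(1)[OF assms(1)] assms(2,3) by auto
next
  fix b b' assume "b \<in> \<theta> ` S" "g' b = Some b'"
  then obtain x x' where "x \<in> S" "b = \<theta> x" "g x = Some x'" "b' = \<theta> x'" using assms(2) by auto
  then show "b' \<in> \<theta> ` S \<and> N' b = Suc (N' b')"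
    using string_funD(2,3)[OF assms(1) \<open>x \<in> S\<close> \<open>g x = Some x'\<close>] assms(3) by auto
qed

section \<open>Seminormal crystals and tensor products\<close>

definition inverse_ops :: "'a set \<Rightarrow> ('a \<Rightarrow> 'a option) \<Rightarrow> ('a \<Rightarrow> 'a option) \<Rightarrow> bool" where
  "inverse_ops S f e \<longleftrightarrow>
     (\<forall>b\<in>S. \<forall>b'. (f b = Some b' \<longrightarrow> e b' = Some b) \<and> (e b = Some b' \<longrightarrow> f b' = Some b))"

definition seminormal :: "nat \<Rightarrow> 'a crystal \<Rightarrow> bool" where
  "seminormal i C \<longleftrightarrow> string_fun (elems C) (f_op C i) (phi C i) \<and>
     string_fun (elems C) (e_op C i) (eps C i) \<and> inverse_ops (elems C) (f_op C i) (e_op C i)"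

lemma seminormalI:
  assumes "string_fun (elems C) (f_op C i) P" "string_fun (elems C) (e_op C i) Q"
    "inverse_ops (elems C) (f_op C i) (e_op C i)"
  shows "seminormal i C"
    and "b \<in> elems C \<Longrightarrow> phi C i b = P b" and "b \<in> elems C \<Longrightarrow> eps C i b = Q b"
proof -
  have phi: "phi C i b = P b" and eps: "eps C i b = Q b" if "b \<in> elems C" for b
    using string_length_eq[OF assms(1) that] string_length_eq[OF assms(2) that]
    by (simp_all add: phi_def eps_def)
  then show "b \<in> elems C \<Longrightarrow> phi C i b = P b" "b \<in> elems C \<Longrightarrow> eps C i b = Q b" by auto
  show "seminormal i C"
    unfolding seminormal_def
    using string_fun_cong[OF assms(1)] string_fun_cong[OF assms(2)] phi eps assms(3) by metis
qed

lemma seminormalD: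
  assumes "seminormal i C" "b \<in> elems C"
  shows "f_op C i b = None \<longleftrightarrow> phi C i b = 0" "e_op C i b = None \<longleftrightarrow> eps C i b = 0"
    and "f_op C i b = Some b' \<Longrightarrow>
           b' \<in> elems C \<and> phi C i b = Suc (phi C i b') \<and> eps C i b' = Suc (eps C i b) \<and> e_op C i b' = Some b"
    and "e_op C i b = Some b' \<Longrightarrow>
           b' \<in> elems C \<and> eps C i b = Suc (eps C i b') \<and> phi C i b' = Suc (phi C i b) \<and> f_op C i b' = Some b"
  using assms string_funD[of "elems C" "f_op C i" "phi C i"] string_funD[of "elems C" "e_op C i" "eps C i"]
  unfolding seminormal_def inverse_ops_def by metis+

lemma trivial_crystal_simps [simp]:
  "elems trivial_crystal = {[]}" "e_op trivial_crystal i bs = None"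
  "f_op trivial_crystal i bs = None" "weight trivial_crystal bs j = 0"
  by (simp_all add: trivial_crystal_def)

lemma seminormal_trivial: "seminormal i trivial_crystal"
  and phi_trivial [simp]: "phi trivial_crystal i [] = 0"
  and eps_trivial [simp]: "eps trivial_crystal i [] = 0"
proof -
  have *: "string_fun (elems trivial_crystal) (f_op trivial_crystal i) (\<lambda>_. 0)"
    "string_fun (elems trivial_crystal) (e_op trivial_crystal i) (\<lambda>_. 0)"
    "inverse_ops (elems trivial_crystal) (f_op trivial_crystal i) (e_op trivial_crystal i)"
    by (auto simp: string_fun_def inverse_ops_def)
  show "seminormal i trivial_crystal" "phi trivial_crystal i [] = 0" "eps trivial_crystal i [] = 0"
    using seminormalI[OF *] by auto
qed

lemma elems_tensor_cons: "elems (tensor_cons B C) = {b # bs | b bs. b \<in> elems B \<and> bs \<in> elems C}"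
  by (simp add: tensor_cons_def)

lemma f_tensor_cons: "f_op (tensor_cons B C) i (b # bs) =
    (if eps B i b \<ge> phi C i bs then map_option (\<lambda>b'. b' # bs) (f_op B i b)
     else map_option (\<lambda>bs'. b # bs') (f_op C i bs))"
  by (simp add: tensor_cons_def)

lemma e_tensor_cons: "e_op (tensor_cons B C) i (b # bs) =
    (if eps B i b > phi C i bs then map_option (\<lambda>b'. b' # bs) (e_op B i b)
     else map_option (\<lambda>bs'. b # bs') (e_op C i bs))"
  by (simp add: tensor_cons_def)

lemma weight_tensor_cons: "weight (tensor_cons B C) (b # bs) j = weight B b j + weight C bs j"
  by (simp add: tensor_cons_def)

text \<open>
  In the signature of \<open>b\<^sub>2 \<otimes> b\<^sub>1\<close> the \<open>\<epsilon>\<close>-part of \<open>b\<^sub>2\<close> cancels against the \<open>\<phi>\<close>-part of \<open>b\<^sub>1\<close>; the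
  truncated differences are what survives of either part.
\<close>

lemma tensor_cons_seminormal:
  assumes B: "seminormal i B" and C: "seminormal i C"
  shows seminormal_tensor_cons: "seminormal i (tensor_cons B C)"
    and phi_tensor_cons: "b \<in> elems B \<Longrightarrow> bs \<in> elems C \<Longrightarrow>
      phi (tensor_cons B C) i (b # bs) = phi B i b + (phi C i bs - eps B i b)"
    and eps_tensor_cons: "b \<in> elems B \<Longrightarrow> bs \<in> elems C \<Longrightarrow>
      eps (tensor_cons B C) i (b # bs) = eps C i bs + (eps B i b - phi C i bs)"
proof -
  let ?T = "tensor_cons B C"
  let ?P = "\<lambda>x. phi B i (hd x) + (phi C i (tl x) - eps B i (hd x))"
  let ?Q = "\<lambda>x. eps C i (tl x) + (eps B i (hd x) - phi C i (tl x))"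
  note b = seminormalD[OF B] and c = seminormalD[OF C]
  have 1: "string_fun (elems ?T) (f_op ?T i) ?P"
  proof (rule string_funI)
    fix x assume "x \<in> elems ?T" "f_op ?T i x = None"
    then show "?P x = 0"
      using b(1) c(1) by (auto simp: elems_tensor_cons f_tensor_cons split: if_splits)
  next
    fix x x' assume "x \<in> elems ?T" "f_op ?T i x = Some x'"
    then show "x' \<in> elems ?T \<and> ?P x = Suc (?P x')"
      using b(3) c(3)
      by (fastforce simp: elems_tensor_cons f_tensor_cons split: if_splits)
  qed
  have 2: "string_fun (elems ?T) (e_op ?T i) ?Q"
  proof (rule string_funI)
    fix x assume "x \<in> elems ?T" "e_op ?T i x = None"
    then show "?Q x = 0"
      using b(2) c(2) by (auto simp: elems_tensor_cons e_tensor_cons split: if_splits)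
  next
    fix x x' assume "x \<in> elems ?T" "e_op ?T i x = Some x'"
    then show "x' \<in> elems ?T \<and> ?Q x = Suc (?Q x')"
      using b(4) c(4)
      by (fastforce simp: elems_tensor_cons e_tensor_cons split: if_splits)
  qed
  have 3: "inverse_ops (elems ?T) (f_op ?T i) (e_op ?T i)"
    unfolding inverse_ops_def
  proof (intro ballI allI conjI impI)
    fix x x' assume "x \<in> elems ?T" "f_op ?T i x = Some x'"
    then show "e_op ?T i x' = Some x"
      using b(3) c(3)
      by (fastforce simp: elems_tensor_cons f_tensor_cons e_tensor_cons split: if_splits)
  next
    fix x x' assume "x \<in> elems ?T" "e_op ?T i x = Some x'"
    then show "f_op ?T i x' = Some x"
      using b(4) c(4)
      by (fastforce simp: elems_tensor_cons f_tensor_cons e_tensor_cons split: if_splits)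
  qed
  show "seminormal i ?T" by (rule seminormalI(1)[OF 1 2 3])
  show "phi ?T i (b # bs) = phi B i b + (phi C i bs - eps B i b)"
    "eps ?T i (b # bs) = eps C i bs + (eps B i b - phi C i bs)" if "b \<in> elems B" "bs \<in> elems C"
    using seminormalI(2,3)[OF 1 2 3, of "b # bs"] that by (auto simp: elems_tensor_cons)
qed

lemma tensor_single:
  assumes R: "seminormal i R" and t: "t \<in> elems R"
  shows "f_op (tensor_list [R]) i [t] = map_option (\<lambda>t. [t]) (f_op R i t)"
    and "e_op (tensor_list [R]) i [t] = map_option (\<lambda>t. [t]) (e_op R i t)"
    and "phi (tensor_list [R]) i [t] = phi R i t" and "eps (tensor_list [R]) i [t] = eps R i t"
  using phi_tensor_cons[OF R seminormal_trivial t] eps_tensor_cons[OF R seminormal_trivial t]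
    seminormalD(2)[OF R t]
  by (simp_all add: tensor_list_def f_tensor_cons e_tensor_cons)

section \<open>Words\<close>

lemma letters_seminormal: "seminormal i (letters n)"
  and phi_letters: "x \<in> {1..2*n} \<Longrightarrow> 1 \<le> i \<Longrightarrow> i < 2*n \<Longrightarrow> phi (letters n) i x = of_bool (x = i)"
  and eps_letters: "x \<in> {1..2*n} \<Longrightarrow> 1 \<le> i \<Longrightarrow> i < 2*n \<Longrightarrow> eps (letters n) i x = of_bool (x = Suc i)"
proof -
  let ?P = "\<lambda>x. if 1 \<le> i \<and> i \<le> 2*n - 1 \<and> x = i then 1 else 0"
  let ?Q = "\<lambda>x. if 1 \<le> i \<and> i \<le> 2*n - 1 \<and> x = Suc i then 1 else 0"
  have *: "string_fun (elems (letters n)) (f_op (letters n) i) ?P"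
    "string_fun (elems (letters n)) (e_op (letters n) i) ?Q"
    "inverse_ops (elems (letters n)) (f_op (letters n) i) (e_op (letters n) i)"
    by (auto simp: string_fun_def inverse_ops_def letters_def)
  show "seminormal i (letters n)" by (rule seminormalI(1)[OF *])
  show "phi (letters n) i x = of_bool (x = i)" "eps (letters n) i x = of_bool (x = Suc i)"
    if "x \<in> {1..2*n}" "1 \<le> i" "i < 2*n"
    using seminormalI(2,3)[OF *, of x] that by (auto simp: letters_def)
qed

lemma words_0 [simp]: "words n 0 = trivial_crystal"
  by (simp add: words_def tensor_list_def)

lemma words_Suc: "words n (Suc k) = tensor_cons (letters n) (words n k)"
  by (simp add: words_def tensor_list_def)

lemma words_seminormal: "seminormal i (words n k)"
  by (induction k) (auto simp: words_Suc seminormal_trivial letters_seminormal seminormal_tensor_cons)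

lemma elems_words: "elems (words n k) = {w. length w = k \<and> set w \<subseteq> {1..2*n}}"
proof (induction k)
  case (Suc k)
  have "elems (letters n) = {1..2*n}" by (simp add: letters_def)
  with Suc show ?case
    by (auto simp: words_Suc elems_tensor_cons length_Suc_conv)
qed auto

text \<open>
  Associativity of the tensor product for words: a factor may be a whole subword. This allows
  to treat columns, rather than letters, as the tensor factors of a reading word.
\<close>

lemma words_append:
  assumes "set u \<subseteq> {1..2*n}" "set v \<subseteq> {1..2*n}" "k = length u" "l = length v"
  shows "phi (words n (k + l)) i (u @ v) =
           phi (words n k) i u + (phi (words n l) i v - eps (words n k) i u)" (is "?phi u k")
    and "eps (words n (k + l)) i (u @ v) =
           eps (words n l) i v + (eps (words n k) i u - phi (words n l) i v)" (is "?eps u k")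
    and "f_op (words n (k + l)) i (u @ v) =
           (if eps (words n k) i u \<ge> phi (words n l) i v then map_option (\<lambda>u'. u' @ v) (f_op (words n k) i u)
            else map_option (\<lambda>v'. u @ v') (f_op (words n l) i v))" (is "?f u k")
    and "e_op (words n (k + l)) i (u @ v) =
           (if eps (words n k) i u > phi (words n l) i v then map_option (\<lambda>u'. u' @ v) (e_op (words n k) i u)
            else map_option (\<lambda>v'. u @ v') (e_op (words n l) i v))" (is "?e u k")
proof -
  have "?phi u k \<and> ?eps u k \<and> ?f u k \<and> ?e u k"
    using assms(1,3)
  proof (induction u arbitrary: k)
    case Nil
    have "v \<in> elems (words n l)" using assms by (auto simp: elems_words)
    moreover have eta: "map_option ((@) []) z = z" for z :: "nat list option"
      by (cases z) auto
    ultimately show ?case using Nil seminormalD(1)[OF words_seminormal, of v n l i] by simp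
  next
    case (Cons x u)
    then obtain k' where k: "k = Suc k'" "k' = length u" by auto
    have IH: "?phi u k' \<and> ?eps u k' \<and> ?f u k' \<and> ?e u k'" using Cons k by auto
    have mem: "x \<in> elems (letters n)" "u \<in> elems (words n k')" "u @ v \<in> elems (words n (k' + l))"
      using Cons.prems k assms by (auto simp: elems_words letters_def)
    note t = phi_tensor_cons[OF letters_seminormal words_seminormal mem(1)]
      eps_tensor_cons[OF letters_seminormal words_seminormal mem(1)]
    define p q p' q' a b where pq: "p = phi (words n k') i u" "q = eps (words n k') i u"
      "p' = phi (words n l) i v" "q' = eps (words n l) i v"
      "a = phi (letters n) i x" "b = eps (letters n) i x"
    define W where "W = words n (k' + l)"
    have uv: "phi W i (u @ v) = p + (p' - q)" "eps W i (u @ v) = q' + (q - p')"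
      "f_op W i (u @ v) = (if q \<ge> p' then map_option (\<lambda>u'. u' @ v) (f_op (words n k') i u)
            else map_option (\<lambda>v'. u @ v') (f_op (words n l) i v))"
      "e_op W i (u @ v) = (if q > p' then map_option (\<lambda>u'. u' @ v) (e_op (words n k') i u)
            else map_option (\<lambda>v'. u @ v') (e_op (words n l) i v))"
      using IH by (simp_all add: pq W_def)
    have xu: "phi (words n k) i (x # u) = a + (p - b)" "eps (words n k) i (x # u) = q + (b - p)"
      using t[OF mem(2)] by (simp_all add: k words_Suc pq)
    have xuv: "phi (words n (k + l)) i (x # u @ v) = a + (phi W i (u @ v) - b)"
      "eps (words n (k + l)) i (x # u @ v) = eps W i (u @ v) + (b - phi W i (u @ v))"
      using t[OF mem(3)] by (simp_all add: k words_Suc pq W_def)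
    have "f_op (words n (k + l)) i (x # u @ v) = (if b \<ge> phi W i (u @ v)
        then map_option (\<lambda>x'. x' # u @ v) (f_op (letters n) i x) else map_option (\<lambda>w. x # w) (f_op W i (u @ v)))"
      "e_op (words n (k + l)) i (x # u @ v) = (if b > phi W i (u @ v)
        then map_option (\<lambda>x'. x' # u @ v) (e_op (letters n) i x) else map_option (\<lambda>w. x # w) (e_op W i (u @ v)))"
      "f_op (words n k) i (x # u) = (if b \<ge> p
        then map_option (\<lambda>x'. x' # u) (f_op (letters n) i x) else map_option (\<lambda>w. x # w) (f_op (words n k') i u))"
      "e_op (words n k) i (x # u) = (if b > p
        then map_option (\<lambda>x'. x' # u) (e_op (letters n) i x) else map_option (\<lambda>w. x # w) (e_op (words n k') i u))"
      by (simp_all add: k words_Suc f_tensor_cons e_tensor_cons pq W_def)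
    note ops = this(1,2)[unfolded uv] this(3,4)
    \<comment> \<open>which factor is acted on, in terms of the string lengths of the three factors\<close>
    have conds: "p + (p' - q) \<le> b \<longleftrightarrow> p \<le> b \<and> p + p' \<le> q + b"
      "p + (p' - q) < b \<longleftrightarrow> p < b \<and> p + p' < q + b"
      "p' \<le> q + (b - p) \<longleftrightarrow> p' \<le> q \<or> p + p' \<le> q + b"
      "p' < q + (b - p) \<longleftrightarrow> p' < q \<or> p + p' < q + b"
      by arith+
    have "?f (x # u) k \<and> ?e (x # u) k"
      unfolding append_Cons xu ops pq(3)[symmetric] conds
      by (auto simp: option.map_comp comp_def)
    moreover have "p + (p' - q) - b = p - b + (p' - (q + (b - p)))"
      "q - p' + (b - (p + (p' - q))) = q + (b - p) - p'"
      by arith+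
    ultimately show ?case
      unfolding append_Cons xuv xu uv pq(3,4)[symmetric] by simp
  qed
  then show "?phi u k" "?eps u k" "?f u k" "?e u k" by auto
qed

lemma weight_words_append:
  "length u = k \<Longrightarrow> weight (words n (k + l)) (u @ v) j = weight (words n k) u j + weight (words n l) v j"
  by (induction u arbitrary: k) (auto simp: words_Suc weight_tensor_cons)

section \<open>Columns as sets\<close>

definition col :: "nat set \<Rightarrow> nat list" where
  "col S = rev (sorted_list_of_set S)"

lemma set_col [simp]: "finite S \<Longrightarrow> set (col S) = S"
  and length_col [simp]: "length (col S) = card S"
  and col_empty [simp]: "col {} = []"
  and col_decreasing: "sorted_wrt (>) (col S)"
  by (simp_all add: col_def sorted_wrt_rev)

lemma col_eqI: "sorted_wrt (>) c \<Longrightarrow> col (set c) = c"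
  unfolding col_def
  by (metis List.finite_set set_rev sorted_list_of_set.idem_if_sorted_distinct
      rev_rev_ident sorted_wrt_rev strict_sorted_iff)

lemma col_append:
  assumes "finite A" "finite B" "\<And>a b. a \<in> A \<Longrightarrow> b \<in> B \<Longrightarrow> b < a"
  shows "col (A \<union> B) = col A @ col B"
proof -
  have "sorted_wrt (>) (col A @ col B)"
    using assms by (simp add: sorted_wrt_append col_decreasing)
  from col_eqI[OF this] show ?thesis using assms by simp
qed

lemma col_singleton [simp]: "col {x} = [x]"
  by (simp add: col_def)

lemma col_inj: "finite A \<Longrightarrow> finite B \<Longrightarrow> col A = col B \<longleftrightarrow> A = B"
  by (metis set_col)

definition move :: "nat \<Rightarrow> nat \<Rightarrow> nat set \<Rightarrow> nat set option" where
  "move p q S = (if p \<in> S \<and> q \<notin> S then Some (insert q (S - {p})) else None)"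

definition movable :: "nat \<Rightarrow> nat \<Rightarrow> nat set \<Rightarrow> nat" where
  "movable p q S = of_bool (p \<in> S \<and> q \<notin> S)"

lemma move_cases:
  "(movable p q S = 0 \<and> move p q S = None) \<or>
   (p \<in> S \<and> q \<notin> S \<and> movable p q S = 1 \<and> move p q S = Some (insert q (S - {p})))"
  by (auto simp: move_def movable_def)

text \<open>
  Letters other than \<open>i\<close> and \<open>i + 1\<close> contribute nothing to the \<open>i\<close>-signature.
\<close>

lemma words_neutral:
  assumes "set w \<subseteq> {1..2*n}" "1 \<le> i" "i < 2*n" "i \<notin> set w" "Suc i \<notin> set w"
  shows "phi (words n (length w)) i w = 0 \<and> eps (words n (length w)) i w = 0"
  using assms
proof (induction w)
  case (Cons x w)
  have "x \<in> elems (letters n)" "w \<in> elems (words n (length w))"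
    using Cons.prems by (auto simp: elems_words letters_def)
  note t = phi_tensor_cons[OF letters_seminormal words_seminormal this]
    eps_tensor_cons[OF letters_seminormal words_seminormal this]
  show ?case using Cons t[of i]
    by (simp add: words_Suc phi_letters eps_letters)
qed simp

lemma split3:
  fixes S :: "nat set" shows "S = {x\<in>S. Suc i < x} \<union> ((S \<inter> {i, Suc i}) \<union> {x\<in>S. x < i})"
  by (auto simp: not_less le_Suc_eq)

lemma col_split3:
  assumes "finite S"
  shows "col S = col {x\<in>S. Suc i < x} @ col (S \<inter> {i, Suc i}) @ col {x\<in>S. x < i}"
proof -
  have "col S = col ({x\<in>S. Suc i < x} \<union> ((S \<inter> {i, Suc i}) \<union> {x\<in>S. x < i}))"
    using split3[of S i] by simp
  also have "\<dots> = col {x\<in>S. Suc i < x} @ col (S \<inter> {i, Suc i}) @ col {x\<in>S. x < i}"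
    using assms by (subst col_append col_append; auto)+
  finally show ?thesis .
qed

lemma col_pair: "col {i, Suc i} = [Suc i, i]"
  using col_eqI[of "[Suc i, i]"] by (simp add: insert_commute)

lemma words_mid:
  assumes "1 \<le> i" "i < 2*n" "M \<subseteq> {i, Suc i}"
  shows "phi (words n (card M)) i (col M) = movable i (Suc i) M"
    and "eps (words n (card M)) i (col M) = movable (Suc i) i M"
    and "f_op (words n (card M)) i (col M) = map_option col (move i (Suc i) M)"
    and "e_op (words n (card M)) i (col M) = map_option col (move (Suc i) i M)"
proof -
  have l: "i \<in> elems (letters n)" "Suc i \<in> elems (letters n)"
    using assms by (auto simp: letters_def)
  have w: "[] \<in> elems (words n 0)" "[i] \<in> elems (words n (Suc 0))"
    using assms by (auto simp: elems_words)
  have p0: "phi (words n (Suc 0)) i [x] = phi (letters n) i x"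
     "eps (words n (Suc 0)) i [x] = eps (letters n) i x"
     "f_op (words n (Suc 0)) i [x] = map_option (\<lambda>x. [x]) (f_op (letters n) i x)"
     "e_op (words n (Suc 0)) i [x] = map_option (\<lambda>x. [x]) (e_op (letters n) i x)"
    if "x \<in> elems (letters n)" for x
    using phi_tensor_cons[OF letters_seminormal words_seminormal that w(1)]
      eps_tensor_cons[OF letters_seminormal words_seminormal that w(1)]
      seminormalD(2)[OF letters_seminormal that]
    by (auto simp: words_Suc f_tensor_cons e_tensor_cons)
  have op: "f_op (letters n) i i = Some (Suc i)" "e_op (letters n) i (Suc i) = Some i"
     "f_op (letters n) i (Suc i) = None" "e_op (letters n) i i = None"
    using assms by (auto simp: letters_def)
  have ph: "phi (letters n) i i = 1" "phi (letters n) i (Suc i) = 0"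
    "eps (letters n) i i = 0" "eps (letters n) i (Suc i) = 1"
    using assms(1,2) by (simp_all add: phi_letters eps_letters)
  note one = p0[OF l(1), unfolded op ph] p0[OF l(2), unfolded op ph]
  have two: "phi (words n 2) i [Suc i, i] = 0" "eps (words n 2) i [Suc i, i] = 0"
    "f_op (words n 2) i [Suc i, i] = None" "e_op (words n 2) i [Suc i, i] = None"
    using phi_tensor_cons[OF letters_seminormal words_seminormal l(2) w(2)]
      eps_tensor_cons[OF letters_seminormal words_seminormal l(2) w(2)]
    by (simp_all add: numeral_2_eq_2 words_Suc[of n "Suc 0"] f_tensor_cons e_tensor_cons one op ph)
  have sets: "{Suc i, i} - {Suc i} = {i}" "{i} - {i} = {}" by auto
  consider "M = {}" | "M = {i}" | "M = {Suc i}" | "M = {i, Suc i}" using assms(3) by auto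
  then show "phi (words n (card M)) i (col M) = movable i (Suc i) M"
    "eps (words n (card M)) i (col M) = movable (Suc i) i M"
    "f_op (words n (card M)) i (col M) = map_option col (move i (Suc i) M)"
    "e_op (words n (card M)) i (col M) = map_option col (move (Suc i) i M)"
    by (cases; simp add: movable_def move_def col_pair one two[unfolded numeral_2_eq_2])+
qed

text \<open>
  Only the letters \<open>i\<close> and \<open>i + 1\<close> of a column matter, and they are adjacent in its reading word;
  if both occur, they cancel.
\<close>

lemma words_col:
  assumes "S \<subseteq> {1..2*n}" "1 \<le> i" "i < 2*n"
  shows "phi (words n (card S)) i (col S) = movable i (Suc i) S"
    and "eps (words n (card S)) i (col S) = movable (Suc i) i S"
    and "f_op (words n (card S)) i (col S) = map_option col (move i (Suc i) S)"
    and "e_op (words n (card S)) i (col S) = map_option col (move (Suc i) i S)"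
proof -
  have fin: "finite S" using assms(1) finite_subset by auto
  define H where "H = {x\<in>S. Suc i < x}"
  define M where "M = S \<inter> {i, Suc i}"
  define L where "L = {x\<in>S. x < i}"
  have fins: "finite H" "finite M" "finite L" using fin by (auto simp: H_def M_def L_def)
  have S: "col S = col H @ col M @ col L"
    using col_split3[OF fin] by (simp add: H_def M_def L_def)
  have card: "card S = card H + (card M + card L)"
    using arg_cong[OF S, of length] by simp
  have sub: "set (col H) \<subseteq> {1..2*n}" "set (col M) \<subseteq> {1..2*n}" "set (col L) \<subseteq> {1..2*n}"
    "set (col M @ col L) \<subseteq> {1..2*n}"
    using assms fins by (auto simp: H_def M_def L_def)
  have M: "M \<subseteq> {i, Suc i}" by (auto simp: M_def)
  have H0: "phi (words n (card H)) i (col H) = 0 \<and> eps (words n (card H)) i (col H) = 0"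
    using words_neutral[OF sub(1) assms(2,3)] fins by (auto simp: H_def)
  have L0: "phi (words n (card L)) i (col L) = 0 \<and> eps (words n (card L)) i (col L) = 0"
    using words_neutral[OF sub(3) assms(2,3)] fins by (auto simp: L_def)
  have "col L \<in> elems (words n (card L))" "col H \<in> elems (words n (card H))"
    using sub by (auto simp: elems_words)
  note none = seminormalD(1,2)[OF words_seminormal this(1), of i]
    seminormalD(1,2)[OF words_seminormal this(2), of i]
  note app = words_append[OF sub(2,3), of "card M" "card L" i, simplified]
    words_append[OF sub(1,4), of "card H" "card M + card L" i, simplified]
  note mid = words_mid[OF assms(2,3) M]
  have mv: "movable i (Suc i) S = movable i (Suc i) M" "movable (Suc i) i S = movable (Suc i) i M"
    by (auto simp: movable_def M_def)
  have merge: "col H @ col M' @ col L = col (H \<union> (M' \<union> L))" if "M' \<subseteq> {i, Suc i}" for M'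
  proof -
    have "finite M'" using that finite_subset by auto
    with that show ?thesis using fins
      by (subst col_append col_append; auto simp: H_def L_def)+
  qed
  have eq: "insert q (S - {p}) = H \<union> (insert q (M - {p}) \<union> L)"
    if "p \<in> {i, Suc i}" "q \<in> {i, Suc i}" for p q
    using that split3[of S i] by (auto simp: H_def L_def M_def)
  have mvo: "map_option (\<lambda>x. col H @ x @ col L) (map_option col (move p q M)) = map_option col (move p q S)"
    if "p \<in> {i, Suc i}" "q \<in> {i, Suc i}" for p q
    using that merge[of "insert q (M - {p})"] eq[OF that] M
    by (auto simp: move_def M_def)
  show "phi (words n (card S)) i (col S) = movable i (Suc i) S"
    "eps (words n (card S)) i (col S) = movable (Suc i) i S"
    using app mid mv H0 L0 by (simp_all add: S card)
  show "f_op (words n (card S)) i (col S) = map_option col (move i (Suc i) S)"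
    using app mid H0 L0 none mvo[of i "Suc i"] move_cases[of i "Suc i" M]
    by (auto simp: S card option.map_comp comp_def)
  show "e_op (words n (card S)) i (col S) = map_option col (move (Suc i) i S)"
    using app mid H0 L0 none mvo[of "Suc i" i] move_cases[of "Suc i" i M]
    by (auto simp: S card option.map_comp comp_def)
qed

section \<open>Pairs of columns\<close>

text \<open>
  Tensor rule for two columns, with \<open>f\<close> replacing \<open>p\<close> by \<open>q\<close> and \<open>e\<close> replacing \<open>q\<close> by \<open>p\<close>. The letters
  are \<open>i\<close> and \<open>i + 1\<close> for a node \<open>i \<ge> 1\<close>, and \<open>2n\<close> and \<open>1\<close> for the node \<open>0\<close>.
\<close>

definition move_pair :: "nat \<Rightarrow> nat \<Rightarrow> nat set \<times> nat set \<Rightarrow> (nat set \<times> nat set) option" where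
  "move_pair p q = (\<lambda>(A, B).
     if movable q p A \<ge> movable p q B then map_option (\<lambda>A'. (A', B)) (move p q A)
     else map_option (\<lambda>B'. (A, B')) (move p q B))"

definition unmove_pair :: "nat \<Rightarrow> nat \<Rightarrow> nat set \<times> nat set \<Rightarrow> (nat set \<times> nat set) option" where
  "unmove_pair p q = (\<lambda>(A, B).
     if movable q p A > movable p q B then map_option (\<lambda>A'. (A', B)) (move q p A)
     else map_option (\<lambda>B'. (A, B')) (move q p B))"

definition phi_pair :: "nat \<Rightarrow> nat \<Rightarrow> nat set \<times> nat set \<Rightarrow> nat" where
  "phi_pair p q = (\<lambda>(A, B). movable p q A + (movable p q B - movable q p A))"

definition eps_pair :: "nat \<Rightarrow> nat \<Rightarrow> nat set \<times> nat set \<Rightarrow> nat" where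
  "eps_pair p q = (\<lambda>(A, B). movable q p B + (movable q p A - movable p q B))"

definition columns :: "nat \<Rightarrow> nat \<Rightarrow> nat set set" where
  "columns n h = {S. S \<subseteq> {1..2*n} \<and> card S = h}"

lemma columnsD: "S \<in> columns n h \<Longrightarrow> S \<subseteq> {1..2*n} \<and> card S = h \<and> finite S"
  by (auto simp: columns_def dest: finite_subset)

lemma columns_exchange:
  assumes "S \<in> columns n h" "p \<in> S" "q \<notin> S" "q \<in> {1..2*n}"
  shows "insert q (S - {p}) \<in> columns n h"
proof -
  note S = columnsD[OF assms(1)]
  then have "card S = Suc (card (S - {p}))" using assms(2) card.remove by metis
  then have "card (insert q (S - {p})) = h" using S assms(3) by simp
  then show ?thesis using S assms(4) by (auto simp: columns_def)
qed

lemma move_columns: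
  "move p q S = Some S' \<Longrightarrow> S \<in> columns n h \<Longrightarrow> q \<in> {1..2*n} \<Longrightarrow> S' \<in> columns n h"
  by (auto simp: move_def columns_exchange split: if_splits)

lemma split_word_concat: "map length t = hs \<Longrightarrow> split_word hs (concat t) = t"
  by (induction t arbitrary: hs) auto

lemma split_word_lengths: "length w = sum_list hs \<Longrightarrow> concat (split_word hs w) = w \<and> map length (split_word hs w) = hs"
  by (induction hs arbitrary: w) auto

text \<open>
  All fillings of a shape, on which the passage from tableaux to reading words is a bijection
  compatible with the operators.
\<close>

definition fillings :: "nat \<Rightarrow> nat list \<Rightarrow> tableau set" where
  "fillings n hs = {t. map length t = hs \<and> set (concat t) \<subseteq> {1..2*n}}"

lemma tableaux_strings:
  fixes n hs i
  defines "T \<equiv> tableaux n hs" and "W \<equiv> words n (sum_list hs)"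
  shows "string_fun (fillings n hs) (f_op T i) (\<lambda>t. phi W i (concat t))"
    and "string_fun (fillings n hs) (e_op T i) (\<lambda>t. eps W i (concat t))"
    and "inverse_ops (fillings n hs) (f_op T i) (e_op T i)"
proof -
  have W: "concat t \<in> elems W" if "t \<in> fillings n hs" for t
    using that by (auto simp: fillings_def W_def elems_words length_concat)
  have unsplit: "split_word hs w \<in> fillings n hs \<and> concat (split_word hs w) = w" if "w \<in> elems W" for w
    using that split_word_lengths[of w hs]
    by (auto simp: fillings_def W_def elems_words simp del: set_concat)
  have ops: "f_op T i t = map_option (split_word hs) (f_op W i (concat t))"
    "e_op T i t = map_option (split_word hs) (e_op W i (concat t))" for t
    by (simp_all add: T_def W_def tableaux_def)
  have sn: "seminormal i W" by (simp add: W_def words_seminormal)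
  have sw: "split_word hs (concat t) = t" if "t \<in> fillings n hs" for t
    using that split_word_concat by (auto simp: fillings_def)
  note d = seminormalD[OF sn]
  show "string_fun (fillings n hs) (f_op T i) (\<lambda>t. phi W i (concat t))"
  proof (rule string_funI)
    fix t assume t: "t \<in> fillings n hs"
    show "phi W i (concat t) = 0" if "f_op T i t = None"
      using that d(1)[OF W[OF t]] by (simp add: ops)
    fix t' assume "f_op T i t = Some t'"
    then obtain w where w: "f_op W i (concat t) = Some w" "t' = split_word hs w" by (auto simp: ops)
    show "t' \<in> fillings n hs \<and> phi W i (concat t) = Suc (phi W i (concat t'))"
      using d(3)[OF W[OF t] w(1)] unsplit[of w] by (simp add: w(2))
  qed
  show "string_fun (fillings n hs) (e_op T i) (\<lambda>t. eps W i (concat t))"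
  proof (rule string_funI)
    fix t assume t: "t \<in> fillings n hs"
    show "eps W i (concat t) = 0" if "e_op T i t = None"
      using that d(2)[OF W[OF t]] by (simp add: ops)
    fix t' assume "e_op T i t = Some t'"
    then obtain w where w: "e_op W i (concat t) = Some w" "t' = split_word hs w" by (auto simp: ops)
    show "t' \<in> fillings n hs \<and> eps W i (concat t) = Suc (eps W i (concat t'))"
      using d(4)[OF W[OF t] w(1)] unsplit[of w] by (simp add: w(2))
  qed
  show "inverse_ops (fillings n hs) (f_op T i) (e_op T i)"
    unfolding inverse_ops_def
  proof (intro ballI allI conjI impI)
    fix t t' assume t: "t \<in> fillings n hs"
    show "e_op T i t' = Some t" if s: "f_op T i t = Some t'"
    proof -
      obtain w where w: "f_op W i (concat t) = Some w" "t' = split_word hs w" using s by (auto simp: ops)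
      show ?thesis
        using d(3)[OF W[OF t] w(1)] unsplit[of w] sw[OF t] by (simp add: ops w(2))
    qed
    show "f_op T i t' = Some t" if s: "e_op T i t = Some t'"
    proof -
      obtain w where w: "e_op W i (concat t) = Some w" "t' = split_word hs w" using s by (auto simp: ops)
      show ?thesis
        using d(4)[OF W[OF t] w(1)] unsplit[of w] sw[OF t] by (simp add: ops w(2))
    qed
  qed
qed

lemma tableaux_col:
  assumes "A \<in> columns n h" "1 \<le> i" "i < 2*n"
  shows "f_op (tableaux n [h]) i [col A] = map_option (\<lambda>A. [col A]) (move i (Suc i) A)"
    and "e_op (tableaux n [h]) i [col A] = map_option (\<lambda>A. [col A]) (move (Suc i) i A)"
proof -
  from assms(1) have A: "A \<subseteq> {1..2*n}" "h = card A" by (auto simp: columns_def)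
  have *: "split_word [h] (col A') = [col A']" if "A' \<in> columns n h" for A'
    using that by (auto simp: columns_def)
  show "f_op (tableaux n [h]) i [col A] = map_option (\<lambda>A. [col A]) (move i (Suc i) A)"
    "e_op (tableaux n [h]) i [col A] = map_option (\<lambda>A. [col A]) (move (Suc i) i A)"
    using *[OF move_columns[OF _ assms(1)], of i "Suc i"] *[OF move_columns[OF _ assms(1)], of "Suc i" i]
      words_col[OF A(1) assms(2,3)] assms(2,3)
    by (auto simp: tableaux_def A(2) map_option_case split: option.split)
qed

lemma tableaux_pair:
  assumes "A \<in> columns n h" "B \<in> columns n k" "1 \<le> i" "i < 2*n"
  defines "T \<equiv> tableaux n [h, k]" and "\<iota> \<equiv> \<lambda>(A, B). [col A, col B]"
  shows "f_op T i [col A, col B] = map_option \<iota> (move_pair i (Suc i) (A, B))"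
    and "e_op T i [col A, col B] = map_option \<iota> (unmove_pair i (Suc i) (A, B))"
    and "phi T i [col A, col B] = phi_pair i (Suc i) (A, B)"
    and "eps T i [col A, col B] = eps_pair i (Suc i) (A, B)"
proof -
  have AB: "A \<subseteq> {1..2*n}" "h = card A" "finite A" "B \<subseteq> {1..2*n}" "k = card B" "finite B"
    using columnsD[OF assms(1)] columnsD[OF assms(2)] by auto
  have sw: "split_word [h, k] (col A' @ col B') = [col A', col B']"
    if "A' \<in> columns n h" "B' \<in> columns n k" for A' B'
    using that by (auto simp: columns_def)
  have fill: "[col A, col B] \<in> fillings n [h, k]" using AB by (auto simp: fillings_def)
  have "set (col A) \<subseteq> {1..2*n}" "set (col B) \<subseteq> {1..2*n}" using AB by auto
  note app = words_append[OF this, of "card A" "card B" i, simplified]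
  note colA = words_col[OF AB(1) assms(3,4)] and colB = words_col[OF AB(4) assms(3,4)]
  show "phi T i [col A, col B] = phi_pair i (Suc i) (A, B)"
    "eps T i [col A, col B] = eps_pair i (Suc i) (A, B)"
    using string_length_eq[OF tableaux_strings(1) fill, of i] string_length_eq[OF tableaux_strings(2) fill, of i]
      app(1,2) colA colB
    by (simp_all add: phi_def eps_def T_def phi_pair_def eps_pair_def AB(2,5))
  have mA: "map_option (\<lambda>x. split_word [h, k] (x @ col B)) (map_option col (move p q A)) =
      map_option \<iota> (map_option (\<lambda>A'. (A', B)) (move p q A))" if "q \<in> {1..2*n}" for p q
    using sw[OF move_columns[OF _ assms(1) that] assms(2)]
    by (auto simp: \<iota>_def option.map_comp comp_def map_option_case simp del: split_word.simps split: option.split)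
  have mB: "map_option (\<lambda>x. split_word [h, k] (col A @ x)) (map_option col (move p q B)) =
      map_option \<iota> (map_option (\<lambda>B'. (A, B')) (move p q B))" if "q \<in> {1..2*n}" for p q
    using sw[OF assms(1) move_columns[OF _ assms(2) that]]
    by (auto simp: \<iota>_def option.map_comp comp_def map_option_case simp del: split_word.simps split: option.split)
  have f: "f_op T i [col A, col B] = map_option (split_word [h, k]) (f_op (words n (card A + card B)) i (col A @ col B))"
    and e: "e_op T i [col A, col B] = map_option (split_word [h, k]) (e_op (words n (card A + card B)) i (col A @ col B))"
    by (simp_all add: T_def tableaux_def AB(2,5))
  show "f_op T i [col A, col B] = map_option \<iota> (move_pair i (Suc i) (A, B))"
    unfolding f app(3) colA colB move_pair_def
    using mA[of "Suc i" i] mB[of "Suc i" i] assms(3,4)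
    by (simp add: if_distrib option.map_comp[of "split_word _"] comp_def del: split_word.simps)
  show "e_op T i [col A, col B] = map_option \<iota> (unmove_pair i (Suc i) (A, B))"
    unfolding e app(4) colA colB unmove_pair_def
    using mA[of i "Suc i"] mB[of i "Suc i"] assms(3,4)
    by (simp add: if_distrib option.map_comp[of "split_word _"] comp_def del: split_word.simps)
qed

lemma weight_words_col:
  assumes "S \<subseteq> {1..2*n}"
  shows "weight (words n (card S)) (col S) j =
     (if 1 \<le> j \<and> j \<le> 2*n - 1 then of_bool (j \<in> S) - of_bool (j + 1 \<in> S) else 0)"
proof -
  have *: "weight (words n (length w)) w j =
     (if 1 \<le> j \<and> j \<le> 2*n - 1 then of_bool (j \<in> set w) - of_bool (j + 1 \<in> set w) else 0)"
    if "distinct w" for w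
    using that by (induction w) (auto simp: words_Suc weight_tensor_cons letters_def)
  have "finite S" using assms finite_subset by auto
  then show ?thesis using *[of "col S"] by (simp add: col_def)
qed

section \<open>Knuth equivalence\<close>

abbreviation knuth :: "nat list \<Rightarrow> nat list \<Rightarrow> bool" where
  "knuth \<equiv> equivclp knuth_step"

lemma knuth_step_context: "knuth_step u v \<Longrightarrow> knuth_step (x @ u @ y) (x @ v @ y)"
proof (induction rule: knuth_step.induct)
  case (1 a b c u v)
  from knuth_step.intros(1)[OF this, of "x @ u" "v @ y"] show ?case by simp
next
  case (2 a b c u v)
  from knuth_step.intros(2)[OF this, of "x @ u" "v @ y"] show ?case by simp
qed

lemma knuth_context: "knuth u v \<Longrightarrow> knuth (x @ u @ y) (x @ v @ y)"
proof (induction rule: equivclp_induct)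
  case (step v w)
  then show ?case
    by (meson knuth_step_context equivclp_trans r_into_equivclp converse_r_into_equivclp)
qed simp

lemma knuth_mset: "knuth u v \<Longrightarrow> mset u = mset v"
proof (induction rule: equivclp_induct)
  case (step v w)
  have "mset a = mset b" if "knuth_step a b" for a b
    using that by induction auto
  with step show ?case by metis
qed simp

text \<open>
  For \<open>S\<close> an interval of letters and \<open>R\<close> the relation \<open>>\<close> or \<open>\<le>\<close>, the possible lengths \<open>m\<close> are
  the Knuth invariants of Greene for a single subsequence.
\<close>

definition chain :: "('a \<Rightarrow> 'a \<Rightarrow> bool) \<Rightarrow> 'a set \<Rightarrow> 'a list \<Rightarrow> nat \<Rightarrow> bool" where
  "chain R S w m \<longleftrightarrow> (\<exists>s. subseq s w \<and> sorted_wrt R s \<and> set s \<subseteq> S \<and> length s = m)"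

text \<open>
  A subsequence \<open>s\<close> of a factor may be exchanged for \<open>s'\<close> inside a longer chain, because every
  letter that fits before or after \<open>s\<close> also fits before or after \<open>s'\<close>.
\<close>

definition interchangeable :: "('a \<Rightarrow> 'a \<Rightarrow> bool) \<Rightarrow> 'a list \<Rightarrow> 'a list \<Rightarrow> bool" where
  "interchangeable R s s' \<longleftrightarrow> sorted_wrt R s' \<and> length s' = length s \<and>
     (\<forall>a. (\<forall>x\<in>set s. R a x) \<longrightarrow> (\<forall>x\<in>set s'. R a x)) \<and>
     (\<forall>a. (\<forall>x\<in>set s. R x a) \<longrightarrow> (\<forall>x\<in>set s'. R x a))"

lemma chain_replace:
  assumes "\<And>s. subseq s M \<Longrightarrow> sorted_wrt R s \<Longrightarrow> set s \<subseteq> S \<Longrightarrow> \<not> subseq s M' \<Longrightarrow>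
      \<exists>s'. subseq s' M' \<and> set s' \<subseteq> S \<and> interchangeable R s s'"
    and "chain R S (u @ M @ v) m"
  shows "chain R S (u @ M' @ v) m"
proof -
  obtain s where s: "subseq s (u @ M @ v)" "sorted_wrt R s" "set s \<subseteq> S" "length s = m"
    using assms(2) by (auto simp: chain_def)
  then obtain s1 s2 s3 where d: "s = s1 @ s2 @ s3" "subseq s1 u" "subseq s2 M" "subseq s3 v"
    by (metis subseq_appendE)
  have s2: "sorted_wrt R s2" "set s2 \<subseteq> S" using s(2,3) by (auto simp: d(1) sorted_wrt_append)
  then have "interchangeable R s2 s2" by (simp add: interchangeable_def)
  then obtain s' where s': "subseq s' M'" "set s' \<subseteq> S" "interchangeable R s2 s'"
    using assms(1)[OF d(3) s2] s2(2) by blast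
  have i: "sorted_wrt R s'" "length s' = length s2" using s'(3) by (simp_all add: interchangeable_def)
  have "subseq (s1 @ s' @ s3) (u @ M' @ v)"
    using d s'(1) by (simp add: list_emb_append_mono)
  moreover have "sorted_wrt R (s1 @ s' @ s3)"
  proof -
    have "\<forall>x\<in>set s1. \<forall>y\<in>set s2. R x y" "\<forall>x\<in>set s2. \<forall>y\<in>set s3. R x y"
      using s(2) by (simp_all add: d(1) sorted_wrt_append)
    then have "\<forall>x\<in>set s1. \<forall>y\<in>set s'. R x y" "\<forall>x\<in>set s'. \<forall>y\<in>set s3. R x y"
      using s'(3) unfolding interchangeable_def by blast+
    then show ?thesis using s(2) i(1) by (simp add: d(1) sorted_wrt_append ball_Un)
  qed
  moreover have "set (s1 @ s' @ s3) \<subseteq> S" "length (s1 @ s' @ s3) = m"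
    using s(3,4) s'(2) i(2) by (simp_all add: d(1))
  ultimately show ?thesis unfolding chain_def by blast
qed

lemma subseq_three:
  "subseq s [x, y, z] \<longleftrightarrow> s \<in> {[x, y, z], [x, y], [x, z], [x], [y, z], [y], [z], []}"
  unfolding in_set_subseqs[symmetric] by (simp add: Let_def)

text \<open>
  In each direction the only decreasing subsequence destroyed by the exchange is \<open>z x\<close>. The middle
  letter \<open>y\<close> can stand in for one of its letters, and belongs to \<open>S\<close> since \<open>S\<close> is convex.
\<close>

lemma chain_knuth_step_decreasing:
  fixes S :: "nat set"
  assumes S: "\<And>x y z. x \<in> S \<Longrightarrow> z \<in> S \<Longrightarrow> x \<le> y \<Longrightarrow> y \<le> z \<Longrightarrow> y \<in> S"
    and "knuth_step v w"
  shows "chain (>) S v m \<longleftrightarrow> chain (>) S w m"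
  using assms(2)
proof cases
  case (1 x y z a b)
  have bad: "\<exists>s'. subseq s' [x, z, y] \<and> set s' \<subseteq> S \<and> interchangeable (>) s s'"
    if "subseq s [z, x, y]" "sorted_wrt (>) s" "set s \<subseteq> S" "\<not> subseq s [x, z, y]" for s
  proof -
    have "s = [z, x]" using that(1,2,4) 1(3,4) unfolding subseq_three insert_iff empty_iff by (elim disjE; simp)
    then show ?thesis using 1 that(3) S[of x z y]
      by (intro exI[of _ "[z, y]"]) (auto simp: subseq_three interchangeable_def)
  qed
  have easy: "subseq s [z, x, y]" if "subseq s [x, z, y]" "sorted_wrt (>) s" for s
    using that 1(3,4) unfolding subseq_three insert_iff empty_iff by (elim disjE; simp)
  show ?thesis unfolding 1(1,2)
  proof
    assume "chain (>) S (a @ [x, z, y] @ b) m"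
    then show "chain (>) S (a @ [z, x, y] @ b) m"
      by (rule chain_replace[rotated]) (use easy in blast)
  next
    assume "chain (>) S (a @ [z, x, y] @ b) m"
    then show "chain (>) S (a @ [x, z, y] @ b) m"
      by (rule chain_replace[rotated]) (use bad in blast)
  qed
next
  case (2 x y z a b)
  have bad: "\<exists>s'. subseq s' [y, x, z] \<and> set s' \<subseteq> S \<and> interchangeable (>) s s'"
    if "subseq s [y, z, x]" "sorted_wrt (>) s" "set s \<subseteq> S" "\<not> subseq s [y, x, z]" for s
  proof -
    have "s = [z, x]" using that(1,2,4) 2(3,4) unfolding subseq_three insert_iff empty_iff by (elim disjE; simp)
    then show ?thesis using 2 that(3) S[of x z y]
      by (intro exI[of _ "[y, x]"]) (auto simp: subseq_three interchangeable_def)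
  qed
  have easy: "subseq s [y, z, x]" if "subseq s [y, x, z]" "sorted_wrt (>) s" for s
    using that 2(3,4) unfolding subseq_three insert_iff empty_iff by (elim disjE; simp)
  show ?thesis unfolding 2(1,2)
  proof
    assume "chain (>) S (a @ [y, x, z] @ b) m"
    then show "chain (>) S (a @ [y, z, x] @ b) m"
      by (rule chain_replace[rotated]) (use easy in blast)
  next
    assume "chain (>) S (a @ [y, z, x] @ b) m"
    then show "chain (>) S (a @ [y, x, z] @ b) m"
      by (rule chain_replace[rotated]) (use bad in blast)
  qed
qed

lemma chain_knuth_step_increasing:
  assumes "knuth_step v w"
  shows "chain (\<le>) (UNIV :: nat set) v m \<longleftrightarrow> chain (\<le>) UNIV w m"
  using assms
proof cases
  case (1 x y z a b)
  have bad: "\<exists>s'. subseq s' [z, x, y] \<and> set s' \<subseteq> UNIV \<and> interchangeable (\<le>) s s'"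
    if "subseq s [x, z, y]" "sorted_wrt (\<le>) s" "\<not> subseq s [z, x, y]" for s
  proof -
    have "s = [x, z]" using that 1(3,4) unfolding subseq_three insert_iff empty_iff by (elim disjE; simp)
    then show ?thesis using 1
      by (intro exI[of _ "[x, y]"]) (auto simp: subseq_three interchangeable_def)
  qed
  have easy: "subseq s [x, z, y]" if "subseq s [z, x, y]" "sorted_wrt (\<le>) s" for s
    using that 1(3,4) unfolding subseq_three insert_iff empty_iff by (elim disjE; simp)
  show ?thesis unfolding 1(1,2)
  proof
    assume "chain (\<le>) UNIV (a @ [z, x, y] @ b) m"
    then show "chain (\<le>) UNIV (a @ [x, z, y] @ b) m"
      by (rule chain_replace[rotated]) (use easy in blast)
  next
    assume "chain (\<le>) UNIV (a @ [x, z, y] @ b) m"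
    then show "chain (\<le>) UNIV (a @ [z, x, y] @ b) m"
      by (rule chain_replace[rotated]) (use bad in blast)
  qed
next
  case (2 x y z a b)
  have bad: "\<exists>s'. subseq s' [y, z, x] \<and> set s' \<subseteq> UNIV \<and> interchangeable (\<le>) s s'"
    if "subseq s [y, x, z]" "sorted_wrt (\<le>) s" "\<not> subseq s [y, z, x]" for s
  proof -
    have "s = [x, z]" using that 2(3,4) unfolding subseq_three insert_iff empty_iff by (elim disjE; simp)
    then show ?thesis using 2
      by (intro exI[of _ "[y, z]"]) (auto simp: subseq_three interchangeable_def)
  qed
  have easy: "subseq s [y, x, z]" if "subseq s [y, z, x]" "sorted_wrt (\<le>) s" for s
    using that 2(3,4) unfolding subseq_three insert_iff empty_iff by (elim disjE; simp)
  show ?thesis unfolding 2(1,2)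
  proof
    assume "chain (\<le>) UNIV (a @ [y, z, x] @ b) m"
    then show "chain (\<le>) UNIV (a @ [y, x, z] @ b) m"
      by (rule chain_replace[rotated]) (use easy in blast)
  next
    assume "chain (\<le>) UNIV (a @ [y, x, z] @ b) m"
    then show "chain (\<le>) UNIV (a @ [y, z, x] @ b) m"
      by (rule chain_replace[rotated]) (use bad in blast)
  qed
qed

lemma knuth_decreasing_chains:
  assumes "knuth v w" and "\<And>x y z. x \<in> S \<Longrightarrow> z \<in> S \<Longrightarrow> x \<le> y \<Longrightarrow> y \<le> z \<Longrightarrow> y \<in> S"
  shows "chain (>) S v m \<longleftrightarrow> chain (>) S w m"
  using assms(1)
proof (induction)
  case (step y z)
  then show ?case using chain_knuth_step_decreasing[of S] assms(2) by metis
qed simp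

lemma knuth_increasing_chains:
  assumes "knuth v w"
  shows "chain (\<le>) UNIV v m \<longleftrightarrow> chain (\<le>) UNIV w m"
  using assms
  by (induction) (use chain_knuth_step_increasing in blast)+

section \<open>Dominance\<close>

text \<open>
  Two columns side by side form a semistandard tableau when the first dominates the second in
  this sense (\<open>rows_weakly_increase_iff\<close>). Counting from above instead gives the condition for columns
  aligned at the bottom.
\<close>

definition row_dom :: "nat set \<Rightarrow> nat set \<Rightarrow> bool" where
  "row_dom A B \<longleftrightarrow> (\<forall>k. card (B \<inter> {..<k}) \<le> card (A \<inter> {..<k}))"

definition tail_dom :: "nat set \<Rightarrow> nat set \<Rightarrow> bool" where
  "tail_dom A B \<longleftrightarrow> (\<forall>k. card (A \<inter> {k..}) \<le> card (B \<inter> {k..}))"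

lemma card_split_at:
  fixes k :: nat assumes "finite A" shows "card A = card (A \<inter> {..<k}) + card (A \<inter> {k..})"
proof -
  have "A = (A \<inter> {..<k}) \<union> (A \<inter> {k..})" by auto
  moreover have "(A \<inter> {..<k}) \<inter> (A \<inter> {k..}) = {}" by auto
  ultimately show ?thesis using assms by (metis card_Un_disjoint finite_Int)
qed

lemma row_dom_iff_tail_dom:
  assumes "finite A" "finite B" "card A = card B"
  shows "row_dom A B \<longleftrightarrow> tail_dom A B"
proof -
  have "card (B \<inter> {..<k}) \<le> card (A \<inter> {..<k}) \<longleftrightarrow> card (A \<inter> {k..}) \<le> card (B \<inter> {k..})" for k
    using card_split_at[OF assms(1), of k] card_split_at[OF assms(2), of k] assms(3) by linarith
  then show ?thesis by (simp add: row_dom_def tail_dom_def)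
qed

lemma row_dom_card_le:
  assumes "row_dom A B" "finite A" "finite B" shows "card B \<le> card A"
proof -
  obtain k where "A \<union> B \<subseteq> {..<k}"
    using assms(2,3) finite_nat_set_iff_bounded[of "A \<union> B"] by auto
  then have "A \<inter> {..<k} = A" "B \<inter> {..<k} = B" by auto
  then show ?thesis using assms(1) unfolding row_dom_def by metis
qed

lemma mem_iff_card_lessThan:
  "x \<in> A \<longleftrightarrow> card (A \<inter> {..<Suc x}) = Suc (card (A \<inter> {..<x}))"
proof (cases "x \<in> A")
  case True
  then have "A \<inter> {..<Suc x} = insert x (A \<inter> {..<x})" by auto
  with True show ?thesis by simp
next
  case False
  then have "A \<inter> {..<Suc x} = A \<inter> {..<x}" by (auto simp: less_Suc_eq)
  with False show ?thesis by simp
qed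

lemma mem_iff_card_atLeast:
  assumes "finite A" shows "x \<in> A \<longleftrightarrow> card (A \<inter> {x..}) = Suc (card (A \<inter> {Suc x..}))"
proof (cases "x \<in> A")
  case True
  then have "A \<inter> {x..} = insert x (A \<inter> {Suc x..})" by auto
  with True assms show ?thesis by simp
next
  case False
  then have "A \<inter> {x..} = A \<inter> {Suc x..}" by (auto simp: Suc_le_eq le_less)
  with False show ?thesis by simp
qed

lemma decreasing_distinct: "sorted_wrt (>) (w :: nat list) \<Longrightarrow> distinct w"
  by (metis distinct_rev sorted_wrt_rev strict_sorted_iff)

lemma filter_col: "finite A \<Longrightarrow> filter P (col A) = col {x\<in>A. P x}"
  using col_eqI[of "filter P (col A)"] by (simp add: sorted_wrt_filter col_decreasing)

lemma subseq_col: "finite A \<Longrightarrow> subseq (col (A \<inter> S)) (col A)"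
  using filter_col[of A "\<lambda>x. x \<in> S"] subseq_filter_left[of "\<lambda>x. x \<in> S" "col A"]
  by (simp add: Int_def)

lemma chain_col_pair_bound:
  assumes "finite A" "finite B" "chain (>) S (col A @ col B) m"
  obtains s1 s2 where "m = card s1 + card s2" "s1 \<subseteq> A \<inter> S" "s2 \<subseteq> B \<inter> S"
    "\<And>x y. x \<in> s1 \<Longrightarrow> y \<in> s2 \<Longrightarrow> y < x"
proof -
  obtain s where s: "subseq s (col A @ col B)" "sorted_wrt (>) s" "set s \<subseteq> S" "length s = m"
    using assms(3) by (auto simp: chain_def)
  then obtain s1 s2 where d: "s = s1 @ s2" "subseq s1 (col A)" "subseq s2 (col B)"
    by (metis subseq_appendE)
  have "set s1 \<subseteq> A" "set s2 \<subseteq> B"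
    using list_emb_set[OF d(2)] list_emb_set[OF d(3)] assms(1,2) by auto
  moreover have "distinct s1" "distinct s2"
    using decreasing_distinct[OF s(2)] by (auto simp: d(1))
  ultimately show ?thesis
    using s that[of "set s1" "set s2"] by (auto simp: d(1) sorted_wrt_append distinct_card)
qed

text \<open>
  A decreasing subsequence of the word takes its larger letters from \<open>A\<close> and its smaller ones from
  \<open>B\<close>. If the cut is at \<open>j\<close>, the letters from \<open>B\<close> can be traded for letters of \<open>A\<close> below \<open>j\<close>.
\<close>

lemma chain_lessThan_le:
  assumes "finite A" "finite B" "row_dom A B" "chain (>) {..<k} (col A @ col B) m"
  shows "m \<le> card (A \<inter> {..<k})"
proof -
  obtain s1 s2 where s: "m = card s1 + card s2" "s1 \<subseteq> A \<inter> {..<k}" "s2 \<subseteq> B \<inter> {..<k}"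
    "\<And>x y. x \<in> s1 \<Longrightarrow> y \<in> s2 \<Longrightarrow> y < x"
    using chain_col_pair_bound[OF assms(1,2,4)] by blast
  have fin: "finite s1" "finite s2" using s(2,3) finite_subset by blast+
  show ?thesis
  proof (cases "s2 = {}")
    case True
    then show ?thesis using s(1,2) by (simp add: card_mono)
  next
    case False
    define j where "j = Suc (Max s2)"
    have j: "x < j" if "x \<in> s2" for x using that fin by (simp add: j_def less_Suc_eq_le)
    have "Max s2 \<in> s2" using False fin by simp
    then have j1: "j \<le> x" if "x \<in> s1" for x using s(4)[OF that] by (simp add: j_def Suc_le_eq)
    have jk: "j \<le> k" using \<open>Max s2 \<in> s2\<close> s(3) by (auto simp: j_def)
    have "card s2 \<le> card (B \<inter> {..<j})" using s(3) j by (intro card_mono) auto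
    also have "\<dots> \<le> card (A \<inter> {..<j})" using assms(3) by (simp add: row_dom_def)
    finally have "card s1 + card s2 \<le> card s1 + card (A \<inter> {..<j})" by simp
    also have "\<dots> = card (s1 \<union> (A \<inter> {..<j}))"
      using fin j1 by (subst card_Un_disjoint) fastforce+
    also have "\<dots> \<le> card (A \<inter> {..<k})"
      using s(2) jk by (intro card_mono) auto
    finally show ?thesis using s(1) by simp
  qed
qed

text \<open>
  Dual to \<open>chain_lessThan_le\<close>: now the letters from \<open>A\<close> are traded for letters of \<open>B\<close> above the cut.
\<close>

lemma chain_atLeast_le:
  assumes "finite A" "finite B" "tail_dom A B" "chain (>) {k..} (col A @ col B) m"
  shows "m \<le> card (B \<inter> {k..})"
proof -
  obtain s1 s2 where s: "m = card s1 + card s2" "s1 \<subseteq> A \<inter> {k..}" "s2 \<subseteq> B \<inter> {k..}"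
    "\<And>x y. x \<in> s1 \<Longrightarrow> y \<in> s2 \<Longrightarrow> y < x"
    using chain_col_pair_bound[OF assms(1,2,4)] by blast
  have fin: "finite s1" "finite s2" using s(2,3) finite_subset assms(1,2) by blast+
  show ?thesis
  proof (cases "s1 = {}")
    case True
    then show ?thesis using s(1,3) assms(2) by (simp add: card_mono)
  next
    case False
    define j where "j = Min s1"
    have j: "j \<le> x" if "x \<in> s1" for x using that fin by (simp add: j_def)
    have j0: "j \<in> s1" using False fin by (simp add: j_def)
    then have j1: "x < j" if "x \<in> s2" for x using s(4) that by blast
    have jk: "k \<le> j" using j0 s(2) by auto
    have "card s1 \<le> card (A \<inter> {j..})" using s(2) j assms(1) by (intro card_mono) auto
    also have "\<dots> \<le> card (B \<inter> {j..})" using assms(3) by (simp add: tail_dom_def)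
    finally have "card s1 + card s2 \<le> card (B \<inter> {j..}) + card s2" by simp
    also have "\<dots> = card ((B \<inter> {j..}) \<union> s2)"
      using fin j1 assms(2) by (subst card_Un_disjoint) fastforce+
    also have "\<dots> \<le> card (B \<inter> {k..})"
      using s(3) jk assms(2) by (intro card_mono) auto
    finally show ?thesis using s(1) by simp
  qed
qed

lemma chain_col_left:
  assumes "finite A" shows "chain (>) S (col A @ w) (card (A \<inter> S))"
proof -
  have "subseq (col (A \<inter> S)) (col A @ w)"
    using subseq_col[OF assms] by (simp add: list_emb_append2 subseq_rev_drop_many)
  then show ?thesis
    unfolding chain_def using assms by (intro exI[of _ "col (A \<inter> S)"]) (auto simp: col_decreasing)
qed

lemma chain_col_right:
  assumes "finite B" shows "chain (>) S (w @ col B) (card (B \<inter> S))"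
proof -
  have "subseq (col (B \<inter> S)) (w @ col B)"
    using subseq_col[OF assms] by (simp add: subseq_drop_many)
  then show ?thesis
    unfolding chain_def using assms by (intro exI[of _ "col (B \<inter> S)"]) (auto simp: col_decreasing)
qed

lemma mset_col_pair_eq:
  assumes "finite A" "finite B" "finite A'" "finite B'" "mset (col A @ col B) = mset (col A' @ col B')"
  shows "A = A' \<longleftrightarrow> B = B'"
proof -
  have "mset (col S) = mset_set S" if "finite S" for S
    using that mset_set_set[of "col S"] by (simp add: col_def)
  then have "mset_set A + mset_set B = mset_set A' + mset_set B'" using assms by simp
  then show ?thesis using assms(1-4)
    by (metis add_left_cancel add_right_cancel finite_set_mset_mset_set)
qed

text \<open>
  The bound of \<open>chain_lessThan_le\<close> is attained by \<open>A\<close> itself. So the Knuth class fixes how many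
  letters of \<open>A\<close> lie below each \<open>k\<close>, hence \<open>A\<close>, and then the content fixes \<open>B\<close>.
\<close>

lemma row_dom_unique:
  assumes fin: "finite A" "finite B" "finite A'" "finite B'"
    and dom: "row_dom A B" "row_dom A' B'" and k: "knuth (col A @ col B) (col A' @ col B')"
  shows "A = A' \<and> B = B'"
proof -
  have "card (A \<inter> {..<k}) = card (A' \<inter> {..<k})" for k
  proof (rule antisym)
    have *: "chain (>) {..<k} (col A @ col B) m \<longleftrightarrow> chain (>) {..<k} (col A' @ col B') m" for m
      by (rule knuth_decreasing_chains[OF k]) auto
    show "card (A \<inter> {..<k}) \<le> card (A' \<inter> {..<k})"
      using chain_lessThan_le[OF fin(3,4) dom(2)] chain_col_left[OF fin(1)] * by blast
    show "card (A' \<inter> {..<k}) \<le> card (A \<inter> {..<k})"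
      using chain_lessThan_le[OF fin(1,2) dom(1)] chain_col_left[OF fin(3)] * by blast
  qed
  then have "A = A'" using mem_iff_card_lessThan by (metis subsetI subset_antisym)
  with mset_col_pair_eq[OF fin knuth_mset[OF k]] show ?thesis by simp
qed

text \<open>
  The same for skew shapes aligned at the bottom, where the second column attains the bound.
\<close>

lemma tail_dom_unique:
  assumes fin: "finite A" "finite B" "finite A'" "finite B'"
    and dom: "tail_dom A B" "tail_dom A' B'" and k: "knuth (col A @ col B) (col A' @ col B')"
  shows "A = A' \<and> B = B'"
proof -
  have "card (B \<inter> {k..}) = card (B' \<inter> {k..})" for k
  proof (rule antisym)
    have *: "chain (>) {k..} (col A @ col B) m \<longleftrightarrow> chain (>) {k..} (col A' @ col B') m" for m
      by (rule knuth_decreasing_chains[OF k]) auto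
    show "card (B \<inter> {k..}) \<le> card (B' \<inter> {k..})"
      using chain_atLeast_le[OF fin(3,4) dom(2)] chain_col_right[OF fin(2)] * by blast
    show "card (B' \<inter> {k..}) \<le> card (B \<inter> {k..})"
      using chain_atLeast_le[OF fin(1,2) dom(1)] chain_col_right[OF fin(4)] * by blast
  qed
  then have "B = B'" using mem_iff_card_atLeast fin by (metis subsetI subset_antisym)
  with mset_col_pair_eq[OF fin knuth_mset[OF k]] show ?thesis by simp
qed

section \<open>Two-column tableaux\<close>

text \<open>
  Translates comparisons of entries in a row into comparisons of counting functions.
\<close>

lemma rev_col_nth_le:
  assumes "finite A" "k < card A"
  shows "rev (col A) ! k \<le> m \<longleftrightarrow> k < card (A \<inter> {..<Suc m})"
proof -
  have "col A = col ((A \<inter> {Suc m..}) \<union> (A \<inter> {..<Suc m}))"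
    by (rule arg_cong[of _ _ col]) auto
  also have "\<dots> = col (A \<inter> {Suc m..}) @ col (A \<inter> {..<Suc m})"
    using assms(1) by (intro col_append) auto
  finally have *: "rev (col A) = rev (col (A \<inter> {..<Suc m})) @ rev (col (A \<inter> {Suc m..}))" by simp
  have len: "length (rev (col (A \<inter> {..<Suc m}))) = card (A \<inter> {..<Suc m})" by simp
  show ?thesis
  proof (cases "k < card (A \<inter> {..<Suc m})")
    case True
    then have "rev (col A) ! k \<in> set (rev (col (A \<inter> {..<Suc m})))"
      unfolding * nth_append len by (auto intro!: nth_mem simp del: set_rev)
    with True show ?thesis by simp
  next
    case False
    have "length (rev (col A)) = card A" by simp
    then have "k - card (A \<inter> {..<Suc m}) < length (rev (col (A \<inter> {Suc m..})))"
      using False assms(2) arg_cong[OF *, of length] by simp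
    then have "rev (col A) ! k \<in> set (rev (col (A \<inter> {Suc m..})))"
      unfolding * nth_append len using False by (auto intro!: nth_mem simp del: set_rev)
    with False assms(1) show ?thesis by auto
  qed
qed

lemma rows_weakly_increase_iff:
  assumes "finite A" "finite B"
  shows "card B \<le> card A \<and> (\<forall>k<card B. rev (col A) ! k \<le> rev (col B) ! k) \<longleftrightarrow> row_dom A B"
proof (intro iffI conjI allI impI)
  assume *: "card B \<le> card A \<and> (\<forall>k<card B. rev (col A) ! k \<le> rev (col B) ! k)"
  show "row_dom A B" unfolding row_dom_def
  proof
    fix m show "card (B \<inter> {..<m}) \<le> card (A \<inter> {..<m})"
    proof (cases "card (B \<inter> {..<m})")
      case (Suc k)
      then obtain m' where m: "m = Suc m'" by (cases m) auto
      have "card (B \<inter> {..<m}) \<le> card B" using assms by (intro card_mono) auto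
      then have k: "k < card B" "k < card A" using Suc * by auto
      then have "rev (col B) ! k \<le> m'" using rev_col_nth_le[OF assms(2) k(1)] Suc m by simp
      then have "rev (col A) ! k \<le> m'" using * k by (meson order_trans)
      then show ?thesis using rev_col_nth_le[OF assms(1) k(2)] Suc m by simp
    qed simp
  qed
next
  assume *: "row_dom A B"
  show le: "card B \<le> card A" by (rule row_dom_card_le[OF * assms])
  fix k assume k: "k < card B"
  then have "k < card (B \<inter> {..<Suc (rev (col B) ! k)})"
    using rev_col_nth_le[OF assms(2) k] by blast
  then have "k < card (A \<inter> {..<Suc (rev (col B) ! k)})"
    using * unfolding row_dom_def by (meson less_le_trans)
  then show "rev (col A) ! k \<le> rev (col B) ! k"
    using rev_col_nth_le[OF assms(1)] k le by simp
qed

lemma col_nonempty: "finite A \<Longrightarrow> col A \<noteq> [] \<longleftrightarrow> A \<noteq> {}"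
  by (metis col_empty list.set(1) set_col)

lemma semistandard_single: "finite A \<Longrightarrow> semistandard [col A] \<longleftrightarrow> A \<noteq> {}"
  using col_nonempty[of A] by (auto simp: semistandard_def col_decreasing)

lemma semistandard_pair:
  assumes "finite A" "finite B"
  shows "semistandard [col A, col B] \<longleftrightarrow> A \<noteq> {} \<and> B \<noteq> {} \<and> row_dom A B"
  unfolding rows_weakly_increase_iff[OF assms, symmetric]
  using assms by (auto simp: semistandard_def col_decreasing col_nonempty less_Suc_eq)

text \<open>
  Empty columns are dropped, so that all tableaux with at most two columns have this form.
\<close>

definition two_cols :: "nat set \<Rightarrow> nat set \<Rightarrow> tableau" where
  "two_cols A B = filter (\<lambda>c. c \<noteq> []) [col A, col B]"

lemma concat_two_cols [simp]: "concat (two_cols A B) = col A @ col B"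
  by (simp add: two_cols_def)

lemma semistandard_two_cols:
  assumes "finite A" "finite B" "row_dom A B" shows "semistandard (two_cols A B)"
proof -
  have "card B \<le> card A" by (rule row_dom_card_le[OF assms(3,1,2)])
  then have "B = {}" if "A = {}" using that assms by simp
  moreover have "semistandard []" by (simp add: semistandard_def)
  ultimately show ?thesis
    using semistandard_pair[OF assms(1,2)] semistandard_single[OF assms(1)] assms
    by (cases "A = {}"; cases "B = {}") (auto simp: two_cols_def col_nonempty)
qed

lemma short_semistandard:
  assumes "semistandard t" "length t \<le> 2"
  obtains A B where "finite A" "finite B" "row_dom A B" "t = two_cols A B"
proof -
  have c: "c = col (set c) \<and> c \<noteq> []" if "c \<in> set t" for c
    using assms(1) that col_eqI[of c] by (auto simp: semistandard_def)
  have "t = [] \<or> (\<exists>c. t = [c]) \<or> (\<exists>c d. t = [c, d])"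
    using assms(2) by (auto simp: numeral_2_eq_2 le_Suc_eq length_Suc_conv)
  then consider "t = []" | c where "t = [c]" | c d where "t = [c, d]" by blast
  then show ?thesis
  proof cases
    case 1 then show ?thesis using that[of "{}" "{}"] by (auto simp: two_cols_def row_dom_def)
  next
    case 2
    then show ?thesis using that[of "set c" "{}"] c[of c] by (auto simp: two_cols_def row_dom_def)
  next
    case 3
    then have "c = col (set c)" "d = col (set d)" "c \<noteq> []" "d \<noteq> []" using c by auto
    moreover from this 3 have "row_dom (set c) (set d)"
      using semistandard_pair[of "set c" "set d"] assms(1) by auto
    ultimately show ?thesis using 3 that[of "set c" "set d"] by (auto simp: two_cols_def)
  qed
qed

text \<open>
  The first row is a weakly increasing subsequence of the column reading word.
\<close>

lemma increasing_chain_three_columns: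
  assumes "semistandard t" "2 < length t" shows "chain (\<le>) UNIV (concat t) 3"
proof -
  have "Suc (Suc (Suc 0)) \<le> length t" using assms(2) by simp
  then obtain c0 c1 c2 t' where t: "t = c0 # c1 # c2 # t'"
    unfolding Suc_le_length_iff by blast
  have ne: "c0 \<noteq> []" "c1 \<noteq> []" "c2 \<noteq> []" using assms(1) by (auto simp: t semistandard_def)
  have le: "rev (t ! j) ! 0 \<le> rev (t ! Suc j) ! 0" if "Suc j < length t" "t ! Suc j \<noteq> []" for j
    using assms(1) that unfolding semistandard_def by blast
  have "last c0 \<le> last c1" "last c1 \<le> last c2"
    using le[of 0] le[of 1] ne by (auto simp: t rev_nth last_conv_nth)
  moreover have "subseq [last c] c" if "c \<noteq> []" for c :: "nat list"
    using that by (simp add: subseq_singleton_left)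
  then have "subseq ([last c0] @ [last c1] @ [last c2] @ []) (c0 @ c1 @ c2 @ concat t')"
    using ne by (intro list_emb_append_mono) auto
  ultimately show ?thesis
    unfolding chain_def by (intro exI[of _ "[last c0, last c1, last c2]"]) (auto simp: t)
qed

lemma sorted_wrt_subseq: "subseq xs ys \<Longrightarrow> sorted_wrt P ys \<Longrightarrow> sorted_wrt P xs"
  by (induction rule: list_emb.induct) (auto dest: list_emb_set)

lemma no_increasing_chain_two_columns: "\<not> chain (\<le>) UNIV (col A @ col B) 3"
proof
  assume "chain (\<le>) UNIV (col A @ col B) 3"
  then obtain s where s: "subseq s (col A @ col B)" "sorted_wrt (\<le>) s" "length s = 3"
    by (auto simp: chain_def)
  then obtain s1 s2 where d: "s = s1 @ s2" "subseq s1 (col A)" "subseq s2 (col B)"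
    by (metis subseq_appendE)
  have le1: "length u \<le> 1" if u: "subseq u (col S)" "sorted_wrt (\<le>) u" for u S
  proof (rule ccontr)
    assume "\<not> length u \<le> 1"
    then obtain x y u' where "u = x # y # u'"
      by (metis One_nat_def le_Suc_eq length_Cons list.exhaust list.size(3) nat_le_linear zero_le)
    moreover have "sorted_wrt (>) u"
      using u(1) col_decreasing[of S] by (rule sorted_wrt_subseq)
    ultimately show False using u(2) by auto
  qed
  have "length s1 \<le> 1" "length s2 \<le> 1"
    using le1 d s(2) by (auto simp: sorted_wrt_append)
  then show False using s(3) d(1) by simp
qed

text \<open>
  Any tableau in the Knuth class of two columns has at most two columns, by the weakly increasing
  subsequences of length three; then \<open>row_dom_unique\<close> applies.
\<close>

lemma schensted_eq:
  assumes "finite A" "finite B" "row_dom A B" "knuth w (col A @ col B)"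
  shows "schensted w = two_cols A B"
  unfolding schensted_def
proof (rule the_equality, intro conjI)
  show "semistandard (two_cols A B)" by (rule semistandard_two_cols[OF assms(1-3)])
  show "knuth (concat (two_cols A B)) w" using assms(4) equivclp_sym by simp
  fix t assume t: "semistandard t \<and> knuth (concat t) w"
  then have k: "knuth (concat t) (col A @ col B)" using assms(4) equivclp_trans by metis
  have "\<not> 2 < length t"
    using increasing_chain_three_columns t knuth_increasing_chains[OF k] no_increasing_chain_two_columns by blast
  then obtain A' B' where "finite A'" "finite B'" "row_dom A' B'" "t = two_cols A' B'"
    using short_semistandard t by (metis not_less)
  then show "t = two_cols A B"
    using row_dom_unique[OF _ _ assms(1,2) _ assms(3), of A' B'] k by auto
qed

section \<open>Column insertion\<close>

lemma bump_past_larger: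
  assumes "sorted_wrt (>) (hs @ [f])" "x \<le> f"
  shows "knuth (x # hs @ f # w) (hs @ x # f # w)"
  using assms
proof (induction hs arbitrary: w)
  case (Cons h hs)
  obtain y ys where y: "hs @ [f] = y # ys" by (cases "hs @ [f]") auto
  have "y \<in> set (hs @ [f])" using y by simp
  then have "y < h" "x \<le> y"
    using Cons.prems by (auto simp: sorted_wrt_append)
  note knuth_step.intros(1)[OF this(2,1), of "[]" "ys @ w"]
  then have step: "knuth (x # h # y # ys @ w) (h # x # y # ys @ w)" by (simp add: r_into_equivclp)
  have "hs @ f # w = (hs @ [f]) @ w" by simp
  then have "hs @ f # w = y # ys @ w" unfolding y by simp
  with step have "knuth (x # h # hs @ f # w) (h # x # hs @ f # w)" by metis
  also have "knuth (x # hs @ f # w) (hs @ x # f # w)"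
    using Cons by simp
  then have "knuth (h # x # hs @ f # w) (h # hs @ x # f # w)"
    using knuth_context[of _ _ "[h]" "[]"] by simp
  finally show ?case by simp
qed simp

lemma bump_out:
  assumes "sorted_wrt (>) (x # ls)" "x \<le> f"
  shows "knuth (x # f # ls) (x # ls @ [f])"
  using assms
proof (induction ls arbitrary: x)
  case (Cons l ls)
  from knuth_step.intros(2)[of l x f "[]" ls] Cons.prems
  have "knuth (x # f # l # ls) (x # l # f # ls)" by (simp add: converse_r_into_equivclp)
  also have "knuth \<dots> (x # l # ls @ [f])"
    using knuth_context[OF Cons.IH[of l], of "[x]" "[]"] Cons.prems by simp
  finally show ?case by simp
qed simp

lemma col_insert_max:
  assumes "finite A" "\<And>x. x \<in> A \<Longrightarrow> x < a" shows "col (insert a A) = a # col A"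
  using col_append[of "{a}" A] assms by simp

text \<open>
  Inserting \<open>a\<close> into the column \<open>F\<close> expels the least entry that is at least \<open>a\<close>: on the way through
  the reading word \<open>a\<close> passes the larger letters, and then \<open>f\<close> passes the smaller ones.
\<close>

lemma column_bump:
  assumes "finite F" "f \<in> F" "a \<le> f" "\<And>x. x \<in> F \<Longrightarrow> a \<le> x \<Longrightarrow> f \<le> x"
  shows "knuth (a # col F) (col (insert a (F - {f})) @ [f])"
proof -
  let ?H = "{x\<in>F. f < x}" and ?L = "{x\<in>F. x < a}"
  have split: "f < x \<or> x = f \<or> x < a" if "x \<in> F" for x using assms(4)[OF that] by linarith
  have F: "F = ?H \<union> ({f} \<union> ?L)" "insert a (F - {f}) = ?H \<union> ({a} \<union> ?L)"
    using split assms(2,3) by fastforce+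
  have col: "col (?H \<union> ({c} \<union> ?L)) = col ?H @ c # col ?L" if "a \<le> c" "c \<le> f" for c
  proof -
    have "col (?H \<union> ({c} \<union> ?L)) = col ?H @ col ({c} \<union> ?L)"
      by (rule col_append) (use that assms(1) in auto)
    moreover have "col ({c} \<union> ?L) = col {c} @ col ?L"
      by (rule col_append) (use that assms(1) in auto)
    ultimately show ?thesis by simp
  qed
  have colF: "col F = col ?H @ f # col ?L" using col[OF assms(3) order_refl] F(1) by simp
  have colF': "col (insert a (F - {f})) = col ?H @ a # col ?L"
    using col[OF order_refl assms(3)] F(2) by simp
  have "sorted_wrt (>) (col ?H @ [f])" using assms(1) by (simp add: sorted_wrt_append col_decreasing)
  from bump_past_larger[OF this assms(3)]
  have "knuth (a # col F) (col ?H @ a # f # col ?L)" by (simp add: colF)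
  also have "knuth \<dots> (col ?H @ a # col ?L @ [f])"
    using bump_out[of a "col ?L" f] assms(1,3) knuth_context[of _ _ "col ?H" "[]"]
    by (simp add: col_decreasing)
  finally show ?thesis by (simp add: colF')
qed

text \<open>
  Insert the letters of \<open>A\<close> into \<open>B\<close> in increasing order. A letter that expels none would create a
  decreasing subsequence longer than \<open>B\<close>, which \<open>chain_atLeast_le\<close> forbids; so every letter of \<open>A\<close>
  bumps, and the lengths of the columns are exchanged. The last conjunct is an invariant of the
  induction: the entries still available to the next letter exceed everything expelled so far,
  so the expelled letters increase and form a column.
\<close>

lemma column_insertion:
  assumes "finite A" "finite B" "tail_dom A B"
  shows "\<exists>F E. finite F \<and> finite E \<and> row_dom F E \<and> card F = card B \<and> card E = card A \<and>
    knuth (col A @ col B) (col F @ col E) \<and> (\<forall>x\<in>F. (\<forall>d\<in>A. d < x) \<longrightarrow> (\<forall>e\<in>E. e < x))"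
  using assms
proof (induction A rule: finite_linorder_max_induct)
  case empty
  then show ?case by (intro exI[of _ B] exI[of _ "{}"]) (auto simp: row_dom_def)
next
  case (insert a A)
  have "card (A \<inter> {k..}) \<le> card (insert a A \<inter> {k..})" for k
    using insert.hyps(1) by (intro card_mono) auto
  then have "tail_dom A B" using insert.prems(2) unfolding tail_dom_def by (meson order_trans)
  from insert.IH[OF \<open>finite B\<close> this] obtain F E where FE': "finite F \<and> finite E \<and> row_dom F E \<and>
      card F = card B \<and> card E = card A \<and> knuth (col A @ col B) (col F @ col E) \<and>
      (\<forall>x\<in>F. (\<forall>d\<in>A. d < x) \<longrightarrow> (\<forall>e\<in>E. e < x))"
    by (elim exE)
  then have FE: "finite F" "finite E" "row_dom F E" "card F = card B"
    "card E = card A" "knuth (col A @ col B) (col F @ col E)"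
    "\<And>x e. x \<in> F \<Longrightarrow> \<forall>d\<in>A. d < x \<Longrightarrow> e \<in> E \<Longrightarrow> e < x" by simp_all
  have ins: "col (insert a A) = a # col A"
    by (rule col_insert_max) (use insert.hyps in blast)+
  have k: "knuth (col (insert a A) @ col B) (a # col F @ col E)"
    using knuth_context[OF FE(6), of "[a]" "[]"] by (simp add: ins)
  \<comment> \<open>otherwise the first column would grow\<close>
  have "\<exists>f\<in>F. a \<le> f"
  proof (rule ccontr)
    assume "\<not> (\<exists>f\<in>F. a \<le> f)"
    then have "\<And>x. x \<in> F \<Longrightarrow> x < a" by (simp add: not_le)
    then have "col (insert a F) = a # col F" "a \<notin> F" using FE(1) by (auto intro: col_insert_max)
    then have "chain (>) {0..} (a # col F @ col E) (Suc (card F))"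
      using chain_col_left[of "insert a F" "{0..}" "col E"] FE(1) by simp
    moreover have "chain (>) {0..} (col (insert a A) @ col B) m = chain (>) {0..} (a # col F @ col E) m" for m
      by (rule knuth_decreasing_chains[OF k]) auto
    ultimately have "Suc (card F) \<le> card (B \<inter> {0..})"
      using chain_atLeast_le[of "insert a A" B 0] insert.hyps(1) insert.prems by blast
    then show False using FE(4) by simp
  qed
  define f where "f = Min {x\<in>F. a \<le> x}"
  have "f \<in> {x\<in>F. a \<le> x}" unfolding f_def using \<open>\<exists>f\<in>F. a \<le> f\<close> FE(1) by (intro Min_in) auto
  then have f: "f \<in> F" "a \<le> f" by auto
  have fmin: "f \<le> x" if "x \<in> F" "a \<le> x" for x unfolding f_def using that FE(1) by simp
  \<comment> \<open>the expelled letter exceeds all earlier ones, so it heads the word of the second column\<close>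
  have fE: "e < f" if "e \<in> E" for e
    using FE(7)[OF f(1) _ that] insert.hyps(2) f(2) by (meson less_le_trans)
  have "knuth (a # col F @ col E) (col (insert a (F - {f})) @ [f] @ col E)"
    using knuth_context[OF column_bump[OF FE(1) f fmin], of "[]" "col E"] by simp
  moreover have "[f] @ col E = col (insert f E)" using FE(2) fE by (simp add: col_insert_max)
  ultimately have k': "knuth (col (insert a A) @ col B) (col (insert a (F - {f})) @ col (insert f E))"
    using equivclp_trans[OF k] by simp
  have aF: "a \<notin> F - {f}" using fmin f by force
  have "row_dom (insert a (F - {f})) (insert f E)" unfolding row_dom_def
  proof
    fix m
    have FEm: "card (E \<inter> {..<m}) \<le> card (F \<inter> {..<m})" using FE(3) by (simp add: row_dom_def)
    show "card (insert f E \<inter> {..<m}) \<le> card (insert a (F - {f}) \<inter> {..<m})"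
    proof (cases "f < m")
      case False
      then have "insert f E \<inter> {..<m} = E \<inter> {..<m}" "F \<inter> {..<m} \<subseteq> insert a (F - {f}) \<inter> {..<m}" by auto
      then show ?thesis using FEm card_mono[of "insert a (F - {f}) \<inter> {..<m}"] by (metis finite_Int finite_lessThan order_trans)
    next
      case True
      have "insert f E \<inter> {..<m} = insert f E" using True fE by force
      moreover have "f \<notin> E" using fE by blast
      ultimately have "card (insert f E \<inter> {..<m}) = Suc (card E)" using FE(2) by simp
      also have "E \<inter> {..<f} = E" using fE by auto
      then have "Suc (card E) \<le> Suc (card (F \<inter> {..<f}))" using FE(3) unfolding row_dom_def by (metis Suc_le_mono)
      also have "\<dots> = card (insert a (F \<inter> {..<f}))" using aF f by (subst card_insert_disjoint) auto
      also have "\<dots> \<le> card (insert a (F - {f}) \<inter> {..<m})" using True f by (intro card_mono) auto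
      finally show ?thesis .
    qed
  qed
  moreover have "card (insert a (F - {f})) = card B"
    using aF FE(1,4) f(1) by (metis card_insert_disjoint card.remove finite_Diff)
  moreover have "card (insert f E) = card (insert a A)"
    using FE(2,5) fE insert.hyps by (metis card_insert_disjoint less_irrefl)
  moreover have "e < x" if "x \<in> insert a (F - {f})" "\<forall>d\<in>insert a A. d < x" "e \<in> insert f E" for x e
  proof -
    have "x \<in> F" "x \<noteq> f" "a < x" using that by auto
    moreover from this have "f < x" using fmin[of x] by simp
    ultimately show ?thesis using FE(7)[of x e] that by auto
  qed
  moreover have "finite (insert a (F - {f}))" "finite (insert f E)" using FE(1,2) by auto
  ultimately show ?case using k' by blast
qed

section \<open>Promotion\<close>

text \<open>
  The last steps of \<open>\<psi>\<^sup>-\<^sup>1\<close> on a column from which the letter \<open>1\<close> has been deleted, and their inverse.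
  At most one cell is vacant, so at most one letter \<open>2n\<close> is added.
\<close>

definition shift_down :: "nat \<Rightarrow> nat \<Rightarrow> nat set \<Rightarrow> nat set" where
  "shift_down n r F = (\<lambda>x. x - 1) ` F \<union> (if card F = r then {} else {2*n})"

definition shift_up :: "nat \<Rightarrow> nat set \<Rightarrow> nat set" where
  "shift_up n S = Suc ` (S - {2*n}) \<union> (if 2*n \<in> S then {1} else {})"

lemma fill_shift_down:
  assumes "F \<subseteq> {2..2*n}" "card F = r \<or> Suc (card F) = r" "1 \<le> n"
  shows "replicate (r - card F) (2*n) @ map (\<lambda>x. x - 1) (col F) = col (shift_down n r F)"
    and "shift_down n r F \<in> columns n r"
proof -
  let ?w = "replicate (r - card F) (2*n) @ map (\<lambda>x. x - 1) (col F)"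
  have fin: "finite F" using assms(1) finite_subset by auto
  have "sorted_wrt (\<lambda>x y. x - 1 > y - 1) (col F)"
    using col_decreasing[of F] by (rule sorted_wrt_mono_rel[rotated]) (use assms(1) fin in force)
  then have "sorted_wrt (>) ?w"
    using assms(1,2) fin by (fastforce simp: sorted_wrt_append sorted_wrt_map)
  moreover have s: "set ?w = shift_down n r F"
    using assms(2) fin by (auto simp: shift_down_def)
  ultimately show *: "?w = col (shift_down n r F)" using col_eqI by metis
  have "card (shift_down n r F) = r" using arg_cong[OF *, of length] assms(2) by auto
  moreover have "x - 1 \<in> {1..2*n}" if "x \<in> F" for x using subsetD[OF assms(1) that] by auto
  then have "shift_down n r F \<subseteq> {1..2*n}" using assms(3) by (auto simp: shift_down_def simp del: atLeastAtMost_iff) auto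
  ultimately show "shift_down n r F \<in> columns n r" by (simp add: columns_def)
qed

text \<open>
  The bound \<open>k \<le> 2n\<close> keeps the added letter \<open>2n\<close> out of the count.
\<close>

lemma card_shift_down_lessThan:
  assumes "F \<subseteq> {2..2*n}" "k \<le> 2*n"
  shows "card (shift_down n r F \<inter> {..<k}) = card (F \<inter> {..<Suc k})"
proof -
  have "x \<in> F \<Longrightarrow> x - 1 < k \<longleftrightarrow> x < Suc k" for x using assms(1) by fastforce
  then have "shift_down n r F \<inter> {..<k} = (\<lambda>x. x - 1) ` (F \<inter> {..<Suc k})"
    using assms(2) by (auto simp: shift_down_def)
  moreover have "inj_on (\<lambda>x. x - 1) (F \<inter> {..<Suc k})"
    using assms(1) by (intro inj_onI) force
  ultimately show ?thesis by (simp add: card_image)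
qed

lemma columns_cut: "S \<in> columns n h \<Longrightarrow> 2*n < k \<Longrightarrow> S \<inter> {..<k} = S"
  by (force simp: columns_def)

lemma row_dom_shift_down:
  assumes "F \<subseteq> {2..2*n}" "E \<subseteq> {2..2*n}" "row_dom F E"
    "shift_down n r F \<in> columns n r" "shift_down n r E \<in> columns n r"
  shows "row_dom (shift_down n r F) (shift_down n r E)"
  unfolding row_dom_def
proof
  fix k
  show "card (shift_down n r E \<inter> {..<k}) \<le> card (shift_down n r F \<inter> {..<k})"
  proof (cases "k \<le> 2*n")
    case True
    then show ?thesis using assms(1-3) by (simp add: card_shift_down_lessThan row_dom_def)
  next
    case False
    then show ?thesis using columns_cut[OF assms(4)] columns_cut[OF assms(5)] assms(4,5)
      by (simp add: columns_def)
  qed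
qed

lemma shift_down_recover: "F \<subseteq> {2..2*n} \<Longrightarrow> F = Suc ` (shift_down n r F - {2*n})"
  by (force simp: shift_down_def image_iff)

lemma shift_up_columns: "S \<in> columns n h \<Longrightarrow> 1 \<le> n \<Longrightarrow> shift_up n S \<in> columns n h"
proof -
  assume S: "S \<in> columns n h" and n: "1 \<le> n"
  note d = columnsD[OF S]
  have "1 \<notin> Suc ` (S - {2*n})" using d by auto
  moreover have "card (Suc ` (S - {2*n})) = card (S - {2*n})" by (simp add: card_image)
  moreover have "2*n \<in> S \<Longrightarrow> card S = Suc (card (S - {2*n}))" using d by (metis card.remove)
  ultimately have "card (shift_up n S) = h" using d by (cases "2*n \<in> S") (auto simp: shift_up_def)
  moreover have "Suc x \<in> {1..2*n}" if "x \<in> S - {2*n}" for x using subsetD[of S "{1..2*n}" x] that d by auto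
  then have "shift_up n S \<subseteq> {1..2*n}" using n by (auto simp: shift_up_def simp del: atLeastAtMost_iff) auto
  ultimately show ?thesis by (simp add: columns_def)
qed

lemma shift_down_up:
  assumes "S \<in> columns n h" "1 \<le> n"
  shows "shift_down n h (shift_up n S - {1}) = S"
proof -
  note d = columnsD[OF assms(1)]
  have 1: "1 \<notin> Suc ` (S - {2*n})" using d by auto
  then have r: "shift_up n S - {1} = Suc ` (S - {2*n})" by (auto simp: shift_up_def)
  have "card (shift_up n S - {1}) = h \<longleftrightarrow> 2*n \<notin> S"
  proof (cases "2*n \<in> S")
    case True
    then have "card S = Suc (card (S - {2*n}))" using d by (metis card.remove)
    then show ?thesis using d True by (simp add: r card_image del: One_nat_def)
  next
    case False then show ?thesis using d by (simp add: r card_image del: One_nat_def)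
  qed
  then show ?thesis using r by (auto simp: shift_down_def image_image)
qed

lemma minus_one_subset: "A \<in> columns n h \<Longrightarrow> A - {1} \<subseteq> {2..2*n}"
  by (fastforce simp: columns_def)

lemma card_minus_one: "A \<in> columns n h \<Longrightarrow> card (A - {1}) = (if 1 \<in> A then h - 1 else h)"
  by (auto simp: columns_def card_Diff_singleton dest: finite_subset)

lemma filter_not_one: "finite A \<Longrightarrow> filter (\<lambda>x. x \<noteq> 1) (col A) = col (A - {1})"
  by (simp add: filter_col set_diff_eq)

lemma psi_inv_single:
  assumes "A \<in> columns n h" "1 \<le> n" "1 \<le> h"
  shows "psi_inv n h 1 [col A] = [col (shift_down n h (A - {1}))]"
proof -
  note d = columnsD[OF assms(1)]
  define P where "P = A - {1}"
  have P: "finite P" "filter (\<lambda>x. x \<noteq> 1) (col A) = col P"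
    using d by (simp_all add: P_def filter_not_one del: One_nat_def)
  have "schensted (col P) = two_cols P {}"
    using P by (intro schensted_eq) (auto simp: row_dom_def)
  moreover have "[0..<1] = [0::nat]" by simp
  ultimately have "psi_inv n h 1 [col A] = [replicate (h - card P) (2*n) @ map (\<lambda>x. x - 1) (col P)]"
    using P by (cases "P = {}")
       (simp_all add: psi_inv_def Let_def two_cols_def col_nonempty del: One_nat_def)
  then show ?thesis
    using fill_shift_down(1)[OF minus_one_subset[OF assms(1)], of h] card_minus_one[OF assms(1)] assms(2,3)
    by (auto simp: P_def split: if_splits)
qed

lemma elems_tableaux_single:
  assumes "1 \<le> h" shows "elems (tableaux n [h]) = (\<lambda>A. [col A]) ` columns n h"
proof (intro set_eqI iffI)
  fix t assume "t \<in> elems (tableaux n [h])"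
  then obtain c where c: "t = [c]" "sorted_wrt (>) c" "length c = h" "set c \<subseteq> {1..2*n}"
    by (auto simp: tableaux_def semistandard_def)
  then have "c = col (set c)" by (simp add: col_eqI)
  moreover from this c have "set c \<in> columns n h" unfolding columns_def
    using length_col[of "set c"] by simp
  ultimately show "t \<in> (\<lambda>A. [col A]) ` columns n h" using c(1) by blast
next
  fix t assume "t \<in> (\<lambda>A. [col A]) ` columns n h"
  then show "t \<in> elems (tableaux n [h])"
    using assms by (auto simp: tableaux_def semistandard_single dest!: columnsD)
qed

lemma elems_tableaux_pair:
  assumes "1 \<le> h" "1 \<le> k"
  shows "elems (tableaux n [h, k]) =
    (\<lambda>(A, B). [col A, col B]) ` {(A, B). A \<in> columns n h \<and> B \<in> columns n k \<and> row_dom A B}"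
proof (intro set_eqI iffI)
  fix t assume "t \<in> elems (tableaux n [h, k])"
  then obtain c d where c: "t = [c, d]" "sorted_wrt (>) c" "sorted_wrt (>) d" "length c = h"
     "length d = k" "set c \<subseteq> {1..2*n}" "set d \<subseteq> {1..2*n}" "semistandard t"
    by (auto simp: tableaux_def semistandard_def)
  then have "c = col (set c)" "d = col (set d)" by (simp_all add: col_eqI)
  moreover from this c have "set c \<in> columns n h" "set d \<in> columns n k"
    unfolding columns_def using length_col[of "set c"] length_col[of "set d"] by simp_all
  moreover have "row_dom (set c) (set d)"
    using semistandard_pair[of "set c" "set d"] c(1,8) calculation by simp
  ultimately show "t \<in> (\<lambda>(A, B). [col A, col B]) `
      {(A, B). A \<in> columns n h \<and> B \<in> columns n k \<and> row_dom A B}" using c(1) by force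
next
  fix t assume "t \<in> (\<lambda>(A, B). [col A, col B]) `
      {(A, B). A \<in> columns n h \<and> B \<in> columns n k \<and> row_dom A B}"
  then obtain A B where t: "t = [col A, col B]" "A \<in> columns n h" "B \<in> columns n k" "row_dom A B"
    by auto
  then show "t \<in> elems (tableaux n [h, k])"
    using assms columnsD[OF t(2)] columnsD[OF t(3)] by (auto simp: tableaux_def semistandard_pair subset_eq)
qed

lemma psi_eqI:
  assumes "inj_on (psi_inv n r s) (elems (tableaux n (replicate s r)))"
    "a \<in> elems (tableaux n (replicate s r))" "psi_inv n r s a = t"
  shows "psi n r s t = a"
  using assms inv_into_f_f unfolding psi_def by metis

lemma inj_psi_inv_single:
  assumes "1 \<le> n" "1 \<le> h"
  shows "inj_on (psi_inv n h 1) (elems (tableaux n [h]))"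
proof (rule inj_onI)
  fix s t assume "s \<in> elems (tableaux n [h])" "t \<in> elems (tableaux n [h])"
    "psi_inv n h 1 s = psi_inv n h 1 t"
  then obtain A B where A: "s = [col A]" "A \<in> columns n h" and B: "t = [col B]" "B \<in> columns n h"
    and eq: "col (shift_down n h (A - {1})) = col (shift_down n h (B - {1}))"
    using assms by (auto simp: elems_tableaux_single psi_inv_single simp del: One_nat_def)
  note sub = minus_one_subset[OF A(2)] minus_one_subset[OF B(2)]
  have "finite (shift_down n h (A - {1}))" "finite (shift_down n h (B - {1}))"
    using columnsD[OF A(2)] columnsD[OF B(2)] by (auto simp: shift_down_def)
  with eq have "shift_down n h (A - {1}) = shift_down n h (B - {1})" by (simp add: col_inj)
  then have AB: "A - {1} = B - {1}" using shift_down_recover[OF sub(1), of h] shift_down_recover[OF sub(2), of h] by simp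
  moreover have "1 \<in> A \<longleftrightarrow> 1 \<in> B"
    using AB card_minus_one[OF A(2)] card_minus_one[OF B(2)] assms(2) by (auto split: if_splits)
  ultimately have "A = B" by blast
  then show "s = t" using A B by simp
qed

text \<open>
  The letter that \<open>f\<^sub>i\<close> replaces by \<open>i + 1\<close>, read cyclically.
\<close>

definition source :: "nat \<Rightarrow> nat \<Rightarrow> nat" where
  "source n i = (if i = 0 then 2*n else i)"

lemma source_range: "i < 2*n \<Longrightarrow> source n i \<in> {1..2*n}" "i < 2*n \<Longrightarrow> Suc i \<in> {1..2*n}"
  by (auto simp: source_def)

lemma move_shift_up:
  assumes "S \<in> columns n h" "1 \<le> n"
  shows "move 1 2 (shift_up n S) = map_option (shift_up n) (move (2*n) 1 S)"
    and "move 2 1 (shift_up n S) = map_option (shift_up n) (move 1 (2*n) S)"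
proof -
  have 0: "0 \<notin> S" using assms(1) by (auto simp: columns_def)
  have mem: "1 \<in> shift_up n S \<longleftrightarrow> 2*n \<in> S" "2 \<in> shift_up n S \<longleftrightarrow> 1 \<in> S"
    using 0 assms(2) by (auto simp: shift_up_def image_iff numeral_2_eq_2)
  have 1: "insert 2 (shift_up n S - {1}) = shift_up n (insert 1 (S - {2*n}))" if "2*n \<in> S" "1 \<notin> S"
    using that 0 assms(2) by (auto simp: shift_up_def image_iff numeral_2_eq_2)
  have 2: "insert 1 (shift_up n S - {2}) = shift_up n (insert (2*n) (S - {1}))" if "2*n \<notin> S" "1 \<in> S"
    using that 0 assms(2) by (auto simp: shift_up_def image_iff numeral_2_eq_2)
  show "move 1 2 (shift_up n S) = map_option (shift_up n) (move (2*n) 1 S)"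
    "move 2 1 (shift_up n S) = map_option (shift_up n) (move 1 (2*n) S)"
    unfolding move_def using mem 1 2 by (auto simp del: One_nat_def)
qed

lemma rect_crystal_simps:
  "elems (rect_crystal n r s) = elems (tableaux n (replicate s r))"
  "weight (rect_crystal n r s) = weight (tableaux n (replicate s r))"
  "i \<noteq> 0 \<Longrightarrow> f_op (rect_crystal n r s) i = f_op (tableaux n (replicate s r)) i"
  "i \<noteq> 0 \<Longrightarrow> e_op (rect_crystal n r s) i = e_op (tableaux n (replicate s r)) i"
  "f_op (rect_crystal n r s) 0 t = map_option (psi_inv n r s) (f_op (tableaux n (replicate s r)) 1 (psi n r s t))"
  "e_op (rect_crystal n r s) 0 t = map_option (psi_inv n r s) (e_op (tableaux n (replicate s r)) 1 (psi n r s t))"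
  by (simp_all add: rect_crystal_def Let_def)

text \<open>
  On a single column \<open>\<psi>\<close> is the rotation \<open>shift_up\<close> of the alphabet, which carries the move from
  \<open>2n\<close> to \<open>1\<close> to the move from \<open>1\<close> to \<open>2\<close>.
\<close>

lemma rect_single_ops:
  assumes "A \<in> columns n h" "1 \<le> n" "1 \<le> h" "i < 2*n"
  shows "f_op (rect_crystal n h 1) i [col A] = map_option (\<lambda>A. [col A]) (move (source n i) (Suc i) A)"
    and "e_op (rect_crystal n h 1) i [col A] = map_option (\<lambda>A. [col A]) (move (Suc i) (source n i) A)"
proof -
  have inv: "psi_inv n h 1 [col (shift_up n S)] = [col S]" if "S \<in> columns n h" for S
    using psi_inv_single[OF shift_up_columns[OF that]] shift_down_up[OF that] assms(2,3) by simp
  have psi: "psi n h 1 [col A] = [col (shift_up n A)]"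
    using assms shift_up_columns[OF assms(1)] inv[OF assms(1)] inj_psi_inv_single[of n h]
    by (intro psi_eqI) (auto simp: elems_tableaux_single)
  note T = tableaux_col[OF shift_up_columns[OF assms(1,2)], of 1, simplified]
  note mv = move_columns[OF _ assms(1)]
  have z: "f_op (rect_crystal n h 1) 0 [col A] = map_option (\<lambda>A. [col A]) (move (2*n) 1 A)"
    "e_op (rect_crystal n h 1) 0 [col A] = map_option (\<lambda>A. [col A]) (move 1 (2*n) A)"
    unfolding rect_crystal_simps psi
    using T mv[of _ 1] mv[of _ "2*n"] inv move_shift_up[OF assms(1,2)] assms(2)
    by (auto simp: option.map_comp comp_def numeral_2_eq_2 intro!: map_option_cong)
  show "f_op (rect_crystal n h 1) i [col A] = map_option (\<lambda>A. [col A]) (move (source n i) (Suc i) A)"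
    "e_op (rect_crystal n h 1) i [col A] = map_option (\<lambda>A. [col A]) (move (Suc i) (source n i) A)"
    using z tableaux_col[OF assms(1), of i] assms(4)
    by (cases "i = 0"; simp add: source_def rect_crystal_simps)+
qed

lemma rect_single_seminormal:
  assumes "1 \<le> n" "1 \<le> h" "i < 2*n"
  shows "seminormal i (rect_crystal n h 1)"
    and "A \<in> columns n h \<Longrightarrow> phi (rect_crystal n h 1) i [col A] = movable (source n i) (Suc i) A"
    and "A \<in> columns n h \<Longrightarrow> eps (rect_crystal n h 1) i [col A] = movable (Suc i) (source n i) A"
proof -
  let ?R = "rect_crystal n h 1" and ?p = "source n i" and ?q = "Suc i"
  have el: "elems ?R = (\<lambda>A. [col A]) ` columns n h"
    using elems_tableaux_single[OF assms(2)] by (simp add: rect_crystal_simps)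
  have ops: "f_op ?R i [col A] = map_option (\<lambda>A. [col A]) (move ?p ?q A)"
    "e_op ?R i [col A] = map_option (\<lambda>A. [col A]) (move ?q ?p A)" if "A \<in> columns n h" for A
    using rect_single_ops[OF that assms] .
  have sc: "set (col A) = A" if "A \<in> columns n h" for A using columnsD[OF that] by simp
  have ne: "?p \<noteq> ?q" using assms(1) by (auto simp: source_def)
  have s: "string_fun (columns n h) (move p q) (movable p q)" if "q \<in> {1..2*n}" "p \<noteq> q" for p q
    by (rule string_funI) (use move_columns[of p q] that in \<open>auto simp: move_def movable_def split: if_splits\<close>)
  have 1: "string_fun (elems ?R) (f_op ?R i) (\<lambda>t. movable ?p ?q (set (hd t)))"
    unfolding el using source_range[OF assms(3)] ne
    by (intro string_fun_image[OF s]) (auto simp: ops sc simp del: One_nat_def)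
  have 2: "string_fun (elems ?R) (e_op ?R i) (\<lambda>t. movable ?q ?p (set (hd t)))"
    unfolding el using source_range[OF assms(3)] ne
    by (intro string_fun_image[OF s]) (auto simp: ops sc simp del: One_nat_def)
  have mv: "move q p A' = Some A" if "move p q A = Some A'" "p \<noteq> q" for p q A A'
    using that by (auto simp: move_def split: if_splits)
  have 3: "inverse_ops (elems ?R) (f_op ?R i) (e_op ?R i)"
    unfolding inverse_ops_def el
  proof (intro ballI allI conjI impI)
    fix t t' assume "t \<in> (\<lambda>A. [col A]) ` columns n h" "f_op ?R i t = Some t'"
    then obtain A A' where "t = [col A]" "t' = [col A']" "A \<in> columns n h" "move ?p ?q A = Some A'"
      using ops by auto
    then show "e_op ?R i t' = Some t"
      using ops(2)[of A'] mv[of ?p ?q A A'] ne move_columns[of ?p ?q A A' n h] source_range[OF assms(3)] by simp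
  next
    fix t t' assume "t \<in> (\<lambda>A. [col A]) ` columns n h" "e_op ?R i t = Some t'"
    then obtain A A' where "t = [col A]" "t' = [col A']" "A \<in> columns n h" "move ?q ?p A = Some A'"
      using ops by auto
    then show "f_op ?R i t' = Some t"
      using ops(1)[of A'] mv[of ?q ?p A A'] ne move_columns[of ?q ?p A A' n h] source_range[OF assms(3)] by simp
  qed
  show "seminormal i ?R" by (rule seminormalI(1)[OF 1 2 3])
  show "phi ?R i [col A] = movable ?p ?q A" "eps ?R i [col A] = movable ?q ?p A"
    if "A \<in> columns n h"
    using seminormalI(2,3)[OF 1 2 3, of "[col A]"] that by (auto simp: el sc simp del: One_nat_def)
qed

lemma tensor_columns:
  assumes "1 \<le> n" "1 \<le> h" "1 \<le> k" "i < 2*n" "A \<in> columns n h" "B \<in> columns n k"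
  defines "C \<equiv> tensor_list [rect_crystal n h 1, rect_crystal n k 1]"
    and "\<iota> \<equiv> \<lambda>(A, B). [[col A], [col B]]"
  shows "f_op C i (\<iota> (A, B)) = map_option \<iota> (move_pair (source n i) (Suc i) (A, B))"
    and "e_op C i (\<iota> (A, B)) = map_option \<iota> (unmove_pair (source n i) (Suc i) (A, B))"
    and "phi C i (\<iota> (A, B)) = phi_pair (source n i) (Suc i) (A, B)"
    and "eps C i (\<iota> (A, B)) = eps_pair (source n i) (Suc i) (A, B)"
proof -
  let ?R = "rect_crystal n h 1" and ?S = "rect_crystal n k 1"
  have C: "C = tensor_cons ?R (tensor_list [?S])" by (simp add: C_def tensor_list_def)
  have sR: "seminormal i ?R" and sS: "seminormal i ?S" using rect_single_seminormal assms by auto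
  have sS': "seminormal i (tensor_list [?S])"
    unfolding tensor_list_def using seminormal_tensor_cons[OF sS seminormal_trivial] by simp
  have mem: "[col A] \<in> elems ?R" "[col B] \<in> elems ?S" "[[col B]] \<in> elems (tensor_list [?S])"
    using assms by (auto simp: rect_crystal_simps elems_tableaux_single tensor_list_def elems_tensor_cons)
  note S1 = tensor_single[OF sS mem(2)]
  note R = rect_single_ops[OF assms(5,1,2,4)] rect_single_seminormal(2,3)[OF assms(1,2,4,5)]
  note S = rect_single_ops[OF assms(6,1,3,4)] rect_single_seminormal(2,3)[OF assms(1,3,4,6)]
  show "phi C i (\<iota> (A, B)) = phi_pair (source n i) (Suc i) (A, B)"
    "eps C i (\<iota> (A, B)) = eps_pair (source n i) (Suc i) (A, B)"
    using phi_tensor_cons[OF sR sS' mem(1,3)] eps_tensor_cons[OF sR sS' mem(1,3)]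
    by (simp_all add: C \<iota>_def S1 R S phi_pair_def eps_pair_def del: One_nat_def)
  show "f_op C i (\<iota> (A, B)) = map_option \<iota> (move_pair (source n i) (Suc i) (A, B))"
    "e_op C i (\<iota> (A, B)) = map_option \<iota> (unmove_pair (source n i) (Suc i) (A, B))"
    by (simp_all add: C \<iota>_def f_tensor_cons e_tensor_cons S1 R S move_pair_def unmove_pair_def
        option.map_comp comp_def del: One_nat_def)
qed

section \<open>Promotion on rectangles with two columns\<close>

lemma card_inter_of_mset:
  assumes "finite A" "finite B" "finite A'" "finite B'" "mset (col A @ col B) = mset (col A' @ col B')"
  shows "card (A \<inter> S) + card (B \<inter> S) = card (A' \<inter> S) + card (B' \<inter> S)"
proof -
  have *: "size (filter_mset (\<lambda>x. x \<in> S) (mset (col C @ col D))) = card (C \<inter> S) + card (D \<inter> S)"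
    if "finite C" "finite D" for C D
    using that by (simp add: mset_filter[symmetric] filter_col Int_def del: mset_filter)
  show ?thesis using *[OF assms(1,2)] *[OF assms(3,4)] unfolding assms(5) by simp
qed

lemma psi_inv_pair:
  assumes "2 \<le> n" "A \<in> columns n n" "B \<in> columns n n"
    "finite F" "finite E" "row_dom F E" "card F = card (B - {1})" "card E = card (A - {1})"
    "knuth (col (A - {1}) @ col (B - {1})) (col F @ col E)"
  shows "psi_inv n n 2 [col A, col B] = [col (shift_down n n F), col (shift_down n n E)]"
    and "F \<subseteq> {2..2*n}" "E \<subseteq> {2..2*n}" "shift_down n n F \<in> columns n n" "shift_down n n E \<in> columns n n"
proof -
  note dA = columnsD[OF assms(2)] and dB = columnsD[OF assms(3)]
  have "set (col (A - {1}) @ col (B - {1})) = set (col F @ col E)"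
    using knuth_mset[OF assms(9)] by (metis set_mset_mset)
  then have FE: "F \<union> E = (A - {1}) \<union> (B - {1})" using assms(4,5) dA dB by simp
  then show sub: "F \<subseteq> {2..2*n}" "E \<subseteq> {2..2*n}"
    using minus_one_subset[OF assms(2)] minus_one_subset[OF assms(3)] by blast+
  have c: "card F = n \<or> Suc (card F) = n" "card E = n \<or> Suc (card E) = n"
    using assms(1,7,8) card_minus_one[OF assms(2)] card_minus_one[OF assms(3)] by auto
  then have ne: "F \<noteq> {}" "E \<noteq> {}" using assms(1) by auto
  have "filter (\<lambda>x. x \<noteq> 1) (concat [col A, col B]) = col (A - {1}) @ col (B - {1})"
    using dA dB by (simp add: filter_not_one del: One_nat_def)
  moreover have "schensted (col (A - {1}) @ col (B - {1})) = [col F, col E]"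
    using schensted_eq[OF assms(4,5,6,9)] ne assms(4,5) by (simp add: two_cols_def col_nonempty)
  moreover have "[0..<2] = [0, 1::nat]" by (simp add: numeral_2_eq_2)
  ultimately have "psi_inv n n 2 [col A, col B] =
     [replicate (n - card F) (2*n) @ map (\<lambda>x. x - 1) (col F),
      replicate (n - card E) (2*n) @ map (\<lambda>x. x - 1) (col E)]"
    by (simp add: psi_inv_def Let_def del: One_nat_def concat.simps filter.simps)
  then show "psi_inv n n 2 [col A, col B] = [col (shift_down n n F), col (shift_down n n E)]"
    "shift_down n n F \<in> columns n n" "shift_down n n E \<in> columns n n"
    using fill_shift_down[OF sub(1) c(1)] fill_shift_down[OF sub(2) c(2)] assms(1) by auto
qed

text \<open>
  Deleting the letters \<open>1\<close> from a rectangle leaves a skew shape whose columns are still aligned at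
  the bottom. This holds whether the letter \<open>1\<close> occurs in none, one or both of the columns.
\<close>

lemma tail_dom_minus_one:
  assumes "A \<in> columns n n" "B \<in> columns n n" "row_dom A B"
  shows "tail_dom (A - {1}) (B - {1})"
  unfolding tail_dom_def
proof
  fix k
  have "tail_dom A B"
    using row_dom_iff_tail_dom[of A B] columnsD[OF assms(1)] columnsD[OF assms(2)] assms(3) by simp
  moreover have "(S - {1}) \<inter> {k..} = S \<inter> {max 2 k..}" if "S \<in> columns n n" for S
    using that by (fastforce simp: columns_def)
  ultimately show "card ((A - {1}) \<inter> {k..}) \<le> card ((B - {1}) \<inter> {k..})"
    using assms(1,2) unfolding tail_dom_def by metis
qed

lemma psi_inv_pair_exists:
  assumes "2 \<le> n" "A \<in> columns n n" "B \<in> columns n n" "row_dom A B"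
  obtains F E where "finite F" "finite E" "row_dom F E" "card F = card (B - {1})" "card E = card (A - {1})"
    "knuth (col (A - {1}) @ col (B - {1})) (col F @ col E)"
proof -
  have "finite (A - {1})" "finite (B - {1})" using columnsD[OF assms(2)] columnsD[OF assms(3)] by auto
  from column_insertion[OF this tail_dom_minus_one[OF assms(2-4)]] that show ?thesis by blast
qed

abbreviation "rect_pairs n \<equiv> {(A, B). A \<in> columns n n \<and> B \<in> columns n n \<and> row_dom A B}"

lemma elems_rect_pair:
  "2 \<le> n \<Longrightarrow> elems (tableaux n (replicate 2 n)) = (\<lambda>(A, B). [col A, col B]) ` rect_pairs n"
  using elems_tableaux_pair[of n n n] by (simp add: numeral_2_eq_2)

text \<open>
  The result determines the rectified tableau, hence the Knuth class of the skew tableau, hence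
  the skew tableau by \<open>tail_dom_unique\<close>. The numbers of deleted letters are read off from its
  column lengths.
\<close>

lemma inj_psi_inv_pair:
  assumes "2 \<le> n"
  shows "inj_on (psi_inv n n 2) (elems (tableaux n (replicate 2 n)))"
proof (rule inj_onI)
  fix s t assume "s \<in> elems (tableaux n (replicate 2 n))" "t \<in> elems (tableaux n (replicate 2 n))"
    and eq: "psi_inv n n 2 s = psi_inv n n 2 t"
  then obtain A B A' B' where s: "s = [col A, col B]" "A \<in> columns n n" "B \<in> columns n n" "row_dom A B"
    and t: "t = [col A', col B']" "A' \<in> columns n n" "B' \<in> columns n n" "row_dom A' B'"
    unfolding elems_rect_pair[OF assms] by auto
  obtain F E where F: "finite F" "finite E" "row_dom F E" "card F = card (B - {1})" "card E = card (A - {1})"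
    "knuth (col (A - {1}) @ col (B - {1})) (col F @ col E)"
    using psi_inv_pair_exists[OF assms s(2-4)] .
  obtain F' E' where F': "finite F'" "finite E'" "row_dom F' E'" "card F' = card (B' - {1})" "card E' = card (A' - {1})"
    "knuth (col (A' - {1}) @ col (B' - {1})) (col F' @ col E')"
    using psi_inv_pair_exists[OF assms t(2-4)] .
  note p = psi_inv_pair[OF assms s(2,3) F] and p' = psi_inv_pair[OF assms t(2,3) F']
  have "shift_down n n F = shift_down n n F'" "shift_down n n E = shift_down n n E'"
    using eq p(1) p'(1) columnsD[OF p(4)] columnsD[OF p(5)] columnsD[OF p'(4)] columnsD[OF p'(5)]
    by (simp_all add: s(1) t(1) col_inj)
  then have FE: "F = F'" "E = E'"
    using shift_down_recover[of _ n n] p(2,3) p'(2,3) by metis+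
  then have "knuth (col (A - {1}) @ col (B - {1})) (col (A' - {1}) @ col (B' - {1}))"
    using F(6) F'(6) equivclp_sym equivclp_trans by metis
  then have *: "A - {1} = A' - {1} \<and> B - {1} = B' - {1}"
    using columnsD[OF s(2)] columnsD[OF s(3)] columnsD[OF t(2)] columnsD[OF t(3)]
    by (intro tail_dom_unique tail_dom_minus_one[OF s(2-4)] tail_dom_minus_one[OF t(2-4)]) auto
  have "1 \<in> A \<longleftrightarrow> 1 \<in> A'" "1 \<in> B \<longleftrightarrow> 1 \<in> B'"
    using * card_minus_one[OF s(2)] card_minus_one[OF s(3)] card_minus_one[OF t(2)] card_minus_one[OF t(3)] assms
    by (auto split: if_splits)
  then have "A = A'" "B = B'" using * by blast+
  then show "s = t" using s t by simp
qed

lemma psi_inv_pair_elems: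
  assumes "2 \<le> n"
  shows "psi_inv n n 2 ` elems (tableaux n (replicate 2 n)) = elems (tableaux n (replicate 2 n))"
proof (rule endo_inj_surj[OF _ _ inj_psi_inv_pair[OF assms]])
  have "finite (columns n n)" unfolding columns_def by simp
  then have "finite (columns n n \<times> columns n n)" by simp
  then have "finite (rect_pairs n)" by (rule rev_finite_subset) auto
  then show "finite (elems (tableaux n (replicate 2 n)))" unfolding elems_rect_pair[OF assms] by simp
  show "psi_inv n n 2 ` elems (tableaux n (replicate 2 n)) \<subseteq> elems (tableaux n (replicate 2 n))"
  proof
    fix t assume "t \<in> psi_inv n n 2 ` elems (tableaux n (replicate 2 n))"
    then obtain A B where s: "t = psi_inv n n 2 [col A, col B]" "A \<in> columns n n" "B \<in> columns n n" "row_dom A B"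
      unfolding elems_rect_pair[OF assms] by auto
    obtain F E where F: "finite F" "finite E" "row_dom F E" "card F = card (B - {1})" "card E = card (A - {1})"
      "knuth (col (A - {1}) @ col (B - {1})) (col F @ col E)"
      using psi_inv_pair_exists[OF assms s(2-4)] .
    note p = psi_inv_pair[OF assms s(2,3) F]
    have "row_dom (shift_down n n F) (shift_down n n E)" using row_dom_shift_down[OF p(2,3) F(3) p(4,5)] .
    then show "t \<in> elems (tableaux n (replicate 2 n))"
      unfolding elems_rect_pair[OF assms] s(1) p(1) using p(4,5) by auto
  qed
qed

lemma card_exchange_lessThan:
  assumes "finite S" "i \<in> S" "Suc i \<notin> S"
  shows "card (insert (Suc i) (S - {i}) \<inter> {..<k}) = (if k = Suc i then card (S \<inter> {..<k}) - 1 else card (S \<inter> {..<k}))"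
proof -
  consider "k \<le> i" | "k = Suc i" | "Suc i < k" by linarith
  then show ?thesis
  proof cases
    case 1
    then have "insert (Suc i) (S - {i}) \<inter> {..<k} = S \<inter> {..<k}" by auto
    with 1 show ?thesis by simp
  next
    case 2
    then have "insert (Suc i) (S - {i}) \<inter> {..<k} = S \<inter> {..<k} - {i}" by auto
    with 2 assms show ?thesis by simp
  next
    case 3
    then have e: "insert (Suc i) (S - {i}) \<inter> {..<k} = insert (Suc i) (S \<inter> {..<k} - {i})" by auto
    have "i \<in> S \<inter> {..<k}" using 3 assms by auto
    then have "card (S \<inter> {..<k}) = Suc (card (S \<inter> {..<k} - {i}))" by (meson card.remove finite_Int finite_lessThan)
    with 3 assms(3) show ?thesis unfolding e by simp
  qed
qed

lemma card_exchange_lessThan':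
  assumes "finite S" "Suc i \<in> S" "i \<notin> S"
  shows "card (insert i (S - {Suc i}) \<inter> {..<k}) = (if k = Suc i then Suc (card (S \<inter> {..<k})) else card (S \<inter> {..<k}))"
proof -
  let ?T = "insert i (S - {Suc i})"
  have "insert (Suc i) (?T - {i}) = S" using assms by auto
  then have *: "card (S \<inter> {..<k}) = (if k = Suc i then card (?T \<inter> {..<k}) - 1 else card (?T \<inter> {..<k}))"
    using card_exchange_lessThan[of ?T i k] assms by simp
  have "k = Suc i \<Longrightarrow> card (?T \<inter> {..<k}) > 0" by (auto simp: card_gt_0_iff)
  then show ?thesis using * by auto
qed

lemma card_lessThan_Suc: "card (S \<inter> {..<Suc i}) = card (S \<inter> {..<i}) + of_bool (i \<in> S)"
proof -
  have "S \<inter> {..<Suc i} = (if i \<in> S then insert i (S \<inter> {..<i}) else S \<inter> {..<i})"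
    by (auto simp: less_Suc_eq)
  then show ?thesis by simp
qed

text \<open>
  Moving \<open>i\<close> to \<open>i + 1\<close> affects only the count below \<open>i + 1\<close>. If this happens in the first column, the
  signature rule forbids \<open>i\<close> without \<open>i + 1\<close> in the second one, which leaves room for the loss.
\<close>

lemma row_dom_move_pair:
  assumes "finite A" "finite B" "row_dom A B" "move_pair i (Suc i) (A, B) = Some (A', B')"
  shows "row_dom A' B'"
  unfolding row_dom_def
proof
  fix k
  have d: "card (B \<inter> {..<k}) \<le> card (A \<inter> {..<k})" for k using assms(3) by (simp add: row_dom_def)
  show "card (B' \<inter> {..<k}) \<le> card (A' \<inter> {..<k})"
  proof (cases "movable i (Suc i) B \<le> movable (Suc i) i A")
    case False
    then have "A' = A" "B' = insert (Suc i) (B - {i})" "i \<in> B" "Suc i \<notin> B"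
      using assms(4) by (auto simp: move_pair_def movable_def move_def)
    then show ?thesis using card_exchange_lessThan[OF assms(2), of i k] d[of k] by (auto split: if_splits)
  next
    case True
    then have A: "A' = insert (Suc i) (A - {i})" "B' = B" "i \<in> A" "Suc i \<notin> A"
      using assms(4) by (auto simp: move_pair_def move_def split: if_splits)
    then have "\<not> (i \<in> B \<and> Suc i \<notin> B)" using True by (auto simp: movable_def)
    then have "Suc (card (B \<inter> {..<Suc i})) \<le> card (A \<inter> {..<Suc i})"
      using d[of i] d[of "Suc (Suc i)"] A(3,4) by (auto simp: card_lessThan_Suc)
    then show ?thesis using A card_exchange_lessThan[OF assms(1) A(3,4), of k] d[of k] by (auto split: if_splits)
  qed
qed

lemma row_dom_unmove_pair:
  assumes "finite A" "finite B" "row_dom A B" "unmove_pair i (Suc i) (A, B) = Some (A', B')"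
  shows "row_dom A' B'"
  unfolding row_dom_def
proof
  fix k
  have d: "card (B \<inter> {..<k}) \<le> card (A \<inter> {..<k})" for k using assms(3) by (simp add: row_dom_def)
  show "card (B' \<inter> {..<k}) \<le> card (A' \<inter> {..<k})"
  proof (cases "movable i (Suc i) B < movable (Suc i) i A")
    case True
    then have "B' = B" "A' = insert i (A - {Suc i})" "Suc i \<in> A" "i \<notin> A"
      using assms(4) by (auto simp: unmove_pair_def movable_def move_def)
    then show ?thesis using card_exchange_lessThan'[OF assms(1), of i k] d[of k] by (auto split: if_splits)
  next
    case False
    then have B: "B' = insert i (B - {Suc i})" "A' = A" "Suc i \<in> B" "i \<notin> B"
      using assms(4) by (auto simp: unmove_pair_def move_def split: if_splits)
    then have "\<not> (Suc i \<in> A \<and> i \<notin> A)" using False by (auto simp: movable_def)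
    then have "Suc (card (B \<inter> {..<Suc i})) \<le> card (A \<inter> {..<Suc i})"
      using d[of i] d[of "Suc (Suc i)"] B(3,4) by (auto simp: card_lessThan_Suc)
    then show ?thesis using B card_exchange_lessThan'[OF assms(2) B(3,4), of k] d[of k] by (auto split: if_splits)
  qed
qed

lemma move_pair_columns:
  assumes "move_pair p q (A, B) = Some (A', B')" "A \<in> columns n h" "B \<in> columns n k" "q \<in> {1..2*n}"
  shows "A' \<in> columns n h \<and> B' \<in> columns n k"
  using assms move_columns[of p q A A' n h] move_columns[of p q B B' n k]
  by (auto simp: move_pair_def split: if_splits)

lemma unmove_pair_columns:
  assumes "unmove_pair p q (A, B) = Some (A', B')" "A \<in> columns n h" "B \<in> columns n k" "p \<in> {1..2*n}"
  shows "A' \<in> columns n h \<and> B' \<in> columns n k"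
  using assms move_columns[of q p A A' n h] move_columns[of q p B B' n k]
  by (auto simp: unmove_pair_def split: if_splits)

lemma tableaux_pair_seminormal:
  assumes "1 \<le> i" "i < 2*n" "1 \<le> h" "1 \<le> k"
  shows "seminormal i (tableaux n [h, k])"
proof -
  let ?T = "tableaux n [h, k]"
  have sub: "elems ?T \<subseteq> fillings n [h, k]" by (auto simp: tableaux_def fillings_def)
  have f: "t' \<in> elems ?T" if t: "t \<in> elems ?T" "f_op ?T i t = Some t'" for t t'
  proof -
    obtain A B where A: "t = [col A, col B]" "A \<in> columns n h" "B \<in> columns n k" "row_dom A B"
      using t(1) unfolding elems_tableaux_pair[OF assms(3,4)] by auto
    obtain A' B' where A': "move_pair i (Suc i) (A, B) = Some (A', B')" "t' = [col A', col B']"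
      using t(2) tableaux_pair(1)[OF A(2,3) assms(1,2)] by (auto simp: A(1))
    have "A' \<in> columns n h \<and> B' \<in> columns n k \<and> row_dom A' B'"
      using move_pair_columns[OF A'(1) A(2,3)] row_dom_move_pair[OF _ _ A(4) A'(1)]
        columnsD[OF A(2)] columnsD[OF A(3)] assms(2) by simp
    then show ?thesis unfolding elems_tableaux_pair[OF assms(3,4)] A'(2) by auto
  qed
  have e: "t' \<in> elems ?T" if t: "t \<in> elems ?T" "e_op ?T i t = Some t'" for t t'
  proof -
    obtain A B where A: "t = [col A, col B]" "A \<in> columns n h" "B \<in> columns n k" "row_dom A B"
      using t(1) unfolding elems_tableaux_pair[OF assms(3,4)] by auto
    obtain A' B' where A': "unmove_pair i (Suc i) (A, B) = Some (A', B')" "t' = [col A', col B']"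
      using t(2) tableaux_pair(2)[OF A(2,3) assms(1,2)] by (auto simp: A(1))
    have "A' \<in> columns n h \<and> B' \<in> columns n k \<and> row_dom A' B'"
      using unmove_pair_columns[OF A'(1) A(2,3)] row_dom_unmove_pair[OF _ _ A(4) A'(1)]
        columnsD[OF A(2)] columnsD[OF A(3)] assms(1,2) by simp
    then show ?thesis unfolding elems_tableaux_pair[OF assms(3,4)] A'(2) by auto
  qed
  note st = tableaux_strings[of n "[h, k]" i]
  have "string_fun (elems ?T) (f_op ?T i) (\<lambda>t. phi (words n (sum_list [h, k])) i (concat t))"
    using string_funD[OF st(1)] sub f by (intro string_funI) blast+
  moreover have "string_fun (elems ?T) (e_op ?T i) (\<lambda>t. eps (words n (sum_list [h, k])) i (concat t))"
    using string_funD[OF st(2)] sub e by (intro string_funI) blast+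
  moreover have "inverse_ops (elems ?T) (f_op ?T i) (e_op ?T i)"
    using st(3) sub unfolding inverse_ops_def by blast
  ultimately show ?thesis by (rule seminormalI(1))
qed

text \<open>
  Since \<open>\<psi>\<^sup>-\<^sup>1\<close> is a bijection of the tableaux, the operators at the node \<open>0\<close> are conjugate to those at
  the node \<open>1\<close>.
\<close>

lemma rect_pair_zero:
  assumes "2 \<le> n"
  defines "T \<equiv> tableaux n [n, n]" and "R \<equiv> rect_crystal n n 2"
  shows "a \<in> elems T \<Longrightarrow> f_op R 0 (psi_inv n n 2 a) = map_option (psi_inv n n 2) (f_op T 1 a)"
    and "a \<in> elems T \<Longrightarrow> e_op R 0 (psi_inv n n 2 a) = map_option (psi_inv n n 2) (e_op T 1 a)"
    and "a \<in> elems T \<Longrightarrow> phi R 0 (psi_inv n n 2 a) = phi T 1 a"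
    and "a \<in> elems T \<Longrightarrow> eps R 0 (psi_inv n n 2 a) = eps T 1 a"
    and "seminormal 0 R"
proof -
  have T: "T = tableaux n (replicate 2 n)" by (simp add: T_def numeral_2_eq_2)
  have psi: "psi n n 2 (psi_inv n n 2 a) = a" if "a \<in> elems T" for a
    using psi_eqI[OF inj_psi_inv_pair[OF assms(1)]] that T by simp
  have R: "elems R = psi_inv n n 2 ` elems T"
    using psi_inv_pair_elems[OF assms(1)] by (simp add: R_def T rect_crystal_simps)
  show f: "f_op R 0 (psi_inv n n 2 a) = map_option (psi_inv n n 2) (f_op T 1 a)"
    and e: "e_op R 0 (psi_inv n n 2 a) = map_option (psi_inv n n 2) (e_op T 1 a)" if "a \<in> elems T" for a
    using psi[OF that] by (simp_all add: R_def T rect_crystal_simps)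
  have sT: "seminormal 1 T" unfolding T_def using tableaux_pair_seminormal[of 1 n n n] assms(1) by simp
  have 1: "string_fun (elems R) (f_op R 0) (\<lambda>t. phi T 1 (psi n n 2 t))"
    unfolding R using sT f psi by (intro string_fun_image) (auto simp: seminormal_def)
  have 2: "string_fun (elems R) (e_op R 0) (\<lambda>t. eps T 1 (psi n n 2 t))"
    unfolding R using sT e psi by (intro string_fun_image) (auto simp: seminormal_def)
  have 3: "inverse_ops (elems R) (f_op R 0) (e_op R 0)"
    unfolding R inverse_ops_def
  proof (intro ballI allI conjI impI)
    fix t t' assume "t \<in> psi_inv n n 2 ` elems T" "f_op R 0 t = Some t'"
    then obtain a a' where "t = psi_inv n n 2 a" "t' = psi_inv n n 2 a'" "a \<in> elems T" "f_op T 1 a = Some a'"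
      using f by auto
    then show "e_op R 0 t' = Some t" using e[of a'] seminormalD(3)[OF sT, of a a'] by simp
  next
    fix t t' assume "t \<in> psi_inv n n 2 ` elems T" "e_op R 0 t = Some t'"
    then obtain a a' where "t = psi_inv n n 2 a" "t' = psi_inv n n 2 a'" "a \<in> elems T" "e_op T 1 a = Some a'"
      using e by auto
    then show "f_op R 0 t' = Some t" using f[of a'] seminormalD(4)[OF sT, of a a'] by simp
  qed
  show "seminormal 0 R" by (rule seminormalI(1)[OF 1 2 3])
  show "phi R 0 (psi_inv n n 2 a) = phi T 1 a" "eps R 0 (psi_inv n n 2 a) = eps T 1 a" if "a \<in> elems T" for a
    using seminormalI(2,3)[OF 1 2 3, of "psi_inv n n 2 a"] psi[OF that] that by (simp_all add: R)
qed

lemma row_dom_minus_one: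
  assumes "row_dom A B" "1 \<in> A \<longleftrightarrow> 1 \<in> B" shows "row_dom (A - {1}) (B - {1})"
  unfolding row_dom_def
proof
  fix k
  have e: "(S - {1}) \<inter> {..<k} = S \<inter> {..<k} - {1}" for S :: "nat set" by auto
  have "card (B \<inter> {..<k}) \<le> card (A \<inter> {..<k})" using assms(1) by (simp add: row_dom_def)
  then show "card ((B - {1}) \<inter> {..<k}) \<le> card ((A - {1}) \<inter> {..<k})"
    unfolding e using assms(2) by (auto simp: card_Diff_singleton_if)
qed

text \<open>
  If both columns or neither of them contain \<open>2n\<close>, no sliding takes place under promotion.
\<close>

lemma psi_inv_shift_up:
  assumes "2 \<le> n" "A \<in> columns n n" "B \<in> columns n n" "row_dom A B" "2*n \<in> A \<longleftrightarrow> 2*n \<in> B"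
  shows "psi_inv n n 2 [col (shift_up n A), col (shift_up n B)] = [col A, col B]"
    and "[col (shift_up n A), col (shift_up n B)] \<in> elems (tableaux n [n, n])"
proof -
  note r = shift_up_columns[OF assms(2)] shift_up_columns[OF assms(3)]
  have 1: "1 \<le> n" using assms(1) by simp
  have cut: "card (shift_up n S \<inter> {..<Suc k}) = card (S \<inter> {..<k}) + of_bool (2*n \<in> S \<and> 1 \<le> k)"
    if "k \<le> 2*n" "S \<in> columns n n" for S k
  proof -
    have "0 \<notin> S" using that by (auto simp: columns_def)
    have "shift_up n S \<inter> {..<Suc k} = Suc ` (S \<inter> {..<k}) \<union> (if 2*n \<in> S \<and> 1 \<le> k then {1} else {})"
    proof -
      have "Suc ` (S - {2*n}) \<inter> {..<Suc k} = Suc ` ((S - {2*n}) \<inter> {..<k})" by blast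
      also have "(S - {2*n}) \<inter> {..<k} = S \<inter> {..<k}" using that(1) by fastforce
      finally have "Suc ` (S - {2*n}) \<inter> {..<Suc k} = Suc ` (S \<inter> {..<k})" .
      moreover have "{1::nat} \<inter> {..<Suc k} = (if 1 \<le> k then {1} else {})" by auto
      ultimately show ?thesis unfolding shift_up_def Int_Un_distrib2 by (simp del: One_nat_def)
    qed
    moreover have "1 \<notin> Suc ` (S \<inter> {..<k})" using \<open>0 \<notin> S\<close> by auto
    ultimately show ?thesis by (auto simp: card_image)
  qed
  have dom: "row_dom (shift_up n A) (shift_up n B)" unfolding row_dom_def
  proof
    fix m
    show "card (shift_up n B \<inter> {..<m}) \<le> card (shift_up n A \<inter> {..<m})"
    proof (cases "0 < m \<and> m \<le> 2*n")
      case True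
      then obtain k where "m = Suc k" "k \<le> 2*n" by (cases m) auto
      then show ?thesis using cut[OF _ assms(2), of k] cut[OF _ assms(3), of k] assms(4,5)
        by (simp add: row_dom_def)
    next
      case False
      then have "m = 0 \<or> 2*n < m" by auto
      then show ?thesis
        using columns_cut[OF r(1)[OF 1], of m] columns_cut[OF r(2)[OF 1], of m] r(1)[OF 1] r(2)[OF 1]
        by (auto simp: columns_def)
    qed
  qed
  then show "[col (shift_up n A), col (shift_up n B)] \<in> elems (tableaux n [n, n])"
    unfolding elems_tableaux_pair[OF 1 1] using r[OF 1] by auto
  have mem: "1 \<in> shift_up n S \<longleftrightarrow> 2*n \<in> S" if "S \<in> columns n n" for S
    using that by (auto simp: shift_up_def columns_def)
  have fin: "finite (shift_up n A - {1})" "finite (shift_up n B - {1})"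
    using columnsD[OF r(1)[OF 1]] columnsD[OF r(2)[OF 1]] by auto
  have c: "card (shift_up n A - {1}) = card (shift_up n B - {1})"
    using card_minus_one[OF r(1)[OF 1]] card_minus_one[OF r(2)[OF 1]] mem assms by simp
  have "row_dom (shift_up n A - {1}) (shift_up n B - {1})"
    using row_dom_minus_one[OF dom] mem assms by simp
  from psi_inv_pair(1)[OF assms(1) r[OF 1] fin this c c[symmetric] equivclp_refl]
  show "psi_inv n n 2 [col (shift_up n A), col (shift_up n B)] = [col A, col B]"
    using shift_down_up[OF assms(2) 1] shift_down_up[OF assms(3) 1] by simp
qed

text \<open>
  The first column of the preimage contains the single letter \<open>1\<close>, and \<open>2\<close> occurs in exactly one
  of the columns. If \<open>2\<close> were in the second column, it could be appended to the letters up to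
  \<open>n + 1\<close> of the first one, giving a decreasing subsequence that is too long for the equal counts
  of the hypothesis on \<open>{1, \<dots>, n}\<close>.
\<close>

lemma psi_inv_preimage_mixed:
  assumes n: "2 \<le> n" and A: "A \<in> columns n n" and B: "B \<in> columns n n" and dom: "row_dom A B"
    and one: "1 \<in> A" "1 \<notin> B" and top: "2*n \<notin> A" "2*n \<in> B"
    and half: "card (A \<inter> {..<Suc n}) = card (B \<inter> {..<Suc n})"
  obtains A0 B0 where "A0 \<in> columns n n" "B0 \<in> columns n n" "row_dom A0 B0"
    "psi_inv n n 2 [col A0, col B0] = [col A, col B]" "1 \<in> A0" "2 \<in> A0" "1 \<notin> B0" "2 \<notin> B0"
proof -
  have "[col A, col B] \<in> elems (tableaux n (replicate 2 n))"
    unfolding elems_rect_pair[OF n] using A B dom by auto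
  then have "[col A, col B] \<in> psi_inv n n 2 ` elems (tableaux n (replicate 2 n))"
    unfolding psi_inv_pair_elems[OF n] .
  then obtain A0 B0 where AB: "A0 \<in> columns n n" "B0 \<in> columns n n" "row_dom A0 B0"
    and psi: "psi_inv n n 2 [col A0, col B0] = [col A, col B]"
    unfolding elems_rect_pair[OF n] by force
  obtain F E where F: "finite F" "finite E" "row_dom F E" "card F = card (B0 - {1})" "card E = card (A0 - {1})"
    "knuth (col (A0 - {1}) @ col (B0 - {1})) (col F @ col E)"
    using psi_inv_pair_exists[OF n AB] .
  note p = psi_inv_pair[OF n AB(1,2) F]
  have low: "shift_down n n F = A" "shift_down n n E = B"
    using psi p(1) columnsD[OF p(4)] columnsD[OF p(5)] columnsD[OF A] columnsD[OF B] by (simp_all add: col_inj)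
  \<comment> \<open>no vacant cell in the first column and one in the second: the letter 1 occurs once\<close>
  have "card F = n" using top(1) by (auto simp: low(1)[symmetric] shift_down_def split: if_splits)
  then have B01: "1 \<notin> B0" using F(4) card_minus_one[OF AB(2)] n by (auto split: if_splits)
  have "card E \<noteq> n"
  proof
    assume "card E = n"
    then have "B = (\<lambda>x. x - 1) ` E" using low(2) by (simp add: shift_down_def)
    then show False using top(2) p(3) n by force
  qed
  then have A01: "1 \<in> A0" using F(5) card_minus_one[OF AB(1)] by (auto split: if_splits)
  have F2: "2 \<in> F"
  proof -
    have "\<exists>x\<in>F. 1 = x - 1"
      using one(1) \<open>card F = n\<close> unfolding low(1)[symmetric] shift_down_def by auto
    then obtain x where "x \<in> F" "1 = x - 1" by blast
    moreover from this have "x = 2" by simp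
    ultimately show ?thesis by simp
  qed
  have E2: "2 \<notin> E" using one(2) unfolding low(2)[symmetric] by (force simp: shift_down_def)
  have fin: "finite (A0 - {1})" "finite (B0 - {1})" using columnsD[OF AB(1)] columnsD[OF AB(2)] by auto
  note count = card_inter_of_mset[OF fin F(1,2) knuth_mset[OF F(6)]]
  have "card ((A0 - {1}) \<inter> {2}) + card ((B0 - {1}) \<inter> {2}) = 1"
    using count[of "{2}"] F2 E2 by simp
  moreover have "(S - {1}) \<inter> {2} = (if 2 \<in> S then {2} else {})" for S :: "nat set" by auto
  ultimately have two: "(2 \<in> A0) \<noteq> (2 \<in> B0)" by (auto split: if_splits)
  have "2 \<in> A0"
  proof (rule ccontr)
    assume 2: "2 \<notin> A0"
    then have B02: "2 \<in> B0" using two by simp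
    let ?S = "{..<Suc (Suc n)}"
    \<comment> \<open>a decreasing subsequence of letters up to \<open>n + 1\<close>, so that \<open>F\<close> has at least as many of them\<close>
    let ?s = "col ((A0 - {1}) \<inter> ?S) @ [2]"
    have "x \<in> A0 - {1} \<Longrightarrow> 2 < x" for x
      using 2 minus_one_subset[OF AB(1)] by (metis DiffD1 atLeastAtMost_iff le_neq_implies_less subsetD)
    then have "sorted_wrt (>) ?s" using fin by (auto simp: sorted_wrt_append col_decreasing)
    moreover have "subseq [2] (col (B0 - {1}))" using B02 fin by (simp add: subseq_singleton_left)
    then have "subseq ?s (col (A0 - {1}) @ col (B0 - {1}))"
      using subseq_col[OF fin(1)] by (intro list_emb_append_mono) auto
    moreover have "set ?s \<subseteq> ?S" using n fin by auto
    ultimately have "chain (>) ?S (col (A0 - {1}) @ col (B0 - {1})) (Suc (card ((A0 - {1}) \<inter> ?S)))"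
      unfolding chain_def by (intro exI[of _ ?s]) simp
    then have "chain (>) ?S (col F @ col E) (Suc (card ((A0 - {1}) \<inter> ?S)))"
      using knuth_decreasing_chains[OF F(6), of ?S] by (metis lessThan_iff le_less_trans)
    from chain_lessThan_le[OF F(1-3) this]
    have "Suc (card ((A0 - {1}) \<inter> ?S)) \<le> card (F \<inter> ?S)" .
    moreover have "card (F \<inter> ?S) = card (E \<inter> ?S)"
      using half card_shift_down_lessThan[OF p(2), of "Suc n" n] card_shift_down_lessThan[OF p(3), of "Suc n" n] n
      by (simp add: low)
    moreover have "card ((A0 - {1}) \<inter> ?S) + card ((B0 - {1}) \<inter> ?S) = card (F \<inter> ?S) + card (E \<inter> ?S)"
      by (rule count)
    moreover have "B0 - {1} = B0" using B01 by simp
    moreover have "card (B0 \<inter> ?S) \<le> card (A0 \<inter> ?S)" using AB(3) by (simp add: row_dom_def)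
    moreover have "card (A0 \<inter> ?S) = Suc (card ((A0 - {1}) \<inter> ?S))"
    proof -
      have "A0 \<inter> ?S = insert 1 ((A0 - {1}) \<inter> ?S)" using A01 by auto
      then show ?thesis by simp
    qed
    ultimately show False by simp
  qed
  then show ?thesis using that[OF AB psi A01 _ B01] two by simp
qed

section \<open>A combinatorial model\<close>

text \<open>
  Possible occurrences of the letters \<open>k\<close> and \<open>2n + 1 - k\<close> in the two columns; which letters belong to
  which state is fixed by \<open>left_col\<close> and \<open>right_col\<close>.
\<close>

datatype state = Off | Pos | Neg | Open | Close

fun bal :: "state \<Rightarrow> int" where
  "bal Open = 1" | "bal Close = -1" | "bal _ = 0"

fun sign :: "state \<Rightarrow> int" where
  "sign Pos = 1" | "sign Neg = -1" | "sign _ = 0"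

definition depth :: "(nat \<Rightarrow> state) \<Rightarrow> nat \<Rightarrow> int" where
  "depth s k = (\<Sum>j=1..k. bal (s j))"

text \<open>
  Words of length \<open>n\<close> with \<open>r\<close> states different from \<open>Off\<close>, extended by \<open>Off\<close>. The conditions on the
  depth say that the brackets are balanced and that no \<open>Off\<close> lies inside a bracket.
\<close>

definition model :: "nat \<Rightarrow> nat \<Rightarrow> (nat \<Rightarrow> state) set" where
  "model n r = {s. (\<forall>k. k \<notin> {1..n} \<longrightarrow> s k = Off) \<and> (\<forall>k\<le>n. 0 \<le> depth s k) \<and> depth s n = 0 \<and>
     (\<forall>k\<in>{1..n}. s k = Off \<longrightarrow> depth s k = 0) \<and> (\<Sum>k=1..n. of_bool (s k \<noteq> Off)) = int r}"

text \<open>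
  The action of \<open>f\<^sub>i\<close> on the states at \<open>i\<close> and \<open>i + 1\<close>, found from the signatures at \<open>i\<close> and \<open>2n - i\<close>. The
  pair \<open>Pos Neg\<close> starts the only strings of length two, and passes through a bracket \<open>Open Close\<close>.
\<close>

fun step_down :: "state \<Rightarrow> state \<Rightarrow> (state \<times> state) option" where
  "step_down Pos Off = Some (Off, Pos)"
| "step_down Off Neg = Some (Neg, Off)"
| "step_down Pos Neg = Some (Open, Close)"
| "step_down Open Close = Some (Neg, Pos)"
| "step_down Pos Open = Some (Open, Pos)"
| "step_down Pos Close = Some (Close, Pos)"
| "step_down Open Neg = Some (Neg, Open)"
| "step_down Close Neg = Some (Neg, Close)"
| "step_down _ _ = None"

fun step_up :: "state \<Rightarrow> state \<Rightarrow> (state \<times> state) option" where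
  "step_up Off Pos = Some (Pos, Off)"
| "step_up Neg Off = Some (Off, Neg)"
| "step_up Open Close = Some (Pos, Neg)"
| "step_up Neg Pos = Some (Open, Close)"
| "step_up Open Pos = Some (Pos, Open)"
| "step_up Close Pos = Some (Pos, Close)"
| "step_up Neg Open = Some (Open, Neg)"
| "step_up Neg Close = Some (Close, Neg)"
| "step_up _ _ = None"

definition downs :: "state \<Rightarrow> state \<Rightarrow> nat" where
  "downs a b = (if step_down a b = None then 0 else if a = Pos \<and> b = Neg then 2 else 1)"

definition ups :: "state \<Rightarrow> state \<Rightarrow> nat" where
  "ups a b = (if step_up a b = None then 0 else if a = Neg \<and> b = Pos then 2 else 1)"

definition lower_op :: "nat \<Rightarrow> nat \<Rightarrow> (nat \<Rightarrow> state) \<Rightarrow> (nat \<Rightarrow> state) option" where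
  "lower_op n i s =
     (if i = 0 then (if s 1 = Neg then Some (s(1 := Pos)) else None)
      else if i = n then (if s n = Pos then Some (s(n := Neg)) else None)
      else map_option (\<lambda>(a, b). s(i := a, Suc i := b)) (step_down (s i) (s (Suc i))))"

definition raise_op :: "nat \<Rightarrow> nat \<Rightarrow> (nat \<Rightarrow> state) \<Rightarrow> (nat \<Rightarrow> state) option" where
  "raise_op n i s =
     (if i = 0 then (if s 1 = Pos then Some (s(1 := Neg)) else None)
      else if i = n then (if s n = Neg then Some (s(n := Pos)) else None)
      else map_option (\<lambda>(a, b). s(i := a, Suc i := b)) (step_up (s i) (s (Suc i))))"

definition lower_count :: "nat \<Rightarrow> nat \<Rightarrow> (nat \<Rightarrow> state) \<Rightarrow> nat" where
  "lower_count n i s = (if i = 0 then of_bool (s 1 = Neg) else if i = n then of_bool (s n = Pos)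
     else downs (s i) (s (Suc i)))"

definition raise_count :: "nat \<Rightarrow> nat \<Rightarrow> (nat \<Rightarrow> state) \<Rightarrow> nat" where
  "raise_count n i s = (if i = 0 then of_bool (s 1 = Pos) else if i = n then of_bool (s n = Neg)
     else ups (s i) (s (Suc i)))"

definition model_weight :: "nat \<Rightarrow> (nat \<Rightarrow> state) \<Rightarrow> nat \<Rightarrow> int" where
  "model_weight n s i = (if i = 0 then 0 else if i < n then sign (s i) - sign (s (Suc i))
     else if i = n then sign (s n) else 0)"

definition top_word :: "nat \<Rightarrow> nat \<Rightarrow> state" where
  "top_word r k = (if 1 \<le> k \<and> k \<le> r then Pos else Off)"

lemma step_inverse: "step_down a b = Some (c, d) \<longleftrightarrow> step_up c d = Some (a, b)"
  by (cases a; cases b; cases c; cases d) simp_all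

lemma step_down_cases:
  assumes "step_down a b = Some (c, d)"
  shows "bal c + bal d = bal a + bal b"
    and "of_bool (c \<noteq> Off) + of_bool (d \<noteq> Off) = (of_bool (a \<noteq> Off) + of_bool (b \<noteq> Off) :: int)"
    and "downs a b = Suc (downs c d)" and "ups c d = Suc (ups a b)"
  using assms by (cases a; cases b; auto simp: downs_def ups_def)+

lemma modelD:
  assumes "s \<in> model n r"
  shows "k \<le> n \<Longrightarrow> 0 \<le> depth s k" and "depth s n = 0"
    and "1 \<le> k \<Longrightarrow> k \<le> n \<Longrightarrow> s k = Off \<Longrightarrow> depth s k = 0"
    and "k \<notin> {1..n} \<Longrightarrow> s k = Off"
    and "(\<Sum>k=1..n. of_bool (s k \<noteq> Off)) = int r"
  using assms by (auto simp: model_def)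

lemma depth_Suc: "depth s (Suc k) = depth s k + bal (s (Suc k))"
  by (simp add: depth_def)

lemma depth_0 [simp]: "depth s 0 = 0"
  by (simp add: depth_def)

lemma sum_update:
  fixes g :: "nat \<Rightarrow> 'b \<Rightarrow> int"
  shows "(\<Sum>k=1..m. g k ((s(i := a)) k)) =
     (\<Sum>k=1..m. g k (s k)) + (if 1 \<le> i \<and> i \<le> m then g i a - g i (s i) else 0)"
  by (induction m) auto

lemma depth_update:
  "depth (s(i := a)) k = depth s k + (if 1 \<le> i \<and> i \<le> k then bal a - bal (s i) else 0)"
  unfolding depth_def using sum_update[of "\<lambda>_. bal"] .

lemma model_update:
  assumes "s \<in> model n r" "1 \<le> i" "i \<le> n" "bal a = bal (s i)" "a \<noteq> Off" "s i \<noteq> Off"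
  shows "s(i := a) \<in> model n r"
  using modelD[OF assms(1)] assms(2-6) sum_update[of "\<lambda>_ x. of_bool (x \<noteq> Off)" s i a n]
  unfolding model_def by (auto simp: depth_update)

text \<open>
  The neighbours on which the signatures at \<open>i\<close> and \<open>2n - i\<close> would disagree, and the end states for which
  those at \<open>0\<close> and \<open>n\<close> would be odd.
\<close>

lemma excluded:
  assumes "s \<in> model n r" "1 \<le> i" "i < n"
  shows "\<not> (s i = Off \<and> s (Suc i) = Close)" and "\<not> (s i = Open \<and> s (Suc i) = Off)"
    and "s 1 \<noteq> Close" and "s n \<noteq> Open"
proof -
  note d = modelD[OF assms(1)]
  show "\<not> (s i = Off \<and> s (Suc i) = Close)"
    using d(3)[of i] d(1)[of "Suc i"] assms(2,3) by (auto simp: depth_Suc)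
  have i: "depth s i = depth s (i - 1) + bal (s i)"
    using depth_Suc[of s "i - 1"] assms(2) by simp
  show "\<not> (s i = Open \<and> s (Suc i) = Off)"
    using d(3)[of "Suc i"] d(1)[OF less_imp_le_nat[OF less_imp_diff_less[OF assms(3)]], of 1] assms(2,3) i
    by (auto simp: depth_Suc)
  show "s 1 \<noteq> Close"
    using d(1)[of 1] depth_Suc[of s 0] assms(2,3) by auto
  have "depth s n = depth s (n - 1) + bal (s n)"
    using depth_Suc[of s "n - 1"] assms(2,3) by simp
  then show "s n \<noteq> Open" using d(1)[of "n - 1"] d(2) by auto
qed

text \<open>
  An exchange of two adjacent states that preserves their total balance changes the depth only
  between them.
\<close>

lemma model_update_pair:
  assumes s: "s \<in> model n r" and i: "1 \<le> i" "i < n"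
    and bal: "bal a + bal b = bal (s i) + bal (s (Suc i))"
    and off: "of_bool (a \<noteq> Off) + of_bool (b \<noteq> Off) = (of_bool (s i \<noteq> Off) + of_bool (s (Suc i) \<noteq> Off) :: int)"
    and mid: "0 \<le> depth s (i - 1) + bal a"
    and offa: "a = Off \<Longrightarrow> depth s (i - 1) = 0"
    and offb: "b = Off \<Longrightarrow> depth s (Suc i) = 0"
  shows "s(i := a, Suc i := b) \<in> model n r"
proof -
  let ?s = "s(i := a, Suc i := b)"
  note d = modelD[OF s]
  have pred: "depth s i = depth s (i - 1) + bal (s i)"
    using depth_Suc[of s "i - 1"] i by simp
  have dep: "depth ?s k = (if k = i then depth s (i - 1) + bal a else depth s k)" for k
    using i bal pred by (auto simp: depth_update)
  have "(\<Sum>k=1..n. of_bool (?s k \<noteq> Off)) = int r"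
    using sum_update[of "\<lambda>_ x. of_bool (x \<noteq> Off)" "s(i := a)" "Suc i" b n]
      sum_update[of "\<lambda>_ x. of_bool (x \<noteq> Off)" s i a n] off d(5) i
    by simp
  moreover have "?s k = Off" if "k \<notin> {1..n}" for k using that d(4) i by auto
  moreover have "0 \<le> depth ?s k" if "k \<le> n" for k using that d(1) dep mid by auto
  moreover have "depth ?s n = 0" using d(2) dep i by auto
  moreover have "depth ?s k = 0" if k: "k \<in> {1..n}" "?s k = Off" for k
  proof -
    consider "k = i" | "k = Suc i" | "k \<noteq> i" "k \<noteq> Suc i" by blast
    then show ?thesis
      using k d(3)[of k] offa offb dep[of k] i by cases (auto split: if_splits)
  qed
  ultimately show ?thesis unfolding model_def by blast
qed

lemma step_down_model:
  assumes s: "s \<in> model n r" and i: "1 \<le> i" "i < n" and st: "step_down (s i) (s (Suc i)) = Some (a, b)"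
  shows "s(i := a, Suc i := b) \<in> model n r"
proof -
  note d = modelD[OF s]
  have pred: "depth s i = depth s (i - 1) + bal (s i)"
    using depth_Suc[of s "i - 1"] i by simp
  have g: "0 \<le> depth s (i - 1)" "0 \<le> depth s i" "0 \<le> depth s (Suc i)"
    "s i = Off \<Longrightarrow> depth s i = 0" "s (Suc i) = Off \<Longrightarrow> depth s (Suc i) = 0"
    using d(1)[of "i - 1"] d(1)[of i] d(1)[of "Suc i"] d(3)[of i] d(3)[of "Suc i"] i by auto
  have "0 \<le> depth s (i - 1) + bal a \<and> (a = Off \<longrightarrow> depth s (i - 1) = 0) \<and> (b = Off \<longrightarrow> depth s (Suc i) = 0)"
    using st g pred depth_Suc[of s i]
    by (cases "s i"; cases "s (Suc i)") auto
  then show ?thesis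
    using model_update_pair[OF s i step_down_cases(1,2)[OF st]] by simp
qed

lemma step_up_model:
  assumes s: "s \<in> model n r" and i: "1 \<le> i" "i < n" and st: "step_up (s i) (s (Suc i)) = Some (a, b)"
  shows "s(i := a, Suc i := b) \<in> model n r"
proof -
  note d = modelD[OF s]
  have st': "step_down a b = Some (s i, s (Suc i))" using st step_inverse by blast
  have pred: "depth s i = depth s (i - 1) + bal (s i)"
    using depth_Suc[of s "i - 1"] i by simp
  have g: "0 \<le> depth s (i - 1)" "0 \<le> depth s i" "0 \<le> depth s (Suc i)"
    "s i = Off \<Longrightarrow> depth s i = 0" "s (Suc i) = Off \<Longrightarrow> depth s (Suc i) = 0"
    using d(1)[of "i - 1"] d(1)[of i] d(1)[of "Suc i"] d(3)[of i] d(3)[of "Suc i"] i by auto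
  have "0 \<le> depth s (i - 1) + bal a \<and> (a = Off \<longrightarrow> depth s (i - 1) = 0) \<and> (b = Off \<longrightarrow> depth s (Suc i) = 0)"
    using st g pred depth_Suc[of s i]
    by (cases "s i"; cases "s (Suc i)") auto
  then show ?thesis
    using model_update_pair[OF s i step_down_cases(1,2)[OF st', symmetric]] by simp
qed

lemma op_model:
  assumes "s \<in> model n r" "2 \<le> n" "i \<le> n"
  shows "lower_op n i s = Some s' \<Longrightarrow> s' \<in> model n r"
    and "raise_op n i s = Some s' \<Longrightarrow> s' \<in> model n r"
  using assms model_update[OF assms(1), of 1] model_update[OF assms(1), of n]
    step_down_model[OF assms(1), of i] step_up_model[OF assms(1), of i]
  by (auto simp: lower_op_def raise_op_def split: if_splits)

lemma op_inverse:
  assumes "2 \<le> n" "i \<le> n"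
  shows "lower_op n i s = Some s' \<longleftrightarrow> raise_op n i s' = Some s"
proof (cases "i = 0 \<or> i = n")
  case True
  then show ?thesis using assms by (auto simp: lower_op_def raise_op_def fun_upd_idem_iff)
next
  case False
  then have l: "lower_op n i s = map_option (\<lambda>(a, b). s(i := a, Suc i := b)) (step_down (s i) (s (Suc i)))"
    and u: "raise_op n i s' = map_option (\<lambda>(a, b). s'(i := a, Suc i := b)) (step_up (s' i) (s' (Suc i)))"
    by (auto simp: lower_op_def raise_op_def)
  show ?thesis
  proof
    assume "lower_op n i s = Some s'"
    then obtain a b where ab: "step_down (s i) (s (Suc i)) = Some (a, b)" "s' = s(i := a, Suc i := b)"
      unfolding l by auto
    then have "step_up (s' i) (s' (Suc i)) = Some (s i, s (Suc i))" using step_inverse by simp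
    then show "raise_op n i s' = Some s" unfolding u using ab(2) by (auto simp: fun_upd_twist)
  next
    assume "raise_op n i s' = Some s"
    then obtain a b where ab: "step_up (s' i) (s' (Suc i)) = Some (a, b)" "s = s'(i := a, Suc i := b)"
      unfolding u by auto
    then have "step_down (s i) (s (Suc i)) = Some (s' i, s' (Suc i))" using step_inverse by simp
    then show "lower_op n i s = Some s'" unfolding l using ab(2) by (auto simp: fun_upd_twist)
  qed
qed

lemma op_counts:
  assumes "2 \<le> n" "i \<le> n" "lower_op n i s = Some s'"
  shows "lower_count n i s = Suc (lower_count n i s')" "raise_count n i s' = Suc (raise_count n i s)"
  using assms step_down_cases(3,4)[of "s i" "s (Suc i)"]
  by (auto simp: lower_op_def lower_count_def raise_count_def split: if_splits)

lemma op_None: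
  "lower_op n i s = None \<Longrightarrow> lower_count n i s = 0" "raise_op n i s = None \<Longrightarrow> raise_count n i s = 0"
  by (auto simp: lower_op_def raise_op_def lower_count_def raise_count_def downs_def ups_def split: if_splits)

lemma model_strings:
  assumes "2 \<le> n" "i \<le> n"
  shows "string_fun (model n r) (lower_op n i) (lower_count n i)"
    and "string_fun (model n r) (raise_op n i) (raise_count n i)"
proof -
  show "string_fun (model n r) (lower_op n i) (lower_count n i)"
    by (rule string_funI) (simp_all add: op_None(1) op_model(1)[OF _ assms] op_counts(1)[OF assms])
  have "raise_count n i s = Suc (raise_count n i s')" if "raise_op n i s = Some s'" for s s'
    using op_counts(2)[OF assms, of s' s] op_inverse[OF assms, of s' s] that by simp
  then show "string_fun (model n r) (raise_op n i) (raise_count n i)"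
    by (intro string_funI) (simp_all add: op_None(2) op_model(2)[OF _ assms])
qed

lemma model_weight_eq:
  assumes "2 \<le> n" "1 \<le> i" "i \<le> n"
  shows "model_weight n s i = int (lower_count n i s) - int (raise_count n i s)"
proof (cases "i = n")
  case True then show ?thesis
    using assms by (cases "s n") (auto simp: model_weight_def lower_count_def raise_count_def)
next
  case False then show ?thesis
    using assms by (cases "s i"; cases "s (Suc i)")
      (auto simp: model_weight_def lower_count_def raise_count_def downs_def ups_def)
qed

lemma sum_model_weight:
  assumes "1 \<le> n" shows "(\<Sum>i=1..n. model_weight n s i) = sign (s 1)"
proof -
  have "(\<Sum>i=1..<n. model_weight n s i) = (\<Sum>i=1..<n. sign (s i) - sign (s (Suc i)))"
    by (rule sum.cong) (auto simp: model_weight_def)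
  also have "\<dots> = sign (s 1) - sign (s n)"
    using assms sum_Suc_diff'[of 1 n "\<lambda>i. sign (s i)"] by (simp add: sum_subtractf)
  finally show ?thesis
    using assms by (simp add: sum.last_plus model_weight_def)
qed

lemma lower_weight:
  assumes "2 \<le> n" "i \<le> n" "j \<le> n" "1 \<le> j" "lower_op n i s = Some s'"
  shows "model_weight n s' j = model_weight n s j - cartan n j i"
    and "sign (s' 1) = sign (s 1) + cartan n 0 i"
proof -
  have *: "sign a - sign c = 1 \<and> sign d - sign b = 1" if "step_down a b = Some (c, d)" for a b c d
    using that by (cases a; cases b) auto
  consider "i = 0" | "i = n" | "0 < i" "i < n" using assms(2) by linarith
  then show "model_weight n s' j = model_weight n s j - cartan n j i"
    "sign (s' 1) = sign (s 1) + cartan n 0 i"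
    using assms * [of "s i" "s (Suc i)"]
    by (cases; auto simp: lower_op_def model_weight_def cartan_def split: if_splits)+
qed

section \<open>Connectedness\<close>

text \<open>
  The sum of all letters in the two columns; the operators \<open>e\<^sub>i\<close> with \<open>i \<ge> 1\<close> lower it, so that repeated
  raising terminates.
\<close>

definition energy :: "nat \<Rightarrow> (nat \<Rightarrow> state) \<Rightarrow> int" where
  "energy n s = (\<Sum>k=1..n. (case s k of Pos \<Rightarrow> 2 * int k | Neg \<Rightarrow> 2 * (2 * int n + 1 - int k) | _ \<Rightarrow> 2 * int n + 1))"

lemma energy_nonneg: "0 \<le> energy n s"
  unfolding energy_def by (rule sum_nonneg) (auto split: state.split)

lemma energy_raise:
  assumes "2 \<le> n" "1 \<le> i" "i \<le> n" "raise_op n i s = Some s'"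
  shows "energy n s' < energy n s"
proof -
  let ?g = "\<lambda>k x. case x of Pos \<Rightarrow> 2 * int k | Neg \<Rightarrow> 2 * (2 * int n + 1 - int k) | _ \<Rightarrow> 2 * int n + 1"
  have e: "energy n (s(k := a)) = energy n s + (if 1 \<le> k \<and> k \<le> n then ?g k a - ?g k (s k) else 0)" for s k a
    unfolding energy_def by (rule sum_update)
  show ?thesis
  proof (cases "i = n")
    case True
    then show ?thesis using assms by (auto simp: raise_op_def e split: if_splits)
  next
    case False
    then obtain a b where ab: "step_up (s i) (s (Suc i)) = Some (a, b)" "s' = s(i := a, Suc i := b)"
      using assms by (auto simp: raise_op_def)
    show ?thesis using ab assms False
      by (cases "s i"; cases "s (Suc i)") (auto simp: e)
  qed
qed

lemma initial_segment:
  assumes "D \<subseteq> {1..n::nat}" "\<And>k. k \<in> D \<Longrightarrow> 1 < k \<Longrightarrow> k - 1 \<in> D" shows "D = {1..card D}"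
proof (cases "D = {}")
  case False
  have fin: "finite D" using assms(1) finite_subset by blast
  define m where "m = Max D"
  have m: "m \<in> D" unfolding m_def using False fin by simp
  have "m - d \<in> D" if "d < m" for d
    using that
  proof (induction d)
    case (Suc d)
    then show ?case using assms(2)[of "m - d"] by simp
  qed (simp add: m)
  then have "{1..m} \<subseteq> D"
  proof -
    assume *: "\<And>d. d < m \<Longrightarrow> m - d \<in> D"
    show ?thesis
    proof
      fix k assume "k \<in> {1..m}"
      then show "k \<in> D" using *[of "m - k"] by simp
    qed
  qed
  moreover have "D \<subseteq> {1..m}" using assms(1) fin by (auto simp: m_def)
  ultimately have "D = {1..m}" by blast
  then show ?thesis by simp
qed simp

text \<open>
  Consider the last position in state \<open>Neg\<close> or \<open>Open\<close>. Every state that may follow there gives a pair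
  on which \<open>e\<^sub>i\<close> is defined, and at the end of the word \<open>e\<^sub>n\<close> is defined; so there is no such
  position. Then there are no brackets, and \<open>Off Pos\<close> is excluded by \<open>e\<^sub>i\<close>, so all \<open>Pos\<close> come first.
\<close>

lemma highest_weight_unique:
  assumes s: "s \<in> model n r" and n: "2 \<le> n" and hw: "\<And>i. 1 \<le> i \<Longrightarrow> i \<le> n \<Longrightarrow> raise_op n i s = None"
  shows "s = top_word r"
proof -
  note d = modelD[OF s]
  have up: "step_up (s i) (s (Suc i)) = None" if "1 \<le> i" "i < n" for i
    using hw[of i] that by (auto simp: raise_op_def)
  have sn: "s n \<noteq> Neg" using hw[of n] n by (auto simp: raise_op_def)
  have no1: "s k \<noteq> Neg \<and> s k \<noteq> Open" for k
  proof (rule ccontr)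
    assume k: "\<not> (s k \<noteq> Neg \<and> s k \<noteq> Open)"
    \<comment> \<open>the last position of a state \<open>Neg\<close> or \<open>Open\<close>\<close>
    define K where "K = {k\<in>{1..n}. s k = Neg \<or> s k = Open}"
    have "k \<in> {1..n}"
    proof (rule ccontr)
      assume "k \<notin> {1..n}"
      then have "s k = Off" by (rule d(4))
      then show False using k by simp
    qed
    then have "k \<in> K" using k by (auto simp: K_def)
    moreover have fin: "finite K" by (simp add: K_def)
    ultimately have KM: "Max K \<in> K" "finite K" using Max_in by blast+
    define m where "m = Max K"
    have m: "1 \<le> m" "m \<le> n" "s m = Neg \<or> s m = Open" using KM by (auto simp: m_def K_def)
    have "m \<noteq> n" using m sn excluded(4)[OF s, of 1] n by auto
    then have mn: "m < n" using m by simp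
    have "Suc m \<notin> K" using Max_ge[OF KM(2), of "Suc m"] by (fastforce simp: m_def)
    then have "s (Suc m) \<noteq> Neg" "s (Suc m) \<noteq> Open" using mn by (auto simp: K_def)
    then show False using m up[OF m(1) mn] excluded(2)[OF s m(1) mn]
      by (cases "s (Suc m)") auto
  qed
  have nonpos: "0 \<le> - bal (s k)" for k using no1[of k] by (cases "s k") auto
  have "(\<Sum>k=1..n. - bal (s k)) = 0" using d(2) by (simp add: depth_def sum_negf)
  then have "\<forall>k\<in>{1..n}. - bal (s k) = 0" using nonpos by (subst (asm) sum_nonneg_eq_0_iff) auto
  then have no2: "s k = Pos \<or> s k = Off" for k
  proof (cases "k \<in> {1..n}")
    case True
    then have "- bal (s k) = 0" using \<open>\<forall>k\<in>{1..n}. - bal (s k) = 0\<close> by blast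
    then show ?thesis using no1[of k] by (cases "s k") auto
  qed (use d(4) in blast)
  define D where "D = {k\<in>{1..n}. s k = Pos}"
  have "k - 1 \<in> D" if "k \<in> D" "1 < k" for k
  proof -
    have k: "1 \<le> k - 1" "k - 1 < n" "Suc (k - 1) = k" "s k = Pos" using that by (auto simp: D_def)
    then show ?thesis using up[OF k(1,2)] no2[of "k - 1"] by (auto simp: D_def)
  qed
  then have D: "D = {1..card D}" by (intro initial_segment[of D n]) (auto simp: D_def)
  have "int (card D) = (\<Sum>k=1..n. of_bool (s k \<noteq> Off))"
  proof -
    have "(\<Sum>k=1..n. of_bool (s k \<noteq> Off)) = (\<Sum>k=1..n. if s k = Pos then 1 else (0::int))"
    proof (rule sum.cong)
      show "of_bool (s k \<noteq> Off) = (if s k = Pos then 1 else (0::int))" for k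
        using no2[of k] by auto
    qed simp
    then show ?thesis by (simp add: D_def sum.If_cases Int_def)
  qed
  then have "card D = r" using d(5) by simp
  then have "D = {1..r}" using D by simp
  show ?thesis
  proof
    fix k
    show "s k = top_word r k"
    proof (cases "k \<in> D")
      case True
      then have "s k = Pos" by (simp add: D_def)
      then show ?thesis using True unfolding \<open>D = {1..r}\<close> by (simp add: top_word_def)
    next
      case False
      then have "s k = Off" using no2[of k] d(4) unfolding D_def by blast
      then show ?thesis using False unfolding \<open>D = {1..r}\<close> by (simp add: top_word_def)
    qed
  qed
qed

text \<open>
  Connectedness of the model under the classical lowering operators.
\<close>

lemma model_induct [consumes 2, case_names top step]:
  assumes "s \<in> model n r" "2 \<le> n" and "P (top_word r)"
    and "\<And>s s' i. s \<in> model n r \<Longrightarrow> P s \<Longrightarrow> 1 \<le> i \<Longrightarrow> i \<le> n \<Longrightarrow> lower_op n i s = Some s' \<Longrightarrow> P s'"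
  shows "P s"
  using assms(1)
proof (induction "nat (energy n s)" arbitrary: s rule: less_induct)
  case less
  show ?case
  proof (cases "\<exists>i s'. 1 \<le> i \<and> i \<le> n \<and> raise_op n i s = Some s'")
    case True
    then obtain i s' where i: "1 \<le> i" "i \<le> n" "raise_op n i s = Some s'" by blast
    have s': "s' \<in> model n r" using op_model(2)[OF less.prems assms(2) i(2,3)] .
    have "energy n s' < energy n s" using energy_raise[OF assms(2) i] .
    then have "nat (energy n s') < nat (energy n s)" using energy_nonneg[of n s'] by simp
    then have "P s'" using less.hyps s' by blast
    then show ?thesis using assms(4)[OF s' _ i(1,2)] op_inverse[OF assms(2) i(2)] i(3) by blast
  next
    case False
    then have "s = top_word r" using highest_weight_unique[OF less.prems assms(2)] by fastforce
    then show ?thesis using assms(3) by simp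
  qed
qed

lemma top_word_model:
  assumes "r \<le> n" shows "top_word r \<in> model n r"
proof -
  have "depth (top_word r) k = 0" for k
    unfolding depth_def by (rule sum.neutral) (simp add: top_word_def)
  moreover have "(\<Sum>k=1..n. of_bool (top_word r k \<noteq> Off)) = int r"
  proof -
    have "(\<Sum>k=1..n. of_bool (top_word r k \<noteq> Off)) = (\<Sum>k=1..n. if k \<le> r then 1 else (0::int))"
      by (rule sum.cong) (auto simp: top_word_def)
    also have "\<dots> = int (card ({1..n} \<inter> {k. k \<le> r}))" by (simp add: sum.If_cases)
    also have "{1..n} \<inter> {k. k \<le> r} = {1..r}" using assms by auto
    finally show ?thesis by simp
  qed
  moreover have "top_word r k = Off" if "k \<notin> {1..n}" for k
    using that assms by (auto simp: top_word_def)
  ultimately show ?thesis unfolding model_def by simp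
qed

section \<open>The columns of a word\<close>

text \<open>
  The left column has the height \<open>2n - r\<close>: its complement, reversed by \<open>k \<mapsto> 2n + 1 - k\<close>, is the left
  half of the split column, and \<open>right_col\<close> is the right half.
\<close>

definition left_col :: "nat \<Rightarrow> (nat \<Rightarrow> state) \<Rightarrow> nat set" where
  "left_col n s = {k\<in>{1..n}. s k \<in> {Off, Pos, Open}} \<union> (\<lambda>k. 2*n + 1 - k) ` {k\<in>{1..n}. s k \<in> {Off, Neg, Close}}"

definition right_col :: "nat \<Rightarrow> (nat \<Rightarrow> state) \<Rightarrow> nat set" where
  "right_col n s = {k\<in>{1..n}. s k \<in> {Pos, Close}} \<union> (\<lambda>k. 2*n + 1 - k) ` {k\<in>{1..n}. s k \<in> {Neg, Open}}"

definition cols :: "nat \<Rightarrow> (nat \<Rightarrow> state) \<Rightarrow> nat set \<times> nat set" where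
  "cols n s = (left_col n s, right_col n s)"

lemma mem_left_col:
  assumes "1 \<le> k" "k \<le> n"
  shows "k \<in> left_col n s \<longleftrightarrow> s k \<in> {Off, Pos, Open}"
    and "2*n + 1 - k \<in> left_col n s \<longleftrightarrow> s k \<in> {Off, Neg, Close}"
proof -
  have "2*n + 1 - k = 2*n + 1 - j \<longleftrightarrow> j = k" "k \<noteq> 2*n + 1 - j" "2*n + 1 - k \<noteq> j" if "j \<le> n" for j
    using that assms by auto
  then show "k \<in> left_col n s \<longleftrightarrow> s k \<in> {Off, Pos, Open}"
    "2*n + 1 - k \<in> left_col n s \<longleftrightarrow> s k \<in> {Off, Neg, Close}"
    using assms unfolding left_col_def by auto
qed

lemma mem_right_col:
  assumes "1 \<le> k" "k \<le> n"
  shows "k \<in> right_col n s \<longleftrightarrow> s k \<in> {Pos, Close}"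
    and "2*n + 1 - k \<in> right_col n s \<longleftrightarrow> s k \<in> {Neg, Open}"
proof -
  have "2*n + 1 - k = 2*n + 1 - j \<longleftrightarrow> j = k" "k \<noteq> 2*n + 1 - j" "2*n + 1 - k \<noteq> j" if "j \<le> n" for j
    using that assms by auto
  then show "k \<in> right_col n s \<longleftrightarrow> s k \<in> {Pos, Close}"
    "2*n + 1 - k \<in> right_col n s \<longleftrightarrow> s k \<in> {Neg, Open}"
    using assms unfolding right_col_def by auto
qed

lemma cols_range: "left_col n s \<subseteq> {1..2*n}" "right_col n s \<subseteq> {1..2*n}"
  unfolding left_col_def right_col_def by auto

lemma letter_cases:
  fixes x n :: nat
  assumes "x \<in> {1..2*n}" obtains k where "1 \<le> k" "k \<le> n" "x = k \<or> x = 2*n + 1 - k"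
proof (cases "x \<le> n")
  case True with assms that[of x] show ?thesis by simp
next
  case False with assms that[of "2*n + 1 - x"] show ?thesis by simp
qed

lemma letter_set_eqI:
  fixes n :: nat
  assumes "S \<subseteq> {1..2*n}" "T \<subseteq> {1..2*n}"
    and "\<And>k. 1 \<le> k \<Longrightarrow> k \<le> n \<Longrightarrow> k \<in> S \<longleftrightarrow> k \<in> T"
    and "\<And>k. 1 \<le> k \<Longrightarrow> k \<le> n \<Longrightarrow> 2*n + 1 - k \<in> S \<longleftrightarrow> 2*n + 1 - k \<in> T"
  shows "S = T"
proof -
  have "x \<in> S \<longleftrightarrow> x \<in> T" if "x \<in> {1..2*n}" for x
    using letter_cases[OF that] assms(3,4) by metis
  then show ?thesis using assms(1,2) by blast
qed

lemma left_col_update: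
  assumes "1 \<le> i" "i \<le> n"
  shows "left_col n (s(i := a)) = left_col n s - {i, 2*n + 1 - i} \<union>
    ((if a \<in> {Off, Pos, Open} then {i} else {}) \<union> (if a \<in> {Off, Neg, Close} then {2*n + 1 - i} else {}))"
    (is "_ = ?S")
proof (rule letter_set_eqI)
  show "left_col n (s(i := a)) \<subseteq> {1..2*n}" by (rule cols_range)
  show "?S \<subseteq> {1..2*n}" using cols_range(1)[of n s] assms by auto
  fix k assume k: "1 \<le> k" "k \<le> n"
  have "2*n + 1 - k = 2*n + 1 - i \<longleftrightarrow> k = i" "k \<noteq> 2*n + 1 - i" "2*n + 1 - k \<noteq> i"
    using assms k by auto
  then show "k \<in> left_col n (s(i := a)) \<longleftrightarrow> k \<in> ?S"
    "2*n + 1 - k \<in> left_col n (s(i := a)) \<longleftrightarrow> 2*n + 1 - k \<in> ?S"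
    unfolding mem_left_col[OF k] Un_iff Diff_iff by (cases "k = i"; simp)+
qed

lemma right_col_update:
  assumes "1 \<le> i" "i \<le> n"
  shows "right_col n (s(i := a)) = right_col n s - {i, 2*n + 1 - i} \<union>
    ((if a \<in> {Pos, Close} then {i} else {}) \<union> (if a \<in> {Neg, Open} then {2*n + 1 - i} else {}))"
    (is "_ = ?S")
proof (rule letter_set_eqI)
  show "right_col n (s(i := a)) \<subseteq> {1..2*n}" by (rule cols_range)
  show "?S \<subseteq> {1..2*n}" using cols_range(2)[of n s] assms by auto
  fix k assume k: "1 \<le> k" "k \<le> n"
  have "2*n + 1 - k = 2*n + 1 - i \<longleftrightarrow> k = i" "k \<noteq> 2*n + 1 - i" "2*n + 1 - k \<noteq> i"
    using assms k by auto
  then show "k \<in> right_col n (s(i := a)) \<longleftrightarrow> k \<in> ?S"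
    "2*n + 1 - k \<in> right_col n (s(i := a)) \<longleftrightarrow> 2*n + 1 - k \<in> ?S"
    unfolding mem_right_col[OF k] Un_iff Diff_iff by (cases "k = i"; simp)+
qed

definition pair_down :: "nat \<Rightarrow> nat \<Rightarrow> nat set \<times> nat set \<Rightarrow> (nat set \<times> nat set) option" where
  "pair_down n i = move_pair (source n i) (Suc i)"

definition pair_up :: "nat \<Rightarrow> nat \<Rightarrow> nat set \<times> nat set \<Rightarrow> (nat set \<times> nat set) option" where
  "pair_up n i = unmove_pair (source n i) (Suc i)"

lemma move_pair_simps:
  assumes "p \<noteq> q"
  shows "move_pair p q (A, B) =
     (if (q \<in> A \<and> p \<notin> A) \<or> \<not> (p \<in> B \<and> q \<notin> B)
      then (if p \<in> A \<and> q \<notin> A then Some (insert q (A - {p}), B) else None)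
      else Some (A, insert q (B - {p})))"
    and "unmove_pair p q (A, B) =
     (if (q \<in> A \<and> p \<notin> A) \<and> \<not> (p \<in> B \<and> q \<notin> B) then Some (insert p (A - {q}), B)
      else if q \<in> B \<and> p \<notin> B then Some (A, insert p (B - {q})) else None)"
  by (auto simp: move_pair_def unmove_pair_def movable_def move_def)

text \<open>
  The letters \<open>i\<close>, \<open>i + 1\<close> and \<open>2n - i\<close>, \<open>2n - i + 1\<close> involved at the nodes \<open>i\<close> and \<open>2n - i\<close> are distinct, and
  all four are described by the states at \<open>i\<close> and \<open>i + 1\<close>. This leaves a finite table.
\<close>

lemma virtual_middle:
  assumes s: "s \<in> model n r" and i: "1 \<le> i" "i < n"
  shows "virtual_op n (pair_down n) i (cols n s) = map_option (cols n) (lower_op n i s)"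
    and "virtual_op n (pair_up n) i (cols n s) = map_option (cols n) (raise_op n i s)"
    and "phi_pair (source n i) (Suc i) (cols n s) = lower_count n i s"
    and "phi_pair (source n (2*n - i)) (Suc (2*n - i)) (cols n s) = lower_count n i s"
    and "eps_pair (source n i) (Suc i) (cols n s) = raise_count n i s"
    and "eps_pair (source n (2*n - i)) (Suc (2*n - i)) (cols n s) = raise_count n i s"
proof -
  define A B where "A = left_col n s" and "B = right_col n s"
  define i' j j' where "i' = Suc i" and "j = 2*n - i" and "j' = Suc (2*n - i)"
  have bars: "2*n + 1 - i = j'" "2*n + 1 - i' = j" using i by (auto simp: i'_def j_def j'_def)
  have dist: "i \<noteq> i'" "i \<noteq> j" "i \<noteq> j'" "i' \<noteq> j" "i' \<noteq> j'" "j \<noteq> j'"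
    using i by (auto simp: i'_def j_def j'_def)
  note dist' = dist dist[symmetric]
  have i1: "1 \<le> i" "i \<le> n" "1 \<le> i'" "i' \<le> n" using i by (auto simp: i'_def)
  note mem = mem_left_col[OF i1(1,2), of s, folded A_def, unfolded bars]
    mem_left_col[OF i1(3,4), of s, folded A_def, unfolded bars]
    mem_right_col[OF i1(1,2), of s, folded B_def, unfolded bars]
    mem_right_col[OF i1(3,4), of s, folded B_def, unfolded bars]
  have upd: "cols n (s(i := a, i' := b)) =
     (A - {i, j'} \<union> ((if a \<in> {Off, Pos, Open} then {i} else {}) \<union> (if a \<in> {Off, Neg, Close} then {j'} else {}))
      - {i', j} \<union> ((if b \<in> {Off, Pos, Open} then {i'} else {}) \<union> (if b \<in> {Off, Neg, Close} then {j} else {})),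
      B - {i, j'} \<union> ((if a \<in> {Pos, Close} then {i} else {}) \<union> (if a \<in> {Neg, Open} then {j'} else {}))
      - {i', j} \<union> ((if b \<in> {Pos, Close} then {i'} else {}) \<union> (if b \<in> {Neg, Open} then {j} else {})))" for a b
    unfolding cols_def left_col_update[OF i1(3,4)] right_col_update[OF i1(3,4)]
      left_col_update[OF i1(1,2)] right_col_update[OF i1(1,2)] bars A_def B_def ..
  have nodes: "2*n - i = j" "source n i = i" "source n j = j" "Suc i = i'" "Suc j = j'"
    using i by (auto simp: source_def i'_def j_def j'_def)
  have down: "pair_down n i = move_pair i i'" "pair_down n j = move_pair j j'"
    "pair_up n i = unmove_pair i i'" "pair_up n j = unmove_pair j j'"
    using nodes unfolding pair_down_def pair_up_def by simp_all
  have v: "virtual_op n g i x = Option.bind (g i x) (g j)" for g and x :: "nat set \<times> nat set"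
    using i by (simp add: virtual_op_def j_def)
  have l: "lower_op n i s = map_option (\<lambda>(a, b). s(i := a, i' := b)) (step_down (s i) (s i'))"
    "raise_op n i s = map_option (\<lambda>(a, b). s(i := a, i' := b)) (step_up (s i) (s i'))"
    "lower_count n i s = downs (s i) (s i')" "raise_count n i s = ups (s i) (s i')"
    using i by (auto simp: lower_op_def raise_op_def lower_count_def raise_count_def i'_def)
  \<comment> \<open>without these two exclusions the signatures at \<open>i\<close> and \<open>2n - i\<close> would differ\<close>
  have ex: "\<not> (s i = Off \<and> s i' = Close)" "\<not> (s i = Open \<and> s i' = Off)"
    using excluded[OF s i] by (auto simp: i'_def)
  have AB: "cols n s = (A, B)" by (simp add: cols_def A_def B_def)
  show "phi_pair (source n i) (Suc i) (cols n s) = lower_count n i s"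
    "phi_pair (source n (2*n - i)) (Suc (2*n - i)) (cols n s) = lower_count n i s"
    "eps_pair (source n i) (Suc i) (cols n s) = raise_count n i s"
    "eps_pair (source n (2*n - i)) (Suc (2*n - i)) (cols n s) = raise_count n i s"
    unfolding nodes AB l phi_pair_def eps_pair_def movable_def prod.case mem using ex
    by (cases "s i"; cases "s i'"; simp add: downs_def ups_def)+
  note mv = move_pair_simps[OF dist(1)] move_pair_simps[OF dist(6)]
  have "Option.bind (move_pair i i' (A, B)) (move_pair j j') = Some (cols n (s(i := c, i' := d)))"
    if st: "s i = a" "s i' = b" "step_down a b = Some (c, d)" for a b c d
    using that by (cases a; cases b; simp add: upd mv mem dist'; auto simp: mem dist')
  moreover have "move_pair i i' (A, B) = None" if "step_down (s i) (s i') = None"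
    using that ex by (cases "s i"; cases "s i'"; simp add: mv mem)
  ultimately show "virtual_op n (pair_down n) i (cols n s) = map_option (cols n) (lower_op n i s)"
    unfolding v down AB l by (cases "step_down (s i) (s i')") auto
  have "Option.bind (unmove_pair i i' (A, B)) (unmove_pair j j') = Some (cols n (s(i := c, i' := d)))"
    if st: "s i = a" "s i' = b" "step_up a b = Some (c, d)" for a b c d
    using that by (cases a; cases b; simp add: upd mv mem dist'; auto simp: mem dist')
  moreover have "unmove_pair i i' (A, B) = None" if "step_up (s i) (s i') = None"
    using that ex by (cases "s i"; cases "s i'"; simp add: mv mem)
  ultimately show "virtual_op n (pair_up n) i (cols n s) = map_option (cols n) (raise_op n i s)"
    unfolding v down AB l by (cases "step_up (s i) (s i')") auto
qed

lemma virtual_n: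
  assumes s: "s \<in> model n r" and n: "2 \<le> n"
  shows "virtual_op n (pair_down n) n (cols n s) = map_option (cols n) (lower_op n n s)"
    and "virtual_op n (pair_up n) n (cols n s) = map_option (cols n) (raise_op n n s)"
    and "phi_pair (source n n) (Suc n) (cols n s) = 2 * lower_count n n s"
    and "eps_pair (source n n) (Suc n) (cols n s) = 2 * raise_count n n s"
proof -
  define A B where "A = left_col n s" and "B = right_col n s"
  define n' where "n' = Suc n"
  have bar: "2*n + 1 - n = n'" by (simp add: n'_def)
  have dist: "n \<noteq> n'" "n' \<noteq> n" by (auto simp: n'_def)
  have n1: "1 \<le> n" "n \<le> n" using n by auto
  note mem = mem_left_col[OF n1, of s, folded A_def, unfolded bar]
    mem_right_col[OF n1, of s, folded B_def, unfolded bar]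
  have upd: "cols n (s(n := a)) =
     (A - {n, n'} \<union> ((if a \<in> {Off, Pos, Open} then {n} else {}) \<union> (if a \<in> {Off, Neg, Close} then {n'} else {})),
      B - {n, n'} \<union> ((if a \<in> {Pos, Close} then {n} else {}) \<union> (if a \<in> {Neg, Open} then {n'} else {})))" for a
    unfolding cols_def left_col_update[OF n1] right_col_update[OF n1] bar A_def B_def ..
  have nodes: "source n n = n" "Suc n = n'" using n by (auto simp: source_def n'_def)
  have down: "pair_down n n = move_pair n n'" "pair_up n n = unmove_pair n n'"
    unfolding pair_down_def pair_up_def nodes by simp_all
  have ex: "s n \<noteq> Open" using excluded(4)[OF s, of 1] n by simp
  have AB: "cols n s = (A, B)" by (simp add: cols_def A_def B_def)
  have v: "virtual_op n g n x = Option.bind (g n x) (g n)" for g and x :: "nat set \<times> nat set"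
    by (simp add: virtual_op_def)
  have l: "lower_op n n s = (if s n = Pos then Some (s(n := Neg)) else None)"
    "raise_op n n s = (if s n = Neg then Some (s(n := Pos)) else None)"
    "lower_count n n s = of_bool (s n = Pos)" "raise_count n n s = of_bool (s n = Neg)"
    using n by (auto simp: lower_op_def raise_op_def lower_count_def raise_count_def)
  show "phi_pair (source n n) (Suc n) (cols n s) = 2 * lower_count n n s"
    "eps_pair (source n n) (Suc n) (cols n s) = 2 * raise_count n n s"
    unfolding nodes AB l phi_pair_def eps_pair_def movable_def prod.case mem using ex
    by (cases "s n"; simp)+
  note mv = move_pair_simps[OF dist(1)]
  show "virtual_op n (pair_down n) n (cols n s) = map_option (cols n) (lower_op n n s)"
    unfolding v down AB l mv using mem ex dist
    by (cases "s n"; simp add: mv upd set_eq_iff; blast)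
  show "virtual_op n (pair_up n) n (cols n s) = map_option (cols n) (raise_op n n s)"
    unfolding v down AB l mv using mem ex dist
    by (cases "s n"; simp add: mv upd set_eq_iff; blast)
qed

lemma virtual_0:
  assumes s: "s \<in> model n r" and n: "2 \<le> n"
  shows "virtual_op n (pair_down n) 0 (cols n s) = map_option (cols n) (lower_op n 0 s)"
    and "virtual_op n (pair_up n) 0 (cols n s) = map_option (cols n) (raise_op n 0 s)"
    and "phi_pair (source n 0) (Suc 0) (cols n s) = 2 * lower_count n 0 s"
    and "eps_pair (source n 0) (Suc 0) (cols n s) = 2 * raise_count n 0 s"
proof -
  define A B where "A = left_col n s" and "B = right_col n s"
  define m where "m = 2*n"
  have bar: "2*n + 1 - 1 = m" by (simp add: m_def)
  have dist: "m \<noteq> 1" "1 \<noteq> m" using n by (auto simp: m_def)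
  have n1: "1 \<le> (1::nat)" "1 \<le> n" using n by auto
  note mem = mem_left_col[OF n1, of s, folded A_def, unfolded bar]
    mem_right_col[OF n1, of s, folded B_def, unfolded bar]
  have upd: "cols n (s(1 := a)) =
     (A - {1, m} \<union> ((if a \<in> {Off, Pos, Open} then {1} else {}) \<union> (if a \<in> {Off, Neg, Close} then {m} else {})),
      B - {1, m} \<union> ((if a \<in> {Pos, Close} then {1} else {}) \<union> (if a \<in> {Neg, Open} then {m} else {})))" for a
    unfolding cols_def left_col_update[OF n1] right_col_update[OF n1] bar A_def B_def ..
  have nodes: "source n 0 = m" "Suc 0 = 1" by (auto simp: source_def m_def)
  have down: "pair_down n 0 = move_pair m 1" "pair_up n 0 = unmove_pair m 1"
    unfolding pair_down_def pair_up_def nodes by simp_all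
  have ex: "s 1 \<noteq> Close" using excluded(3)[OF s, of 1] n by simp
  have AB: "cols n s = (A, B)" by (simp add: cols_def A_def B_def)
  have v: "virtual_op n g 0 x = Option.bind (g 0 x) (g 0)" for g and x :: "nat set \<times> nat set"
    by (simp add: virtual_op_def)
  have l: "lower_op n 0 s = (if s 1 = Neg then Some (s(1 := Pos)) else None)"
    "raise_op n 0 s = (if s 1 = Pos then Some (s(1 := Neg)) else None)"
    "lower_count n 0 s = of_bool (s 1 = Neg)" "raise_count n 0 s = of_bool (s 1 = Pos)"
    by (auto simp: lower_op_def raise_op_def lower_count_def raise_count_def)
  show "phi_pair (source n 0) (Suc 0) (cols n s) = 2 * lower_count n 0 s"
    "eps_pair (source n 0) (Suc 0) (cols n s) = 2 * raise_count n 0 s"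
    unfolding nodes AB l phi_pair_def eps_pair_def movable_def prod.case mem using ex
    by (cases "s 1"; simp del: One_nat_def)+
  note mv = move_pair_simps[OF dist(1)]
  show "virtual_op n (pair_down n) 0 (cols n s) = map_option (cols n) (lower_op n 0 s)"
    unfolding v down AB l mv using mem ex dist
    by (cases "s 1"; simp add: mv upd set_eq_iff del: One_nat_def; blast)
  show "virtual_op n (pair_up n) 0 (cols n s) = map_option (cols n) (raise_op n 0 s)"
    unfolding v down AB l mv using mem ex dist
    by (cases "s 1"; simp add: mv upd set_eq_iff del: One_nat_def; blast)
qed

lemma virtual_cols:
  assumes "s \<in> model n r" "2 \<le> n" "i \<le> n"
  shows "virtual_op n (pair_down n) i (cols n s) = map_option (cols n) (lower_op n i s)"
    and "virtual_op n (pair_up n) i (cols n s) = map_option (cols n) (raise_op n i s)"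
  using assms virtual_0[OF assms(1,2)] virtual_n[OF assms(1,2)] virtual_middle[OF assms(1), of i]
  by (metis One_nat_def Suc_leI le_neq_implies_less neq0_conv)+

section \<open>Realizations of the model\<close>

lemma left_col_top: "r \<le> n \<Longrightarrow> left_col n (top_word r) = {1..2*n - r}"
proof (rule letter_set_eqI[of _ n])
  assume r: "r \<le> n"
  fix k assume k: "1 \<le> k" "k \<le> n"
  show "k \<in> left_col n (top_word r) \<longleftrightarrow> k \<in> {1..2*n - r}"
    "2*n + 1 - k \<in> left_col n (top_word r) \<longleftrightarrow> 2*n + 1 - k \<in> {1..2*n - r}"
    unfolding mem_left_col[OF k] using k r by (auto simp: top_word_def)
qed (auto simp: cols_range[THEN subsetD] dest: subsetD[OF cols_range(1)])

lemma right_col_top: "r \<le> n \<Longrightarrow> right_col n (top_word r) = {1..r}"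
proof (rule letter_set_eqI[of _ n])
  assume r: "r \<le> n"
  fix k assume k: "1 \<le> k" "k \<le> n"
  show "k \<in> right_col n (top_word r) \<longleftrightarrow> k \<in> {1..r}"
    "2*n + 1 - k \<in> right_col n (top_word r) \<longleftrightarrow> 2*n + 1 - k \<in> {1..r}"
    unfolding mem_right_col[OF k] using k r by (auto simp: top_word_def)
qed (auto dest: subsetD[OF cols_range(2)])

definition tableau_pair :: "nat \<Rightarrow> nat \<Rightarrow> nat set \<times> nat set \<Rightarrow> bool" where
  "tableau_pair n r = (\<lambda>(A, B). A \<in> columns n (2*n - r) \<and> B \<in> columns n r \<and> row_dom A B)"

lemma tableau_pair_down:
  assumes "tableau_pair n r ab" "pair_down n i ab = Some ab'" "1 \<le> i" "i < 2*n"
  shows "tableau_pair n r ab'"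
proof -
  obtain A B A' B' where ab: "ab = (A, B)" "ab' = (A', B')" by (cases ab; cases ab')
  have m: "move_pair i (Suc i) (A, B) = Some (A', B')" using assms(2,3) by (simp add: pair_down_def source_def ab)
  have AB: "A \<in> columns n (2*n - r)" "B \<in> columns n r" "row_dom A B" using assms(1) by (auto simp: tableau_pair_def ab)
  have "Suc i \<in> {1..2*n}" using assms(4) by simp
  then show ?thesis
    using move_pair_columns[OF m AB(1,2)] row_dom_move_pair[OF _ _ AB(3) m] columnsD[OF AB(1)] columnsD[OF AB(2)]
    by (simp add: tableau_pair_def ab)
qed

text \<open>
  Column heights and dominance are inherited from the highest weight word, because the type A
  operators preserve both.
\<close>

lemma cols_tableau_pair:
  assumes "s \<in> model n r" "2 \<le> n" "r \<le> n"
  shows "tableau_pair n r (cols n s)"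
  using assms(1,2)
proof (induction rule: model_induct)
  case top
  have "card ({1..r} \<inter> {..<k}) \<le> card ({1..2*n - r} \<inter> {..<k})" for k
    using assms(3) by (intro card_mono) auto
  then show ?case
    using assms(3) by (simp add: tableau_pair_def cols_def left_col_top right_col_top columns_def row_dom_def)
next
  case (step s s' i)
  have "virtual_op n (pair_down n) i (cols n s) = Some (cols n s')"
    using virtual_cols(1)[OF step.hyps(1) assms(2) step.hyps(3)] step.hyps(4) by simp
  then obtain ab j where ab: "pair_down n i (cols n s) = Some ab" "pair_down n j ab = Some (cols n s')"
    and j: "j = i \<or> i < n \<and> j = 2*n - i"
    using step.hyps(2,3) by (auto simp: virtual_op_def bind_eq_Some_conv split: if_splits)
  have "1 \<le> i" "i < 2*n" "1 \<le> j" "j < 2*n" using step.hyps(2,3) j assms(2) by auto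
  then show ?case using tableau_pair_down ab step.IH by blast
qed

lemma bind_transport:
  assumes "f1 (\<iota> x) = map_option \<iota> (g1 x)" "\<And>y. g1 x = Some y \<Longrightarrow> f2 (\<iota> y) = map_option \<iota> (g2 y)"
  shows "Option.bind (f1 (\<iota> x)) f2 = map_option \<iota> (Option.bind (g1 x) g2)"
  using assms by (cases "g1 x") auto

lemma virtual_transport:
  assumes "\<And>y j. y \<in> D \<Longrightarrow> j = i \<or> i \<notin> {0, n} \<and> j = 2*n - i \<Longrightarrow> f j (\<iota> y) = map_option \<iota> (g j y)"
    and "\<And>y. g i x = Some y \<Longrightarrow> y \<in> D" and "x \<in> D"
  shows "virtual_op n f i (\<iota> x) = map_option \<iota> (virtual_op n g i x)"
  unfolding virtual_op_def using assms by (auto intro!: bind_transport)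

lemma inj_cols:
  assumes "s \<in> model n r" "s' \<in> model n r" "cols n s = cols n s'"
  shows "s = s'"
proof
  fix k
  show "s k = s' k"
  proof (cases "k \<in> {1..n}")
    case True
    then have k: "1 \<le> k" "k \<le> n" by auto
    have "left_col n s = left_col n s'" "right_col n s = right_col n s'" using assms(3) by (auto simp: cols_def)
    then show ?thesis
      using mem_left_col[OF k, of s] mem_left_col[OF k, of s'] mem_right_col[OF k, of s] mem_right_col[OF k, of s']
      by (cases "s k"; cases "s' k"; simp)
  next
    case False then show ?thesis using assms modelD(4) by metis
  qed
qed

lemma sum_single:
  assumes "1 \<le> j" "j \<le> n"
  shows "(\<Sum>i=1..n. if i = j then f i else (0::int)) = f (j::nat)"
  using assms by simp

text \<open>
  \<open>\<Psi>\<close> in coordinates: symmetric under \<open>j \<mapsto> 2n - j\<close>, and doubled in the middle.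
\<close>

lemma Psi_eq:
  assumes "2 \<le> n"
  shows "Psi n l j = (if j = 0 then 0 else if j < n then l j else if j = n then 2 * l n
     else if j < 2*n then l (2*n - j) else 0)"
proof -
  consider "j = 0 \<or> 2*n \<le> j" | "1 \<le> j" "j < n" | "j = n" | "n < j" "j < 2*n" by linarith
  then show ?thesis
  proof cases
    case 1
    then have "Psi n l j = (\<Sum>i=1..n. 0)" using assms
      unfolding Psi_def by (intro sum.cong) (auto simp: Psi_fund_def)
    then show ?thesis using 1 assms by auto
  next
    case 2
    then have "Psi n l j = (\<Sum>i=1..n. if i = j then l i else 0)"
      unfolding Psi_def by (intro sum.cong) (auto simp: Psi_fund_def)
    then show ?thesis using 2 sum_single[of j n l] by simp
  next
    case 3
    then have "Psi n l j = (\<Sum>i=1..n. if i = n then 2 * l i else 0)"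
      unfolding Psi_def by (intro sum.cong) (auto simp: Psi_fund_def)
    then show ?thesis using 3 assms sum_single[of n n "\<lambda>i. 2 * l i"] by simp
  next
    case 4
    then have "Psi n l j = (\<Sum>i=1..n. if i = 2*n - j then l i else 0)"
      unfolding Psi_def by (intro sum.cong) (auto simp: Psi_fund_def)
    moreover have "1 \<le> 2*n - j" "2*n - j \<le> n" using 4 by auto
    ultimately show ?thesis using 4 sum_single[of "2*n - j" n l] by simp
  qed
qed

lemma inj_Psi: "2 \<le> n \<Longrightarrow> inj_on (Psi n) (weights_C n)"
proof (rule inj_onI, rule ext)
  fix l l' i assume n: "2 \<le> n" and l: "l \<in> weights_C n" "l' \<in> weights_C n" and e: "Psi n l = Psi n l'"
  show "l i = l' i"
  proof (cases "i \<in> {1..n}")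
    case True
    then show ?thesis using fun_cong[OF e, of i] n by (auto simp: Psi_eq split: if_splits)
  next
    case False then show ?thesis using l by (simp add: weights_C_def)
  qed
qed

lemma model_weight_in: "model_weight n s \<in> weights_C n"
  by (auto simp: weights_C_def model_weight_def)

text \<open>
  With \<open>g x\<close> the multiplicity of the letter \<open>x\<close>, the letters \<open>k\<close> and \<open>2n + 1 - k\<close> occur \<open>1 + sign\<close> and
  \<open>1 - sign\<close> times, which makes the weight symmetric.
\<close>

lemma pair_weight:
  assumes "2 \<le> n"
  shows "weight (words n (card (left_col n s))) (col (left_col n s)) j +
     weight (words n (card (right_col n s))) (col (right_col n s)) j = Psi n (model_weight n s) j"
proof -
  define g :: "nat \<Rightarrow> int" where "g x = of_bool (x \<in> left_col n s) + of_bool (x \<in> right_col n s)" for x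
  have g: "g k = 1 + sign (s k)" "g (2*n + 1 - k) = 1 - sign (s k)" if "1 \<le> k" "k \<le> n" for k
    unfolding g_def mem_left_col[OF that] mem_right_col[OF that] by (cases "s k"; simp)+
  consider "j = 0 \<or> 2*n \<le> j" | "1 \<le> j" "j < n" | "j = n" | "n < j" "j < 2*n" by linarith
  then have "(if 1 \<le> j \<and> j \<le> 2*n - 1 then g j - g (j + 1) else 0) = Psi n (model_weight n s) j"
  proof cases
    case 1 then show ?thesis using assms by (auto simp: Psi_eq)
  next
    case 2
    then have "j \<le> 2*n - 1" by simp
    then show ?thesis using 2 assms g[of j] g[of "Suc j"] by (simp add: Psi_eq model_weight_def)
  next
    case 3
    moreover have "n \<le> 2*n - 1" using assms by simp
    ultimately show ?thesis using assms g(1)[of n] g(2)[of n] by (simp add: Psi_eq model_weight_def Suc_diff_le)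
  next
    case 4
    define i where "i = 2*n - j"
    have i: "1 \<le> i" "i < n" "j = 2*n + 1 - Suc i" "j + 1 = 2*n + 1 - i" using 4 by (auto simp: i_def)
    have "g j - g (j + 1) = sign (s i) - sign (s (Suc i))"
      unfolding i(4) using g(2)[of "Suc i"] g(2)[of i] i by simp
    moreover have "j \<le> 2*n - 1" using 4 by simp
    ultimately show ?thesis using 4 i assms by (simp add: Psi_eq model_weight_def i_def[symmetric])
  qed
  then show ?thesis
    unfolding weight_words_col[OF cols_range(1)] weight_words_col[OF cols_range(2)] g_def
    by auto
qed

text \<open>
  The interface between the model and an ambient crystal, from which all assertions about
  \<open>V\<^sup>r\<^sup>,\<^sup>1\<close> and \<open>V(\<Lambda>\<^sub>r)\<close> except alignment are derived.
\<close>

definition realizes :: "nat \<Rightarrow> nat \<Rightarrow> nat set \<Rightarrow> 'a crystal \<Rightarrow> ((nat \<Rightarrow> state) \<Rightarrow> 'a) \<Rightarrow> bool" where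
  "realizes n r I A \<iota> \<longleftrightarrow> inj_on \<iota> (model n r) \<and>
     (\<forall>s\<in>model n r. \<iota> s \<in> elems A \<and> weight A (\<iota> s) = Psi n (model_weight n s) \<and>
        (\<forall>i\<in>I. virtual_op n (f_op A) i (\<iota> s) = map_option \<iota> (lower_op n i s) \<and>
               virtual_op n (e_op A) i (\<iota> s) = map_option \<iota> (raise_op n i s)))"

lemma realizes_pairs:
  fixes \<iota> :: "nat set \<times> nat set \<Rightarrow> 'a"
  defines "D \<equiv> \<lambda>n r. columns n (2*n - r) \<times> columns n r"
  assumes n: "2 \<le> n" "r \<le> n" and I: "I \<subseteq> {0..n}"
    and inj: "inj_on \<iota> (D n r)"
    and el: "\<And>ab. tableau_pair n r ab \<Longrightarrow> \<iota> ab \<in> elems C"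
    and wt: "\<And>A B j. (A, B) \<in> D n r \<Longrightarrow> weight C (\<iota> (A, B)) j =
       weight (words n (card A)) (col A) j + weight (words n (card B)) (col B) j"
    and f: "\<And>ab j. ab \<in> D n r \<Longrightarrow> j < 2*n \<Longrightarrow> (j = 0 \<Longrightarrow> 0 \<in> I) \<Longrightarrow>
       f_op C j (\<iota> ab) = map_option \<iota> (pair_down n j ab)"
    and e: "\<And>ab j. ab \<in> D n r \<Longrightarrow> j < 2*n \<Longrightarrow> (j = 0 \<Longrightarrow> 0 \<in> I) \<Longrightarrow>
       e_op C j (\<iota> ab) = map_option \<iota> (pair_up n j ab)"
  shows "realizes n r I C (\<lambda>s. \<iota> (cols n s))"
  unfolding realizes_def
proof (intro conjI ballI)
  have tp: "tableau_pair n r (cols n s)" if "s \<in> model n r" for s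
    using cols_tableau_pair[OF that n] .
  have tD: "ab \<in> D n r" if "tableau_pair n r ab" for ab
    using that by (auto simp: tableau_pair_def D_def split: prod.splits)
  have cl: "ab' \<in> D n r"
    if "pair_down n i ab = Some ab' \<or> pair_up n i ab = Some ab'" "ab \<in> D n r" "i < 2*n" for i ab ab'
    using that move_pair_columns[of "source n i" "Suc i" "fst ab" "snd ab" "fst ab'" "snd ab'" n "2*n - r" r]
      unmove_pair_columns[of "source n i" "Suc i" "fst ab" "snd ab" "fst ab'" "snd ab'" n "2*n - r" r]
      source_range[OF that(3)]
    by (cases ab; cases ab') (auto simp: pair_down_def pair_up_def D_def)
  show "inj_on (\<lambda>s. \<iota> (cols n s)) (model n r)"
    using inj_onD[OF inj _ tD[OF tp] tD[OF tp]] inj_cols by (blast intro: inj_onI)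
  fix s assume s: "s \<in> model n r"
  show "\<iota> (cols n s) \<in> elems C" by (rule el[OF tp[OF s]])
  show "weight C (\<iota> (cols n s)) = Psi n (model_weight n s)"
    using wt[of "left_col n s" "right_col n s"] tD[OF tp[OF s]] pair_weight[OF n(1), of s]
    by (intro ext) (simp add: cols_def)
  fix i assume i: "i \<in> I"
  then have i2: "i \<le> n" "i < 2*n" using I n by auto
  have "virtual_op n (f_op C) i (\<iota> (cols n s)) = map_option \<iota> (virtual_op n (pair_down n) i (cols n s))"
  proof (rule virtual_transport[OF _ _ tD[OF tp[OF s]]])
    show "f_op C j (\<iota> ab) = map_option \<iota> (pair_down n j ab)"
      if "ab \<in> D n r" "j = i \<or> i \<notin> {0, n} \<and> j = 2*n - i" for ab j
      by (rule f[OF that(1)]) (use that(2) i i2 n in auto)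
    show "ab \<in> D n r" if "pair_down n i (cols n s) = Some ab" for ab
      by (rule cl[OF disjI1[OF that] tD[OF tp[OF s]] i2(2)])
  qed
  then show "virtual_op n (f_op C) i (\<iota> (cols n s)) = map_option (\<lambda>s. \<iota> (cols n s)) (lower_op n i s)"
    using virtual_cols(1)[OF s n(1) i2(1)] by (simp add: option.map_comp comp_def)
  have "virtual_op n (e_op C) i (\<iota> (cols n s)) = map_option \<iota> (virtual_op n (pair_up n) i (cols n s))"
  proof (rule virtual_transport[OF _ _ tD[OF tp[OF s]]])
    show "e_op C j (\<iota> ab) = map_option \<iota> (pair_up n j ab)"
      if "ab \<in> D n r" "j = i \<or> i \<notin> {0, n} \<and> j = 2*n - i" for ab j
      by (rule e[OF that(1)]) (use that(2) i i2 n in auto)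
    show "ab \<in> D n r" if "pair_up n i (cols n s) = Some ab" for ab
      by (rule cl[OF disjI2[OF that] tD[OF tp[OF s]] i2(2)])
  qed
  then show "virtual_op n (e_op C) i (\<iota> (cols n s)) = map_option (\<lambda>s. \<iota> (cols n s)) (raise_op n i s)"
    using virtual_cols(2)[OF s n(1) i2(1)] by (simp add: option.map_comp comp_def)
qed

text \<open>
  Independent of whether \<open>0\<close> belongs to \<open>I\<close>: the model is closed under all operators and generated
  by the classical ones.
\<close>

lemma generated_eq_model:
  assumes R: "realizes n r I A \<iota>" and I: "{1..n} \<subseteq> I" "I \<subseteq> {0..n}" and n: "2 \<le> n" "r \<le> n"
  shows "generated n A I (\<iota> (top_word r)) = \<iota> ` model n r" (is "?G = _")
proof (intro set_eqI iffI)
  fix b assume "b \<in> ?G"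
  then show "b \<in> \<iota> ` model n r"
  proof induction
    case 1 then show ?case using top_word_model[OF n(2)] by blast
  next
    case (2 b i b')
    then obtain s where s: "s \<in> model n r" "b = \<iota> s" by auto
    have "virtual_op n (e_op A) i (\<iota> s) = map_option \<iota> (raise_op n i s)"
      using R s(1) "2.hyps"(2) unfolding realizes_def by blast
    then obtain s' where "raise_op n i s = Some s'" "b' = \<iota> s'" using "2.hyps"(3) s(2) by auto
    then show ?case using op_model(2)[OF s(1) n(1), of i s'] I(2) "2.hyps"(2) by auto
  next
    case (3 b i b')
    then obtain s where s: "s \<in> model n r" "b = \<iota> s" by auto
    have "virtual_op n (f_op A) i (\<iota> s) = map_option \<iota> (lower_op n i s)"
      using R s(1) "3.hyps"(2) unfolding realizes_def by blast
    then obtain s' where "lower_op n i s = Some s'" "b' = \<iota> s'" using "3.hyps"(3) s(2) by auto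
    then show ?case using op_model(1)[OF s(1) n(1), of i s'] I(2) "3.hyps"(2) by auto
  qed
next
  fix b assume "b \<in> \<iota> ` model n r"
  then obtain s where s: "s \<in> model n r" "b = \<iota> s" by auto
  from s(1) n(1) have "\<iota> s \<in> ?G"
  proof (induction rule: model_induct)
    case top
    then show ?case using top_word_model[OF n(2)] R by (auto simp: realizes_def intro: generated.intros(1))
  next
    case (step s s' i)
    have s': "s' \<in> model n r" using op_model(1)[OF step.hyps(1) n(1) step.hyps(3,4)] .
    have i: "i \<in> I" using I step.hyps(2,3) by auto
    have "virtual_op n (f_op A) i (\<iota> s) = map_option \<iota> (lower_op n i s)" "\<iota> s' \<in> elems A"
      using R step.hyps(1) s' i unfolding realizes_def by blast+
    then show ?case using generated.intros(3)[OF step.IH i] step.hyps(4) by simp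
  qed
  then show "b \<in> ?G" using s by simp
qed

lemma is_crystal_model:
  assumes n: "2 \<le> n" "r \<le> n" and I: "I \<subseteq> {0..n}"
    and D: "elems D = \<iota> ` model n r" "inj_on \<iota> (model n r)"
    and f: "\<And>s i. s \<in> model n r \<Longrightarrow> i \<in> I \<Longrightarrow> f_op D i (\<iota> s) = map_option \<iota> (lower_op n i s)"
    and e: "\<And>s i. s \<in> model n r \<Longrightarrow> i \<in> I \<Longrightarrow> e_op D i (\<iota> s) = map_option \<iota> (raise_op n i s)"
    and w: "\<And>s i. s \<in> model n r \<Longrightarrow> i \<in> I \<Longrightarrow>
      weight D (\<iota> s) i = (if i = 0 then - sign (s 1) else model_weight n s i)"
  shows "is_crystal I (cartan n) D"
proof -
  let ?X = "model n r" and ?j = "inv_into (model n r) \<iota>"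
  have j: "?j (\<iota> s) = s" if "s \<in> ?X" for s using that D(2) by simp
  have le: "i \<le> n" if "i \<in> I" for i using that I by auto
  have 1: "string_fun (elems D) (f_op D i) (\<lambda>b. lower_count n i (?j b))" if "i \<in> I" for i
    unfolding D(1) using model_strings(1)[OF n(1) le[OF that]]
    by (rule string_fun_image) (use f j that in auto)
  have 2: "string_fun (elems D) (e_op D i) (\<lambda>b. raise_count n i (?j b))" if "i \<in> I" for i
    unfolding D(1) using model_strings(2)[OF n(1) le[OF that]]
    by (rule string_fun_image) (use e j that in auto)
  have inv: "f_op D i b = Some b' \<longleftrightarrow> e_op D i b' = Some b" if h: "i \<in> I" "b \<in> elems D" "b' \<in> elems D" for i b b'
  proof -
    obtain s s' where s: "s \<in> ?X" "b = \<iota> s" "s' \<in> ?X" "b' = \<iota> s'" using h D(1) by auto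
    have "f_op D i b = Some b' \<longleftrightarrow> lower_op n i s = Some s'"
      using f[OF s(1) that(1)] s op_model(1)[OF s(1) n(1) le[OF that(1)]] inj_on_eq_iff[OF D(2)] by auto
    moreover have "e_op D i b' = Some b \<longleftrightarrow> raise_op n i s' = Some s"
      using e[OF s(3) that(1)] s op_model(2)[OF s(3) n(1) le[OF that(1)]] inj_on_eq_iff[OF D(2)] by auto
    ultimately show ?thesis using op_inverse[OF n(1) le[OF that(1)]] by simp
  qed
  have wt: "weight D b' k = weight D b k - cartan n k i"
    if h: "i \<in> I" "b \<in> elems D" "f_op D i b = Some b'" "k \<in> I" for i b b' k
  proof -
    obtain s where s: "s \<in> ?X" "b = \<iota> s" using h D(1) by auto
    then obtain s' where s': "lower_op n i s = Some s'" "b' = \<iota> s'"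
      using h(3) s f[OF s(1) h(1)] by auto
    then have "s' \<in> ?X" using op_model(1)[OF s(1) n(1) le[OF that(1)]] by blast
    then show ?thesis
      using w[OF s(1) that(4)] w[OF _ that(4), of s'] lower_weight[OF n(1) le[OF that(1)] le[OF that(4)] _ s'(1)]
        lower_weight(2)[OF n(1) le[OF that(1)] _ _ s'(1), of 1] n s s'
      by auto
  qed
  have pe: "weight D b i = int (phi D i b) - int (eps D i b)" if h: "i \<in> I" "b \<in> elems D" for i b
  proof -
    obtain s where s: "s \<in> ?X" "b = \<iota> s" using h D(1) by auto
    have "phi D i b = lower_count n i s" "eps D i b = raise_count n i s"
      using string_length_eq[OF 1[OF that(1)] that(2)] string_length_eq[OF 2[OF that(1)] that(2)] j[OF s(1)]
      by (simp_all add: phi_def eps_def s(2))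
    moreover have "- sign (s 1) = int (lower_count n 0 s) - int (raise_count n 0 s)"
      by (cases "s 1") (auto simp: lower_count_def raise_count_def)
    ultimately show ?thesis
      using w[OF s(1) that(1)] model_weight_eq[OF n(1) _ le[OF that(1)], of s] s(2) by (cases "i = 0") auto
  qed
  have "elems D \<noteq> {}" unfolding D(1) using top_word_model[OF n(2)] by blast
  moreover have "b' \<in> elems D" if "i \<in> I" "b \<in> elems D" "e_op D i b = Some b' \<or> f_op D i b = Some b'" for i b b'
    using string_funD(2)[OF 1[OF that(1)] that(2)] string_funD(2)[OF 2[OF that(1)] that(2)] that(3) by blast
  moreover have "finite {m. op_power (e_op D i) m b \<noteq> None} \<and> finite {m. op_power (f_op D i) m b \<noteq> None}"
    if "i \<in> I" "b \<in> elems D" for i b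
    using string_finite[OF 1[OF that(1)] that(2)] string_finite[OF 2[OF that(1)] that(2)] by blast
  ultimately show ?thesis
    unfolding is_crystal_def using inv wt pe by blast
qed

lemma realized_virtual_crystal:
  assumes R: "realizes n r I A \<iota>" and I: "{1..n} \<subseteq> I" "I \<subseteq> {0..n}" and n: "2 \<le> n" "r \<le> n"
  defines "V \<equiv> virtual_crystal n A (\<iota> ` model n r)"
  shows "virtual_weights_exist n A (\<iota> ` model n r)"
    and "is_C_crystal n V"
    and "I = {0..n} \<Longrightarrow> is_affine_C_crystal n V"
    and "s \<in> model n r \<Longrightarrow> weight V (\<iota> s) = model_weight n s"
proof -
  show "virtual_weights_exist n A (\<iota> ` model n r)"
    unfolding virtual_weights_exist_def using R model_weight_in by (auto simp: realizes_def)
  show w: "weight V (\<iota> s) = model_weight n s" if "s \<in> model n r" for s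
    using R that inv_into_f_f[OF inj_Psi[OF n(1)] model_weight_in]
    by (simp add: V_def virtual_crystal_def realizes_def)
  have ops: "elems V = \<iota> ` model n r" "f_op V = virtual_op n (f_op A)" "e_op V = virtual_op n (e_op A)"
    by (simp_all add: V_def virtual_crystal_def)
  show "is_C_crystal n V"
    unfolding is_C_crystal_def
    by (rule is_crystal_model[OF n, of _ _ \<iota>]) (use R I w in \<open>auto simp: ops realizes_def\<close>)
  show "is_affine_C_crystal n V" if "I = {0..n}"
    unfolding is_affine_C_crystal_def
  proof (rule is_crystal_model[OF n, of _ _ \<iota>])
    fix s i assume s: "s \<in> model n r" "i \<in> {0..n}"
    show "weight (level_zero n V) (\<iota> s) i = (if i = 0 then - sign (s 1) else model_weight n s i)"
      using w[OF s(1)] sum_model_weight[of n s] n by (simp add: level_zero_def)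
  qed (use R that in \<open>auto simp: level_zero_def ops realizes_def\<close>)
qed

lemma realized_isomorphic:
  assumes R: "realizes n r I A \<iota>" "{1..n} \<subseteq> I" "I \<subseteq> {0..n}"
    and S: "realizes n r J B \<kappa>" "{1..n} \<subseteq> J" "J \<subseteq> {0..n}" and n: "2 \<le> n" "r \<le> n"
  shows "crystal_isomorphic {1..n} (virtual_crystal n A (\<iota> ` model n r)) (virtual_crystal n B (\<kappa> ` model n r))"
    (is "crystal_isomorphic _ ?V ?W")
proof -
  let ?j = "inv_into (model n r) \<iota>"
  let ?\<theta> = "\<lambda>b. \<kappa> (?j b)"
  have inj: "inj_on \<iota> (model n r)" "inj_on \<kappa> (model n r)" using R(1) S(1) by (auto simp: realizes_def)
  have \<theta>: "?\<theta> (\<iota> s) = \<kappa> s" if "s \<in> model n r" for s using that inj(1) by simp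
  have "bij_betw ?\<theta> (\<iota> ` model n r) (\<kappa> ` model n r)"
    using bij_betw_comp_iff bij_betw_trans[OF inj_on_imp_bij_betw[OF inj(1), THEN bij_betw_inv_into]
        inj_on_imp_bij_betw[OF inj(2)]] by (simp add: comp_def)
  moreover have "(\<forall>i\<in>{1..n}. weight ?W (?\<theta> b) i = weight ?V b i) \<and>
      (\<forall>i\<in>{1..n}. e_op ?W i (?\<theta> b) = map_option ?\<theta> (e_op ?V i b)) \<and>
      (\<forall>i\<in>{1..n}. f_op ?W i (?\<theta> b) = map_option ?\<theta> (f_op ?V i b))" if h: "b \<in> \<iota> ` model n r" for b
  proof -
    obtain s where s: "s \<in> model n r" "b = \<iota> s" using h by auto
    have w: "weight ?W (?\<theta> b) i = weight ?V b i" for i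
      using realized_virtual_crystal(4)[OF R n s(1)] realized_virtual_crystal(4)[OF S n s(1)] \<theta>[OF s(1)]
      by (simp add: s(2))
    have i: "i \<in> I" "i \<in> J" "i \<le> n" if "i \<in> {1..n}" for i using that R(2) S(2) by auto
    have op: "map_option \<kappa> x = map_option ?\<theta> (map_option \<iota> x)" if "\<And>s'. x = Some s' \<Longrightarrow> s' \<in> model n r" for x
      using that \<theta> by (cases x) auto
    have f: "f_op ?W i (?\<theta> b) = map_option ?\<theta> (f_op ?V i b)"
      and e: "e_op ?W i (?\<theta> b) = map_option ?\<theta> (e_op ?V i b)" if "i \<in> {1..n}" for i
      using R(1) S(1) s i[OF that] \<theta>[OF s(1)] op op_model[OF s(1) n(1) i(3)[OF that]]
      by (simp_all add: realizes_def virtual_crystal_def)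
    show ?thesis using w f e by blast
  qed
  ultimately show ?thesis
    unfolding crystal_isomorphic_def by (intro exI[of _ ?\<theta>]) (simp add: virtual_crystal_def)
qed

lemma aligned_model:
  assumes n: "2 \<le> n"
    and phi: "\<And>s i. s \<in> model n r \<Longrightarrow> i < 2*n \<Longrightarrow> phi A i (\<iota> s) = phi_pair (source n i) (Suc i) (cols n s)"
    and eps: "\<And>s i. s \<in> model n r \<Longrightarrow> i < 2*n \<Longrightarrow> eps A i (\<iota> s) = eps_pair (source n i) (Suc i) (cols n s)"
  shows "aligned n A (\<iota> ` model n r)"
  unfolding aligned_def
proof
  fix b assume "b \<in> \<iota> ` model n r"
  then obtain s where s: "s \<in> model n r" "b = \<iota> s" by auto
  have "phi A i b = phi A (2*n - i) b \<and> eps A i b = eps A (2*n - i) b" if "i \<in> {1..n - 1}" for i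
  proof -
    have i: "1 \<le> i" "i < n" "i < 2*n" "2*n - i < 2*n" using that n by auto
    show ?thesis
      unfolding s(2) phi[OF s(1) i(3)] phi[OF s(1) i(4)] eps[OF s(1) i(3)] eps[OF s(1) i(4)]
        virtual_middle(3-6)[OF s(1) i(1,2)] by simp
  qed
  moreover have "even (phi A 0 b)" "even (eps A 0 b)" "even (phi A n b)" "even (eps A n b)"
    using phi[OF s(1), of 0] phi[OF s(1), of n] eps[OF s(1), of 0] eps[OF s(1), of n] n
      virtual_0(3,4)[OF s(1) n] virtual_n(3,4)[OF s(1) n] by (simp_all add: s(2))
  ultimately show "(\<forall>i\<in>{1..n - 1}. phi A i b = phi A (2*n - i) b \<and> eps A i b = eps A (2*n - i) b) \<and>
     even (phi A 0 b) \<and> even (eps A 0 b) \<and> even (phi A n b) \<and> even (eps A n b)" by blast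
qed

section \<open>The ambient crystals\<close>

lemma ambient_less:
  assumes n: "2 \<le> n" "1 \<le> r" "r < n"
  defines "\<iota> \<equiv> \<lambda>(A, B). [[col A], [col B]]" and "C \<equiv> ambient n r"
  shows "realizes n r {0..n} C (\<lambda>s. \<iota> (cols n s))"
    and "s \<in> model n r \<Longrightarrow> i < 2*n \<Longrightarrow> phi C i (\<iota> (cols n s)) = phi_pair (source n i) (Suc i) (cols n s)"
    and "s \<in> model n r \<Longrightarrow> i < 2*n \<Longrightarrow> eps C i (\<iota> (cols n s)) = eps_pair (source n i) (Suc i) (cols n s)"
proof -
  let ?h = "2*n - r"
  let ?D = "columns n ?h \<times> columns n r"
  have C: "C = tensor_list [rect_crystal n ?h 1, rect_crystal n r 1]" using n by (simp add: C_def ambient_def)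
  have h: "1 \<le> n" "1 \<le> ?h" "1 \<le> r" using n by auto
  note T = tensor_columns[OF h, folded C]
  have ops: "f_op C i (\<iota> ab) = map_option \<iota> (pair_down n i ab)"
    "e_op C i (\<iota> ab) = map_option \<iota> (pair_up n i ab)"
    "phi C i (\<iota> ab) = phi_pair (source n i) (Suc i) ab" "eps C i (\<iota> ab) = eps_pair (source n i) (Suc i) ab"
    if "ab \<in> ?D" "i < 2*n" for i ab
    using T[OF that(2), of "fst ab" "snd ab"] that(1)
    by (auto simp: pair_down_def pair_up_def \<iota>_def del: One_nat_def)
  have D: "cols n s \<in> ?D" if "s \<in> model n r" for s
    using cols_tableau_pair[OF that n(1)] n by (auto simp: tableau_pair_def split: prod.splits)
  then show "phi C i (\<iota> (cols n s)) = phi_pair (source n i) (Suc i) (cols n s)"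
    "eps C i (\<iota> (cols n s)) = eps_pair (source n i) (Suc i) (cols n s)" if "s \<in> model n r" "i < 2*n"
    using ops(3,4) that by auto
  show "realizes n r {0..n} C (\<lambda>s. \<iota> (cols n s))"
  proof (rule realizes_pairs)
    show "inj_on \<iota> ?D"
    proof (rule inj_onI)
      fix ab ab' assume h: "ab \<in> ?D" "ab' \<in> ?D" "\<iota> ab = \<iota> ab'"
      obtain L R L' R' where e: "ab = (L, R)" "ab' = (L', R')" by (cases ab; cases ab')
      then have "finite L" "finite R" "finite L'" "finite R'" using h(1,2) columnsD by blast+
      then show "ab = ab'" using h(3) col_inj e by (simp add: \<iota>_def)
    qed
    show "\<iota> ab \<in> elems C" if "tableau_pair n r ab" for ab
    proof -
      obtain L R where e: "ab = (L, R)" "L \<in> columns n ?h" "R \<in> columns n r"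
        using \<open>tableau_pair n r ab\<close> by (cases ab) (auto simp: tableau_pair_def)
      have "[col L] \<in> elems (tableaux n [?h])" "[col R] \<in> elems (tableaux n [r])"
        using e elems_tableaux_single h by auto
      then show ?thesis by (simp add: C e(1) \<iota>_def tensor_list_def elems_tensor_cons rect_crystal_simps)
    qed
    show "weight C (\<iota> (L, R)) j = weight (words n (card L)) (col L) j + weight (words n (card R)) (col R) j"
      if "(L, R) \<in> ?D" for L R j
      using that
      by (auto simp: C \<iota>_def tensor_list_def weight_tensor_cons rect_crystal_simps tableaux_def dest!: columnsD)
  qed (use ops n in auto)
qed

lemma two_column_tableaux:
  assumes n: "2 \<le> n" "1 \<le> r" "r \<le> n"
  defines "\<iota> \<equiv> \<lambda>(A, B). [col A, col B]" and "C \<equiv> tableaux n [2*n - r, r]"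
  shows "realizes n r {1..n} C (\<lambda>s. \<iota> (cols n s))"
    and "s \<in> model n r \<Longrightarrow> 1 \<le> i \<Longrightarrow> i < 2*n \<Longrightarrow>
      phi C i (\<iota> (cols n s)) = phi_pair (source n i) (Suc i) (cols n s)"
    and "s \<in> model n r \<Longrightarrow> 1 \<le> i \<Longrightarrow> i < 2*n \<Longrightarrow>
      eps C i (\<iota> (cols n s)) = eps_pair (source n i) (Suc i) (cols n s)"
proof -
  let ?h = "2*n - r"
  let ?D = "columns n ?h \<times> columns n r"
  have h: "1 \<le> ?h" "1 \<le> r" using n by auto
  have ops: "f_op C i (\<iota> ab) = map_option \<iota> (pair_down n i ab)"
    "e_op C i (\<iota> ab) = map_option \<iota> (pair_up n i ab)"
    "phi C i (\<iota> ab) = phi_pair (source n i) (Suc i) ab" "eps C i (\<iota> ab) = eps_pair (source n i) (Suc i) ab"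
    if "ab \<in> ?D" "1 \<le> i" "i < 2*n" for i ab
    using tableaux_pair[of "fst ab" n ?h "snd ab" r i, folded C_def \<iota>_def] that
    by (auto simp: pair_down_def pair_up_def \<iota>_def source_def)
  have D: "cols n s \<in> ?D" if "s \<in> model n r" for s
    using cols_tableau_pair[OF that n(1,3)] by (auto simp: tableau_pair_def split: prod.splits)
  then show "phi C i (\<iota> (cols n s)) = phi_pair (source n i) (Suc i) (cols n s)"
    "eps C i (\<iota> (cols n s)) = eps_pair (source n i) (Suc i) (cols n s)" if "s \<in> model n r" "1 \<le> i" "i < 2*n"
    using ops(3,4) that by auto
  show "realizes n r {1..n} C (\<lambda>s. \<iota> (cols n s))"
  proof (rule realizes_pairs)
    show "inj_on \<iota> ?D"
    proof (rule inj_onI)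
      fix ab ab' assume h: "ab \<in> ?D" "ab' \<in> ?D" "\<iota> ab = \<iota> ab'"
      obtain L R L' R' where e: "ab = (L, R)" "ab' = (L', R')" by (cases ab; cases ab')
      then have "finite L" "finite R" "finite L'" "finite R'" using h(1,2) columnsD by blast+
      then show "ab = ab'" using h(3) col_inj e by (simp add: \<iota>_def)
    qed
    show "\<iota> ab \<in> elems C" if "tableau_pair n r ab" for ab
      unfolding C_def elems_tableaux_pair[OF h] using that
      by (auto simp: tableau_pair_def \<iota>_def image_iff split: prod.splits)
    show "weight C (\<iota> (L, R)) j = weight (words n (card L)) (col L) j + weight (words n (card R)) (col R) j"
      if "(L, R) \<in> ?D" for L R j
    proof -
      have "?h = card L" "r = card R" using that by (auto simp: columns_def)
      then show ?thesis
        using weight_words_append[of "col L" "card L" n "card R" "col R" j]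
        by (simp add: C_def \<iota>_def tableaux_def)
    qed
    have pos: "1 \<le> j" if "j = 0 \<Longrightarrow> 0 \<in> {1..n}" for j :: nat
      using that by (cases "j = 0") auto
    show "f_op C j (\<iota> ab) = map_option \<iota> (pair_down n j ab)"
      "e_op C j (\<iota> ab) = map_option \<iota> (pair_up n j ab)"
      if "ab \<in> ?D" "j < 2*n" "j = 0 \<Longrightarrow> 0 \<in> {1..n}" for ab j
      using ops(1,2)[OF that(1) pos[OF that(3)] that(2)] by auto
  qed (use n in auto)
qed

section \<open>The square case\<close>

lemma model_full:
  assumes "s \<in> model n n" "k \<in> {1..n}" shows "s k \<noteq> Off"
proof -
  have "(\<Sum>k=1..n. of_bool (s k = Off)) = (\<Sum>k=1..n. 1 - of_bool (s k \<noteq> Off) :: int)"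
    by (rule sum.cong) auto
  also have "\<dots> = 0" using modelD(5)[OF assms(1)] by (simp add: sum_subtractf)
  finally have "\<forall>k\<in>{1..n}. of_bool (s k = Off) = (0::int)"
    by (subst (asm) sum_nonneg_eq_0_iff) auto
  then show ?thesis using assms(2) by auto
qed

text \<open>
  Without \<open>Off\<close>, the difference of the two counts is the total balance of the brackets.
\<close>

lemma model_half:
  assumes "s \<in> model n n"
  shows "card (left_col n s \<inter> {..<Suc n}) = card (right_col n s \<inter> {..<Suc n})"
proof -
  have c: "int (card (S \<inter> {..<Suc n})) = (\<Sum>k=1..n. of_bool (k \<in> S))" if "S \<subseteq> {1..2*n}" for S
  proof -
    have "S \<inter> {..<Suc n} = {1..n} \<inter> {k. k \<in> S}" using that by (auto simp: less_Suc_eq_le subset_eq)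
    then show ?thesis by simp
  qed
  have "(\<Sum>k=1..n. of_bool (k \<in> left_col n s)) - (\<Sum>k=1..n. of_bool (k \<in> right_col n s)) =
      (\<Sum>k=1..n. of_bool (k \<in> left_col n s) - of_bool (k \<in> right_col n s) :: int)"
    by (simp add: sum_subtractf)
  also have "\<dots> = (\<Sum>k=1..n. bal (s k))"
  proof (rule sum.cong)
    fix k assume k: "k \<in> {1..n}"
    then have k': "1 \<le> k" "k \<le> n" by auto
    show "of_bool (k \<in> left_col n s) - of_bool (k \<in> right_col n s) = bal (s k)"
      unfolding mem_left_col[OF k'] mem_right_col[OF k'] using model_full[OF assms k] by (cases "s k") auto
  qed simp
  also have "\<dots> = 0" using modelD(2)[OF assms] by (simp add: depth_def)
  finally show ?thesis using c[OF cols_range(1), of s] c[OF cols_range(2), of s] by linarith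
qed

lemma movable_shift_up:
  assumes "S \<in> columns n h" "1 \<le> n"
  shows "movable 1 2 (shift_up n S) = movable (2*n) 1 S" "movable 2 1 (shift_up n S) = movable 1 (2*n) S"
  using move_shift_up[OF assms] move_cases[of 1 2 "shift_up n S"] move_cases[of 2 1 "shift_up n S"]
    move_cases[of "2*n" 1 S] move_cases[of 1 "2*n" S] by auto

text \<open>
  If the first state is \<open>Open\<close>, both sides vanish by \<open>psi_inv_preimage_mixed\<close>. Otherwise the tableau
  and its image under the virtual operator are related to their \<open>\<psi>\<close>-images by \<open>shift_up\<close>, and
  the operators are transported along \<open>\<psi>\<^sup>-\<^sup>1\<close>, reading words and \<open>shift_up\<close> in turn.
\<close>

lemma rect_zero:
  assumes s: "s \<in> model n n" and n: "2 \<le> n"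
  defines "\<iota> \<equiv> \<lambda>(A, B). [col A, col B]" and "R \<equiv> rect_crystal n n 2"
  shows "virtual_op n (f_op R) 0 (\<iota> (cols n s)) = map_option (\<lambda>s. \<iota> (cols n s)) (lower_op n 0 s)"
    and "virtual_op n (e_op R) 0 (\<iota> (cols n s)) = map_option (\<lambda>s. \<iota> (cols n s)) (raise_op n 0 s)"
    and "phi R 0 (\<iota> (cols n s)) = phi_pair (source n 0) (Suc 0) (cols n s)"
    and "eps R 0 (\<iota> (cols n s)) = eps_pair (source n 0) (Suc 0) (cols n s)"
proof -
  let ?T = "tableaux n [n, n]" and ?psi = "psi_inv n n 2"
  let ?D = "columns n n \<times> columns n n"
  define up where "up = map_prod (shift_up n) (shift_up n)"
  have n1: "1 \<le> n" "1 < 2*n" using n by auto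
  note R0 = rect_pair_zero[OF n, folded R_def]
  have tp: "left_col n s \<in> columns n n" "right_col n s \<in> columns n n" "row_dom (left_col n s) (right_col n s)"
    if "s \<in> model n n" for s
    using cols_tableau_pair[OF that n order_refl] by (simp_all add: tableau_pair_def cols_def)
  have one: "1 \<le> (1::nat)" "1 \<le> n" using n by auto
  have bar: "2*n + 1 - 1 = 2*n" by simp
  have mem: "1 \<in> left_col n s \<longleftrightarrow> s 1 \<in> {Off, Pos, Open}" "2*n \<in> left_col n s \<longleftrightarrow> s 1 \<in> {Off, Neg, Close}"
    "1 \<in> right_col n s \<longleftrightarrow> s 1 \<in> {Pos, Close}" "2*n \<in> right_col n s \<longleftrightarrow> s 1 \<in> {Neg, Open}" for s
    using mem_left_col[OF one, of s] mem_right_col[OF one, of s] unfolding bar by auto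
  have T: "f_op ?T 1 (\<iota> ab) = map_option \<iota> (move_pair 1 2 ab)"
    "e_op ?T 1 (\<iota> ab) = map_option \<iota> (unmove_pair 1 2 ab)"
    "phi ?T 1 (\<iota> ab) = phi_pair 1 2 ab" "eps ?T 1 (\<iota> ab) = eps_pair 1 2 ab" if "ab \<in> ?D" for ab
    using tableaux_pair[of "fst ab" n n "snd ab" n 1, folded \<iota>_def] that n1
    by (auto simp: \<iota>_def numeral_2_eq_2)
  have st: "s 1 = Pos \<or> s 1 = Neg \<or> s 1 = Open"
    using model_full[OF s, of 1] excluded(3)[OF s, of 1] n by (cases "s 1") auto
  have v: "virtual_op n g 0 x = Option.bind (g 0 x) (g 0)" for g and x :: "'b"
    by (simp add: virtual_op_def)
  have "virtual_op n (f_op R) 0 (\<iota> (cols n s)) = map_option (\<lambda>s. \<iota> (cols n s)) (lower_op n 0 s) \<and>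
    virtual_op n (e_op R) 0 (\<iota> (cols n s)) = map_option (\<lambda>s. \<iota> (cols n s)) (raise_op n 0 s) \<and>
    phi R 0 (\<iota> (cols n s)) = phi_pair (source n 0) (Suc 0) (cols n s) \<and>
    eps R 0 (\<iota> (cols n s)) = eps_pair (source n 0) (Suc 0) (cols n s)"
  proof (cases "s 1 = Open")
    case True
    have ex: "\<exists>A0 B0. A0 \<in> columns n n \<and> B0 \<in> columns n n \<and> row_dom A0 B0 \<and>
      ?psi [col A0, col B0] = [col (left_col n s), col (right_col n s)] \<and> 1 \<in> A0 \<and> 2 \<in> A0 \<and> 1 \<notin> B0 \<and> 2 \<notin> B0"
      using psi_inv_preimage_mixed[OF n tp[OF s] _ _ _ _ model_half[OF s]] True mem[of s] by (metis empty_iff insert_iff state.distinct)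
    then obtain A0 B0 where AB: "A0 \<in> columns n n" "B0 \<in> columns n n" "row_dom A0 B0"
      "?psi [col A0, col B0] = \<iota> (cols n s)" "1 \<in> A0" "2 \<in> A0" "1 \<notin> B0" "2 \<notin> B0"
      by (auto simp: \<iota>_def cols_def)
    have el: "\<iota> (A0, B0) \<in> elems ?T" unfolding elems_tableaux_pair[OF n1(1) n1(1)] using AB by (auto simp: \<iota>_def)
    have "(A0, B0) \<in> ?D" using AB by simp
    note T0 = T[OF this]
    have "f_op ?T 1 (\<iota> (A0, B0)) = None" "e_op ?T 1 (\<iota> (A0, B0)) = None"
      "phi ?T 1 (\<iota> (A0, B0)) = 0" "eps ?T 1 (\<iota> (A0, B0)) = 0"
      unfolding T0 using AB
      by (auto simp: move_pair_def unmove_pair_def move_def movable_def phi_pair_def eps_pair_def)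
    then have z: "f_op R 0 (\<iota> (cols n s)) = None" "e_op R 0 (\<iota> (cols n s)) = None"
      "phi R 0 (\<iota> (cols n s)) = 0" "eps R 0 (\<iota> (cols n s)) = 0"
      using R0(1-4)[OF el] AB(4) by (simp_all add: \<iota>_def)
    show ?thesis
      using z virtual_0(3,4)[OF s n] True
      by (simp add: virtual_op_def lower_op_def raise_op_def lower_count_def raise_count_def)
  next
    case False
    then have s1: "s 1 = Pos \<or> s 1 = Neg" using st by blast
    have psi: "?psi (\<iota> (up (cols n t))) = \<iota> (cols n t)" "\<iota> (up (cols n t)) \<in> elems ?T"
      if "t \<in> model n n" "t 1 = Pos \<or> t 1 = Neg" for t
    proof -
      have "2*n \<in> left_col n t \<longleftrightarrow> 2*n \<in> right_col n t" using that(2) mem[of t] by auto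
      from psi_inv_shift_up[OF n tp[OF that(1)] this]
      show "?psi (\<iota> (up (cols n t))) = \<iota> (cols n t)" "\<iota> (up (cols n t)) \<in> elems ?T"
        by (simp_all add: \<iota>_def up_def cols_def)
    qed
    have cs: "cols n s \<in> ?D" using tp[OF s] by (simp add: cols_def)
    have upD: "up ab \<in> ?D" if "ab \<in> ?D" for ab
      using that shift_up_columns n1 by (auto simp: up_def)
    have mv: "move_pair 1 2 (up ab) = map_option up (pair_down n 0 ab)"
      "unmove_pair 1 2 (up ab) = map_option up (pair_up n 0 ab)"
      "phi_pair 1 2 (up ab) = phi_pair (2*n) 1 ab" "eps_pair 1 2 (up ab) = eps_pair (2*n) 1 ab"
      if "ab \<in> ?D" for ab
    proof -
      obtain A B where ab: "ab = (A, B)" "A \<in> columns n n" "B \<in> columns n n" using \<open>ab \<in> ?D\<close> by auto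
      note r = move_shift_up[OF ab(2) n1(1)] move_shift_up[OF ab(3) n1(1)]
        movable_shift_up[OF ab(2) n1(1)] movable_shift_up[OF ab(3) n1(1)]
      have nd: "source n 0 = 2*n" "Suc 0 = 1" by (simp_all add: source_def)
      show "move_pair 1 2 (up ab) = map_option up (pair_down n 0 ab)"
        "unmove_pair 1 2 (up ab) = map_option up (pair_up n 0 ab)"
        "phi_pair 1 2 (up ab) = phi_pair (2*n) 1 ab" "eps_pair 1 2 (up ab) = eps_pair (2*n) 1 ab"
        unfolding pair_down_def pair_up_def nd
        by (simp_all add: ab(1) up_def move_pair_def unmove_pair_def phi_pair_def eps_pair_def r
            option.map_comp comp_def del: One_nat_def)
    qed
    have cl: "ab' \<in> ?D" if "pair_down n 0 ab = Some ab' \<or> pair_up n 0 ab = Some ab'" "ab \<in> ?D" for ab ab'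
      using that n move_pair_columns[of "2*n" 1 "fst ab" "snd ab" "fst ab'" "snd ab'" n n n]
        unmove_pair_columns[of "2*n" 1 "fst ab" "snd ab" "fst ab'" "snd ab'" n n n]
      by (cases ab; cases ab') (auto simp: pair_down_def pair_up_def source_def)
    have Tup: "f_op ?T 1 (\<iota> (up ab)) = map_option (\<lambda>x. \<iota> (up x)) (pair_down n 0 ab)"
      "e_op ?T 1 (\<iota> (up ab)) = map_option (\<lambda>x. \<iota> (up x)) (pair_up n 0 ab)" if "ab \<in> ?D" for ab
      using T(1,2)[OF upD[OF that]] mv(1,2)[OF that] by (simp_all add: option.map_comp comp_def)
    have sT: "seminormal 1 ?T" using tableaux_pair_seminormal[of 1 n n n] n1 by simp
    let ?\<kappa> = "\<lambda>ab. ?psi (\<iota> (up ab))"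
    have el: "\<iota> (up ab') \<in> elems ?T" if "pair_down n 0 (cols n s) = Some ab' \<or> pair_up n 0 (cols n s) = Some ab'" for ab'
      using that
    proof
      assume "pair_down n 0 (cols n s) = Some ab'"
      then have "f_op ?T 1 (\<iota> (up (cols n s))) = Some (\<iota> (up ab'))" using Tup(1)[OF cs] by simp
      from seminormalD(3)[OF sT psi(2)[OF s s1] this] show ?thesis by blast
    next
      assume "pair_up n 0 (cols n s) = Some ab'"
      then have "e_op ?T 1 (\<iota> (up (cols n s))) = Some (\<iota> (up ab'))" using Tup(2)[OF cs] by simp
      from seminormalD(4)[OF sT psi(2)[OF s s1] this] show ?thesis by blast
    qed
    \<comment> \<open>on words with first state \<open>Pos\<close> or \<open>Neg\<close> this map agrees with \<open>\<iota>\<close>, and in this form it carries moves from \<open>2n\<close> to 1 to the node 0\<close>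
    have Rk: "f_op R 0 (?\<kappa> ab) = map_option ?\<kappa> (pair_down n 0 ab)"
      "e_op R 0 (?\<kappa> ab) = map_option ?\<kappa> (pair_up n 0 ab)"
      if "ab \<in> ?D" "\<iota> (up ab) \<in> elems ?T" for ab
      using R0(1,2)[OF that(2)] Tup[OF that(1)] by (simp_all add: option.map_comp comp_def)
    have "virtual_op n (f_op R) 0 (?\<kappa> (cols n s)) = map_option ?\<kappa> (virtual_op n (pair_down n) 0 (cols n s))"
      unfolding v using Rk[OF cs psi(2)[OF s s1]] Rk[OF cl[OF _ cs] el]
      by (intro bind_transport) auto
    also have "\<dots> = map_option (\<lambda>t. ?\<kappa> (cols n t)) (lower_op n 0 s)"
      unfolding virtual_0(1)[OF s n] by (simp add: option.map_comp comp_def)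
    also have "\<dots> = map_option (\<lambda>t. \<iota> (cols n t)) (lower_op n 0 s)"
      using psi(1) op_model(1)[OF s n, of 0] by (auto simp: lower_op_def)
    finally have 1: "virtual_op n (f_op R) 0 (\<iota> (cols n s)) = map_option (\<lambda>s. \<iota> (cols n s)) (lower_op n 0 s)"
      using psi(1)[OF s s1] by simp
    have "virtual_op n (e_op R) 0 (?\<kappa> (cols n s)) = map_option ?\<kappa> (virtual_op n (pair_up n) 0 (cols n s))"
      unfolding v using Rk[OF cs psi(2)[OF s s1]] Rk[OF cl[OF _ cs] el]
      by (intro bind_transport) auto
    also have "\<dots> = map_option (\<lambda>t. ?\<kappa> (cols n t)) (raise_op n 0 s)"
      unfolding virtual_0(2)[OF s n] by (simp add: option.map_comp comp_def)
    also have "\<dots> = map_option (\<lambda>t. \<iota> (cols n t)) (raise_op n 0 s)"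
      using psi(1) op_model(2)[OF s n, of 0] by (auto simp: raise_op_def)
    finally have 2: "virtual_op n (e_op R) 0 (\<iota> (cols n s)) = map_option (\<lambda>s. \<iota> (cols n s)) (raise_op n 0 s)"
      using psi(1)[OF s s1] by simp
    have "phi R 0 (\<iota> (cols n s)) = phi_pair (source n 0) (Suc 0) (cols n s)"
      "eps R 0 (\<iota> (cols n s)) = eps_pair (source n 0) (Suc 0) (cols n s)"
      using R0(3,4)[OF psi(2)[OF s s1]] psi(1)[OF s s1] T(3,4)[OF upD[OF cs]] mv(3,4)[OF cs]
      by (simp_all add: source_def)
    with 1 2 show ?thesis by blast
  qed
  then show "virtual_op n (f_op R) 0 (\<iota> (cols n s)) = map_option (\<lambda>s. \<iota> (cols n s)) (lower_op n 0 s)"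
    "virtual_op n (e_op R) 0 (\<iota> (cols n s)) = map_option (\<lambda>s. \<iota> (cols n s)) (raise_op n 0 s)"
    "phi R 0 (\<iota> (cols n s)) = phi_pair (source n 0) (Suc 0) (cols n s)"
    "eps R 0 (\<iota> (cols n s)) = eps_pair (source n 0) (Suc 0) (cols n s)" by blast+
qed

lemma ambient_square:
  assumes n: "2 \<le> n"
  defines "\<iota> \<equiv> \<lambda>(A, B). [[col A, col B]]" and "A \<equiv> ambient n n"
  shows "realizes n n {0..n} A (\<lambda>s. \<iota> (cols n s))"
    and "s \<in> model n n \<Longrightarrow> i < 2*n \<Longrightarrow> phi A i (\<iota> (cols n s)) = phi_pair (source n i) (Suc i) (cols n s)"
    and "s \<in> model n n \<Longrightarrow> i < 2*n \<Longrightarrow> eps A i (\<iota> (cols n s)) = eps_pair (source n i) (Suc i) (cols n s)"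
proof -
  define \<kappa> :: "nat set \<times> nat set \<Rightarrow> tableau" where "\<kappa> = (\<lambda>(A, B). [col A, col B])"
  let ?R = "rect_crystal n n 2" and ?T = "tableaux n [n, n]"
  have A: "A = tensor_list [?R]" by (simp add: A_def ambient_def)
  have i\<kappa>: "\<iota> ab = [\<kappa> ab]" for ab by (simp add: \<iota>_def \<kappa>_def split: prod.split)
  have n1: "1 \<le> n" "n \<le> n" using n by auto
  have "2*n - n = n" by simp
  note two = two_column_tableaux[OF n n1, folded \<kappa>_def, unfolded this]
  have T: "\<And>s. s \<in> model n n \<Longrightarrow> \<kappa> (cols n s) \<in> elems ?T"
    "\<And>s. s \<in> model n n \<Longrightarrow> weight ?T (\<kappa> (cols n s)) = Psi n (model_weight n s)"
    "inj_on (\<lambda>s. \<kappa> (cols n s)) (model n n)"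
    "\<And>s i. s \<in> model n n \<Longrightarrow> 1 \<le> i \<Longrightarrow> i \<le> n \<Longrightarrow>
      virtual_op n (f_op ?T) i (\<kappa> (cols n s)) = map_option (\<lambda>s. \<kappa> (cols n s)) (lower_op n i s)"
    "\<And>s i. s \<in> model n n \<Longrightarrow> 1 \<le> i \<Longrightarrow> i \<le> n \<Longrightarrow>
      virtual_op n (e_op ?T) i (\<kappa> (cols n s)) = map_option (\<lambda>s. \<kappa> (cols n s)) (raise_op n i s)"
    using two(1) by (simp_all add: realizes_def)
  have rep: "replicate 2 n = [n, n]" by (simp add: numeral_2_eq_2)
  have RT: "elems ?R = elems ?T" "weight ?R = weight ?T"
    "i \<noteq> 0 \<Longrightarrow> f_op ?R i = f_op ?T i" "i \<noteq> 0 \<Longrightarrow> e_op ?R i = e_op ?T i" for i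
    by (simp_all add: rect_crystal_simps rep)
  have pe: "phi ?R i = phi ?T i" "eps ?R i = eps ?T i" if "i \<noteq> 0" for i
    by (simp_all add: phi_def eps_def fun_eq_iff RT(3,4)[OF that])
  have sR: "seminormal i ?R" if "i < 2*n" for i
  proof (cases "i = 0")
    case True then show ?thesis using rect_pair_zero(5)[OF n] by simp
  next
    case False
    then have "seminormal i ?T" using tableaux_pair_seminormal[of i n n n] that n1 by simp
    then show ?thesis using False RT pe by (simp add: seminormal_def)
  qed
  have R: "phi ?R i (\<kappa> (cols n s)) = phi_pair (source n i) (Suc i) (cols n s)"
    "eps ?R i (\<kappa> (cols n s)) = eps_pair (source n i) (Suc i) (cols n s)" if "s \<in> model n n" "i < 2*n" for s i
    using rect_zero(3,4)[OF that(1) n, folded \<kappa>_def] two(2,3)[OF that(1), of i] pe that(2) by (cases "i = 0"; simp)+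
  note single = tensor_single[OF sR, folded A]
  show "phi A i (\<iota> (cols n s)) = phi_pair (source n i) (Suc i) (cols n s)"
    "eps A i (\<iota> (cols n s)) = eps_pair (source n i) (Suc i) (cols n s)" if "s \<in> model n n" "i < 2*n"
    using single(3,4)[OF that(2), of "\<kappa> (cols n s)"] R[OF that] T(1)[OF that(1)] by (simp_all add: i\<kappa> RT)
  have vR: "virtual_op n (f_op ?R) i (\<kappa> (cols n s)) = map_option (\<lambda>s. \<kappa> (cols n s)) (lower_op n i s)"
    "virtual_op n (e_op ?R) i (\<kappa> (cols n s)) = map_option (\<lambda>s. \<kappa> (cols n s)) (raise_op n i s)"
    if "s \<in> model n n" "i \<le> n" for s i
  proof -
    have "2*n - i \<noteq> 0" using that(2) n by simp
    then have "virtual_op n (f_op ?R) i b = virtual_op n (f_op ?T) i b"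
      "virtual_op n (e_op ?R) i b = virtual_op n (e_op ?T) i b" if "i \<noteq> 0" for b
      using that RT(3,4)[of i] RT(3,4)[of "2*n - i"] RT(3,4)[of n] n by (auto simp: virtual_op_def)
    then show "virtual_op n (f_op ?R) i (\<kappa> (cols n s)) = map_option (\<lambda>s. \<kappa> (cols n s)) (lower_op n i s)"
      "virtual_op n (e_op ?R) i (\<kappa> (cols n s)) = map_option (\<lambda>s. \<kappa> (cols n s)) (raise_op n i s)"
      using rect_zero(1,2)[OF that(1) n, folded \<kappa>_def] T(4,5)[OF that(1), of i] that(2) by (cases "i = 0"; simp)+
  qed
  show "realizes n n {0..n} A (\<lambda>s. \<iota> (cols n s))"
    unfolding realizes_def
  proof (intro conjI ballI)
    show "inj_on (\<lambda>s. \<iota> (cols n s)) (model n n)" using T(3) by (simp add: i\<kappa> inj_on_def)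
    fix s assume s: "s \<in> model n n"
    show "\<iota> (cols n s) \<in> elems A"
      using T(1)[OF s] by (simp add: A i\<kappa> tensor_list_def elems_tensor_cons RT)
    have "weight A [t] = weight ?R t" for t
      by (rule ext) (simp add: A tensor_list_def weight_tensor_cons)
    then show "weight A (\<iota> (cols n s)) = Psi n (model_weight n s)" using T(2)[OF s] by (simp add: i\<kappa> RT)
    fix i assume "i \<in> {0..n}"
    then have i: "i \<le> n" "i < 2*n" "i \<noteq> 0 \<Longrightarrow> 2*n - i < 2*n" using n by auto
    have k: "\<kappa> (cols n s) \<in> elems ?R" using T(1)[OF s] by (simp add: RT)
    have "virtual_op n (f_op A) i [\<kappa> (cols n s)] = map_option (\<lambda>t. [t]) (virtual_op n (f_op ?R) i (\<kappa> (cols n s)))"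
      "virtual_op n (e_op A) i [\<kappa> (cols n s)] = map_option (\<lambda>t. [t]) (virtual_op n (e_op ?R) i (\<kappa> (cols n s)))"
      unfolding virtual_op_def
      using single(1,2)[OF i(2) k] single(1,2)[OF i(2)] single(1,2)[OF i(3)] seminormalD(3,4)[OF sR[OF i(2)] k]
      by (auto intro!: bind_transport[where \<iota> = "\<lambda>t. [t]"])
    then show "virtual_op n (f_op A) i (\<iota> (cols n s)) = map_option (\<lambda>s. \<iota> (cols n s)) (lower_op n i s)"
      "virtual_op n (e_op A) i (\<iota> (cols n s)) = map_option (\<lambda>s. \<iota> (cols n s)) (raise_op n i s)"
      using vR[OF s i(1)] by (simp_all add: i\<kappa> option.map_comp comp_def)
  qed
qed

lemma yamanouchi_col: "yamanouchi hs = map (\<lambda>h. col {1..h}) hs"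
proof -
  have "col {1..h} = rev [1..<Suc h]" for h
  proof -
    have "set (rev [1..<Suc h]) = {1..h}" by auto
    moreover have "sorted_wrt (>) (rev [1..<Suc h])" by (simp add: sorted_wrt_rev del: upt_Suc)
    ultimately show ?thesis using col_eqI by metis
  qed
  then show ?thesis by (simp add: yamanouchi_def del: upt_Suc)
qed

theorem theorem6p23:
  fixes n r :: nat
  assumes "2 \<le> n" and "1 \<le> r" and "r \<le> n"
  shows "virtual_weights_exist n (ambient n r) (V_set n r) \<and>
         is_affine_C_crystal n (V_crystal n r) \<and>
         aligned n (ambient n r) (V_set n r) \<and>
         virtual_weights_exist n (tableaux n [2*n - r, r]) (V_Lambda_set n r) \<and>
         is_C_crystal n (V_crystal n r) \<and>
         is_C_crystal n (V_Lambda n r) \<and>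
         crystal_isomorphic {1..n} (V_crystal n r) (V_Lambda n r)"
proof -
  define \<kappa> :: "nat set \<times> nat set \<Rightarrow> tableau" where "\<kappa> = (\<lambda>(A, B). [col A, col B])"
  define \<iota> :: "nat set \<times> nat set \<Rightarrow> tableau list" where
    "\<iota> = (if r < n then (\<lambda>(A, B). [[col A], [col B]]) else (\<lambda>(A, B). [[col A, col B]]))"
  have A: "realizes n r {0..n} (ambient n r) (\<lambda>s. \<iota> (cols n s))"
    and phi: "\<And>s i. s \<in> model n r \<Longrightarrow> i < 2*n \<Longrightarrow>
      phi (ambient n r) i (\<iota> (cols n s)) = phi_pair (source n i) (Suc i) (cols n s)"
    and eps: "\<And>s i. s \<in> model n r \<Longrightarrow> i < 2*n \<Longrightarrow>
      eps (ambient n r) i (\<iota> (cols n s)) = eps_pair (source n i) (Suc i) (cols n s)"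
    using ambient_less[OF assms(1,2)] ambient_square[OF assms(1)] assms(3)
    by (cases "r < n"; simp add: \<iota>_def)+
  have T: "realizes n r {1..n} (tableaux n [2*n - r, r]) (\<lambda>s. \<kappa> (cols n s))"
    using two_column_tableaux(1)[OF assms] by (simp add: \<kappa>_def)
  have top: "cols n (top_word r) = ({1..2*n - r}, {1..r})"
    using left_col_top[OF assms(3)] right_col_top[OF assms(3)] by (simp add: cols_def)
  have V: "V_set n r = (\<lambda>s. \<iota> (cols n s)) ` model n r"
    using generated_eq_model[OF A _ _ assms(1,3)] assms
    by (simp add: V_set_def top \<iota>_def yamanouchi_col split: if_splits)
  have L: "V_Lambda_set n r = (\<lambda>s. \<kappa> (cols n s)) ` model n r"
    using generated_eq_model[OF T _ _ assms(1,3)]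
    by (simp add: V_Lambda_set_def top \<kappa>_def yamanouchi_col)
  have sub: "{1..n} \<subseteq> {0..n}" "{0..n} \<subseteq> {0..n}" "{1..n} \<subseteq> {1..n}" by auto
  note cA = realized_virtual_crystal[OF A sub(1,2) assms(1,3), folded V]
  note cT = realized_virtual_crystal[OF T sub(3,1) assms(1,3), folded L]
  have "aligned n (ambient n r) (V_set n r)"
    unfolding V by (rule aligned_model[where r = r, OF assms(1)]) (use phi eps in auto)
  then show ?thesis
    using cA(1,2) cA(3)[OF refl] cT(1,2)
      realized_isomorphic[OF A sub(1,2) T sub(3,1) assms(1,3), folded V L]
    by (simp add: V_crystal_def V_Lambda_def)
qed

end
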